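(* Let $c\in\mathbb{C}$, $c\ne0$, let $\tau_1,\tau_2,\tau_3,\tau_4\in\mathbb{C}$ be distinct, and let $\sigma_1,\dots,\sigma_4\in\mathbb{C}$ be constants, not necessarily distinct, with $\sigma_j\neq\tau_k$ for all $j,k$. Define $r_0,\dots,r_4$ by $c\prod_{j=1}^4(u-\sigma_j)=r_4u^4+r_3u^3+r_2u^2+r_1u+r_0$, and consider the equation $$S(u,z)=c\,\frac{(u-\sigma_1)(u-\sigma_2)(u-\sigma_3)(u-\sigma_4)}{(u-\tau_1)(u-\tau_2)(u-\tau_3)(u-\tau_4)}=\frac{r_4u^4+r_3u^3+r_2u^2+r_1u+r_0}{(u-\tau_1)(u-\tau_2)(u-\tau_3)(u-\tau_4)}.\qquad(\ast)$$ (1) All transcendental meromorphic solutions of $(\ast)$ on $\mathbb{C}$ are elliptic functions of the form $$u(z)=a-\frac{b}{\wp(z-z_0;g_2,g_3)-d},\qquad(\ast\ast)$$ where $z_0\in\mathbb{C}$ is arbitrary, $a=\tau_i$ for some $i\in\{1,2,3,4\}$, and $b,d,g_2,g_3$ are constants that depend on $c$ and the $\sigma_j,\tau_j$. (2) Put $$e_1=\sum_{j=1}^4\tau_j,\quad e_2=\sum_{1\le j<k\le4}\tau_j\tau_k,\quad e_3=\sum_{1\le j<k<l\le4}\tau_j\tau_k\tau_l,\quad e_4=\prod_{j=1}^4\tau_j,\qquad q_i=\prod_{\substack{1\le j\le4\\ j\ne i}}(\tau_i-\tau_j).$$ For $i\in\{1,2,3,4\}$ and constants $b,d,g_2,g_3\in\mathbb{C}$,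 equation $(\ast)$ admits solutions of the form $(\ast\ast)$ with $a=\tau_i$ if and only if the following relations hold: $$r_0=\frac{b}{2q_i}(3e_3^2-8e_2e_4),\quad r_1=\frac{2b}{q_i}(6e_1e_4-e_2e_3),\quad r_2=\frac{b}{q_i}(2e_2^2-3e_1e_3-24e_4),$$ $$r_3=\frac{2b}{q_i}(6e_3-e_1e_2),\quad r_4=\frac{b}{2q_i}(3e_1^2-8e_2),$$ $$d=\frac{b}{6q_i}\Bigg[\sum_{\substack{1\le j<k\le4\\ j,k\ne i}}(\tau_j-\tau_k)^2-\sum_{\substack{1\le j\le4\\ j\ne i}}2(\tau_i-\tau_j)^2\Bigg],$$ $$g_2=\frac{4b^2}{3q_i^2}(e_2^2-3e_1e_3+12e_4),\quad g_3=\frac{4b^3}{27q_i^3}(2e_2^3-9e_1e_2e_3-72e_2e_4+27e_3^2+27e_1^2e_4),$$ $$\Delta=g_2^3-27g_3^2=\frac{16b^6}{q_i^6}\prod_{1\le j<k\le4}(\tau_j-\tau_k)^2\ne0.$$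
   Context: For a nonconstant meromorphic function $u$, the Schwarzian derivative is $S(u,z)=\left(\frac{u''}{u'}\right)'-\frac12\left(\frac{u''}{u'}\right)^2=\frac{u'''}{u'}-\frac32\left(\frac{u''}{u'}\right)^2$. Solutions are nonconstant; "transcendental" means not rational. $\wp(z;g_2,g_3)$ is the Weierstrass elliptic function with invariants $g_2,g_3$, satisfying $\wp'^2=4\wp^3-g_2\wp-g_3$ with $g_2^3-27g_3^2\ne0$. *)

theory Defs
  imports "HOL-Complex_Analysis.Complex_Analysis"
begin

(* Meromorphic functions on the plane are represented by total functions, whose values at poles
   and removable singularities are immaterial.  Identities between meromorphic functions are
   therefore always stated on the complement of a closed discrete set (the cosparse filter). *)

definition Schwarzian :: "(complex \<Rightarrow> complex) \<Rightarrow> complex \<Rightarrow> complex" where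
  "Schwarzian u z =
     deriv (\<lambda>w. deriv (deriv u) w / deriv u w) z - (1/2) * (deriv (deriv u) z / deriv u z)\<^sup>2"

definition Schwarzian_solution :: "(complex \<Rightarrow> complex) \<Rightarrow> (complex \<Rightarrow> complex) \<Rightarrow> bool" where
  "Schwarzian_solution R u \<longleftrightarrow>
     u meromorphic_on UNIV \<and> \<not> (\<exists>k. \<forall>\<^sub>\<approx>z. u z = k) \<and> (\<forall>\<^sub>\<approx>z. Schwarzian u z = R (u z))"

definition transcendental :: "(complex \<Rightarrow> complex) \<Rightarrow> bool" where
  "transcendental u \<longleftrightarrow> \<not> (\<exists>p q. q \<noteq> 0 \<and> (\<forall>\<^sub>\<approx>z. u z = poly p z / poly q z))"

(* Im (w2 / w1) \<noteq> 0 says that w1, w2 are linearly independent over the reals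
   (it fails for w1 = 0 because w2 / 0 = 0). *)
definition elliptic :: "(complex \<Rightarrow> complex) \<Rightarrow> bool" where
  "elliptic f \<longleftrightarrow> f meromorphic_on UNIV \<and>
     (\<exists>w1 w2. Im (w2 / w1) \<noteq> 0 \<and> (\<forall>\<^sub>\<approx>z. f (z + w1) = f z) \<and> (\<forall>\<^sub>\<approx>z. f (z + w2) = f z))"

definition is_lattice :: "complex set \<Rightarrow> bool" where
  "is_lattice L \<longleftrightarrow>
     (\<exists>w1 w2. Im (w2 / w1) \<noteq> 0 \<and> L = {of_int m * w1 + of_int n * w2 | m n :: int. True})"

definition lattice_g2 :: "complex set \<Rightarrow> complex" where
  "lattice_g2 L = 60 * (\<Sum>\<^sub>\<infinity>w\<in>L - {0}. 1 / w ^ 4)"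

definition lattice_g3 :: "complex set \<Rightarrow> complex" where
  "lattice_g3 L = 140 * (\<Sum>\<^sub>\<infinity>w\<in>L - {0}. 1 / w ^ 6)"

definition lattice_wp :: "complex set \<Rightarrow> complex \<Rightarrow> complex" where
  "lattice_wp L z = 1 / z\<^sup>2 + (\<Sum>\<^sub>\<infinity>w\<in>L - {0}. 1 / (z - w)\<^sup>2 - 1 / w\<^sup>2)"

(* For g2 ^ 3 - 27 * g3 ^ 2 \<noteq> 0 there is exactly one lattice with invariants g2, g3
   (uniformization); for other g2, g3 there is none and the value is meaningless. *)
definition wp :: "complex \<Rightarrow> complex \<Rightarrow> complex \<Rightarrow> complex" where
  "wp g2 g3 = lattice_wp (THE L. is_lattice L \<and> lattice_g2 L = g2 \<and> lattice_g3 L = g3)"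

definition wp_form ::
  "complex \<Rightarrow> complex \<Rightarrow> complex \<Rightarrow> complex \<Rightarrow> complex \<Rightarrow> complex \<Rightarrow> complex \<Rightarrow> complex" where
  "wp_form a b d g2 g3 z0 z = a - b / (wp g2 g3 (z - z0) - d)"

end

theory Submission
  imports Defs
begin

text \<open>Write Q for the monic quartic with the roots tau_j and S(u) = P(u)/Q(u) for the equation. Three ideas
combine.

First, a quadratic first integral. Where a meromorphic u takes a value with multiplicity n, S(u) has
the leading term (1 - n^2)/2 times (z - z0)^(-2). The right-hand side is finite unless u takes some
tau_j, and there its pole has order exactly n. Comparing orders, u takes every tau_j with
multiplicity two and every other value, infinity included, with multiplicity one. Therefore
v = u'^2/Q(u) extends to an entire function without zeros, and the leading coefficients show that v
has one and the same value kappa at all points where u takes tau_1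
(\<open>Schwarzian_solution_first_integral_local\<close>).

Second, v is constant (\<open>Schwarzian_first_integral\<close>). Let h be entire with h'^2 = v. A Moebius
map that sends tau_1 to infinity turns u into a function y with
y'^2 = h'^2 (4 y^3 - g2 y - g3); uniqueness for this equation gives y = wp(h + zeta)
(\<open>lattice_wp_lift\<close>). So h'^2 = kappa wherever h + zeta meets the period lattice. If h' were
large somewhere, then, as in the proof of Bloch's theorem, h would be almost linear with large
derivative on a small disc whose image covers a whole period parallelogram, and would therefore meet
the lattice at a point where h' is far larger than kappa allows
(\<open>bounded_deriv_if_bounded_over_net\<close>). Hence h' is bounded, thus constant.

Once u'^2 = K Q(u), differentiation gives S(u) = K (4 Q Q'' - 3 Q'^2)(u) / (8 Q(u))
(\<open>Schwarzian_of_square_ode\<close>), so P is K/8 times 4 Q Q'' - 3 Q'^2; these are the relations for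
the r_i, with K = -4 b / q_i. The same Moebius map, now with root tau_i, brings u'^2 = K Q(u) into the
form x'^2 = 4 x^3 - g2 x - g3 and yields d, g2 and g3. All steps can be reversed.

Third, since wp is given by its invariants, every pair with nonzero discriminant must belong to
exactly one lattice (\<open>uniformization\<close>). Here a solution of y'^2 = 4 y^3 - g2 y - g3 with a pole
at 0 is obtained by inverting an elliptic integral and is extended to the plane by the duplication
formula. Its poles are its periods. They are relatively dense, because on a large disc without poles
Cauchy's estimates make y' and y'' small, which pushes y towards a double root of the cubic. So the
poles form a lattice, and Liouville's theorem identifies the solution with the function wp of that
lattice.\<close>

section \<open>Uniqueness for the Weierstrass equation\<close>
lemma eventually_at_imp_eventually_nhds:
  fixes z :: complex
  assumes "eventually P (at z)"
  shows "eventually (\<lambda>w. eventually P (nhds w)) (at z)"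
proof -
  obtain S where S: "open S" "z \<in> S" "\<forall>x\<in>S. x \<noteq> z \<longrightarrow> P x"
    using assms unfolding eventually_at_topological by auto
  have "open (S - {z})" using S by auto
  then have "\<forall>w\<in>S - {z}. eventually P (nhds w)"
    unfolding eventually_nhds using S by (metis DiffE insertI1)
  then show ?thesis
    unfolding eventually_at_topological using S by auto
qed

lemma eventually_cosparse_imp_nhds:
  fixes A :: "complex set"
  assumes "eventually P (cosparse A)" "open A"
  shows "eventually (\<lambda>w. eventually P (nhds w)) (cosparse A)"
  using assms eventually_at_imp_eventually_nhds by (auto simp: eventually_cosparse_open_eq)

lemma deriv_eq_at:
  fixes f g :: "complex \<Rightarrow> complex"
  assumes "eventually (\<lambda>w. f w = g w) (at z)"
  shows "eventually (\<lambda>w. deriv f w = deriv g w) (at z)"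
  using eventually_at_imp_eventually_nhds[OF assms] by eventually_elim (auto intro: deriv_cong_ev)

lemma meromorphic_eq_cosparseI:
  assumes "f meromorphic_on A" "g meromorphic_on A" "open A" "connected A" "z0 \<in> A"
    and ev: "eventually (\<lambda>z. f z = g z) (at z0)"
  shows "\<forall>\<^sub>\<approx>z\<in>A. f z = g z"
proof -
  have "(\<lambda>z. f z - g z) meromorphic_on A"
    using assms by (intro meromorphic_intros)
  then consider "\<forall>\<^sub>\<approx>z\<in>A. f z - g z = 0" | "\<forall>\<^sub>\<approx>z\<in>A. f z - g z \<noteq> 0"
    using meromorphic_imp_constant_or_avoid assms by blast
  then show ?thesis
  proof cases
    case 1
    then show ?thesis by simp
  next
    case 2
    then have "eventually (\<lambda>z. f z - g z \<noteq> 0) (at z0)"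
      using assms eventually_cosparse_imp_eventually_at by blast
    with ev have "eventually (\<lambda>z. False) (at z0)" by eventually_elim auto
    then show ?thesis by simp
  qed
qed

text \<open>The product of D with exp(- A), where A' = m, has derivative 0.\<close>
lemma linear_ode_zero:
  assumes D: "D holomorphic_on ball z r" and m: "m holomorphic_on ball z r"
    and ode: "\<And>w. w \<in> ball z r \<Longrightarrow> deriv D w = m w * D w"
    and "D z = 0" and w: "w \<in> ball z r"
  shows "D w = 0"
proof -
  obtain A where A: "\<And>x. x \<in> ball z r \<Longrightarrow> (A has_field_derivative m x) (at x within ball z r)"
    using holomorphic_convex_primitive'[OF convex_ball open_ball m] by blast
  have "\<exists>c. \<forall>x\<in>ball z r. D x * exp (- A x) = c"
  proof (rule has_field_derivative_zero_constant)
    fix x assume x: "x \<in> ball z r"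
    have d: "(D has_field_derivative m x * D x) (at x within ball z r)"
      using holomorphic_derivI[OF D open_ball x] ode[OF x] by simp
    show "((\<lambda>x. D x * exp (- A x)) has_field_derivative 0) (at x within ball z r)"
      by (rule derivative_eq_intros d A x refl | simp add: algebra_simps)+
  qed auto
  then obtain c where c: "\<forall>x\<in>ball z r. D x * exp (- A x) = c" by auto
  have "z \<in> ball z r" using w zero_le_dist[of z w] by (auto simp del: zero_le_dist)
  then have "c = 0" using c assms by force
  then show ?thesis using c w by simp
qed

text \<open>The difference D of the two functions satisfies D' (y1' + y2') = p D, and y1' + y2' does not vanish
at the base point; so D solves a linear equation of first order. The hypothesis fits any pair of
solutions of y'^2 = F(z, y) with F polynomial in y, for then F(z, y1) - F(z, y2) is divisible by
y1 - y2.\<close>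
lemma regular_ode_unique:
  assumes y1: "y1 analytic_on {z}" and y2: "y2 analytic_on {z}" and p: "p analytic_on {z}"
    and eq: "y1 z = y2 z" "deriv y1 z = deriv y2 z" "deriv y1 z \<noteq> 0"
    and ev: "eventually (\<lambda>w. (deriv y1 w)^2 - (deriv y2 w)^2 = p w * (y1 w - y2 w)) (at z)"
  shows "eventually (\<lambda>w. y1 w = y2 w) (nhds z)"
proof -
  define s where "s = (\<lambda>w. deriv y1 w + deriv y2 w)"
  have s: "s analytic_on {z}" unfolding s_def using y1 y2 by (intro analytic_intros)
  have sz: "s z \<noteq> 0" using eq by (simp add: s_def)
  obtain S1 where S1: "open S1" "z \<in> S1" "y1 holomorphic_on S1" using y1 analytic_at by blast
  obtain S2 where S2: "open S2" "z \<in> S2" "y2 holomorphic_on S2" using y2 analytic_at by blast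
  obtain S3 where S3: "open S3" "z \<in> S3" "p holomorphic_on S3" using p analytic_at by blast
  obtain S4 where S4: "open S4" "z \<in> S4" "s holomorphic_on S4" using s analytic_at by blast
  have "eventually (\<lambda>w. s w \<noteq> 0) (nhds z)"
    using s sz analytic_at_imp_isCont[OF s] tendsto_imp_eventually_ne[of s "s z" "at z" 0]
    by (simp add: eventually_nhds_conv_at isCont_def)
  then obtain S5 where S5: "open S5" "z \<in> S5" "\<forall>w\<in>S5. s w \<noteq> 0"
    unfolding eventually_nhds by auto
  obtain S6 where S6: "open S6" "z \<in> S6" "\<forall>w\<in>S6. w \<noteq> z \<longrightarrow> (deriv y1 w)^2 - (deriv y2 w)^2 = p w * (y1 w - y2 w)"
    using ev unfolding eventually_at_topological by auto
  have "open (S1 \<inter> S2 \<inter> S3 \<inter> S4 \<inter> S5 \<inter> S6)"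
    using S1 S2 S3 S4 S5 S6 by (intro open_Int)
  moreover have "z \<in> S1 \<inter> S2 \<inter> S3 \<inter> S4 \<inter> S5 \<inter> S6"
    using S1 S2 S3 S4 S5 S6 by simp
  ultimately obtain r where r: "r > 0" "ball z r \<subseteq> S1 \<inter> S2 \<inter> S3 \<inter> S4 \<inter> S5 \<inter> S6"
    using open_contains_ball by blast
  have h1: "y1 holomorphic_on ball z r" and h2: "y2 holomorphic_on ball z r"
    and h3: "p holomorphic_on ball z r" and h4: "s holomorphic_on ball z r"
    using holomorphic_on_subset S1 S2 S3 S4 r by (meson le_inf_iff)+
  have s0: "\<And>w. w \<in> ball z r \<Longrightarrow> s w \<noteq> 0" using r S5 by blast
  have "y1 w - y2 w = 0" if "w \<in> ball z r" for w
  proof (rule linear_ode_zero[where D="\<lambda>w. y1 w - y2 w" and m="\<lambda>w. p w / s w" and z=z and r=r])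
    show "(\<lambda>w. y1 w - y2 w) holomorphic_on ball z r" "(\<lambda>w. p w / s w) holomorphic_on ball z r"
      using h1 h2 h3 h4 s0 by (auto intro!: holomorphic_intros)
    fix w assume w: "w \<in> ball z r"
    have d: "deriv (\<lambda>w. y1 w - y2 w) w = deriv y1 w - deriv y2 w"
      using h1 h2 w by (intro deriv_diff) (auto intro: holomorphic_on_imp_differentiable_at)
    show "deriv (\<lambda>w. y1 w - y2 w) w = p w / s w * (y1 w - y2 w)"
    proof (cases "w = z")
      case True
      then show ?thesis using d eq by simp
    next
      case False
      then have "(deriv y1 w)^2 - (deriv y2 w)^2 = p w * (y1 w - y2 w)" using r S6 w by blast
      then have "(deriv y1 w - deriv y2 w) * s w = p w * (y1 w - y2 w)"
        by (simp add: s_def power2_eq_square algebra_simps)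
      then show ?thesis unfolding d using s0[OF w] by (simp add: field_simps)
    qed
  qed (use that eq in auto)
  then show ?thesis unfolding eventually_nhds using r
    by (intro exI[of _ "ball z r"]) auto
qed

text \<open>At a pole the substitution y = 1/s^2 makes the equation regular: s'^2 = 1 - g2/4 s^4 - g3/4 s^6.
The order of the pole must be two and its leading coefficient one, so that a square root s with
s' = 1 at the pole exists.\<close>
lemma pole_square_root:
  assumes mero: "y meromorphic_on {z0}" and pole: "is_pole y z0"
    and ode: "\<forall>\<^sub>F w in at z0. (deriv y w)^2 = 4 * y w ^ 3 - g2 * y w - g3"
  obtains s where "s analytic_on {z0}" "s z0 = 0" "deriv s z0 = 1"
    "\<forall>\<^sub>F w in at z0. y w = 1 / (s w)^2"
    "\<forall>\<^sub>F w in at z0. (deriv s w)^2 = 1 - g2/4 * s w ^ 4 - g3/4 * s w ^ 6"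
proof -
  have iso: "isolated_singularity_at y z0" and ness: "not_essential y z0"
    using mero by (auto intro: meromorphic_on_isolated_singularity meromorphic_on_not_essential)
  have "eventually (\<lambda>w. y w \<noteq> 0) (at z0)" using pole non_zero_neighbour_pole by blast
  then have fr: "\<exists>\<^sub>F w in at z0. y w \<noteq> 0" by (simp add: eventually_frequently)
  define k where "k = zor_poly y z0"
  define n where "n = zorder y z0"
  have "n < 0" unfolding n_def using pole iso isolated_pole_imp_neg_zorder by blast
  obtain r where k0: "k z0 \<noteq> 0" and r: "r > 0" "k holomorphic_on cball z0 r"
    "\<forall>w\<in>cball z0 r - {z0}. y w = k w * (w - z0) powi n \<and> k w \<noteq> 0"
    using zorder_exist[OF iso ness fr] unfolding k_def n_def by blast
  define N where "N = nat (- n)"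
  have N: "N \<ge> 1" using \<open>n < 0\<close> by (simp add: N_def)
  have n: "n = - int N" using \<open>n < 0\<close> by (simp add: N_def)
  have ka: "k analytic_on {z0}"
    using r by (meson analytic_at ball_subset_cball centre_in_ball holomorphic_on_subset open_ball)
  have kd: "(k has_field_derivative deriv k w) (at w)" if "w \<in> ball z0 r" for w
    using r that by (meson ball_subset_cball holomorphic_derivI holomorphic_on_subset open_ball)
  have y: "y w = k w / (w - z0) ^ N" if "w \<in> ball z0 r - {z0}" for w
    using r(3) that unfolding n by (auto simp: power_int_minus field_simps)
  have inb: "eventually (\<lambda>w. w \<in> ball z0 r - {z0}) (at z0)"
    using r by (intro eventually_at_in_open) auto
  have dy: "deriv y w = (deriv k w * (w - z0) - of_nat N * k w) / (w - z0) ^ (N+1)"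
    if w: "w \<in> ball z0 r - {z0}" for w
  proof -
    have wz: "w - z0 \<noteq> 0" using w by auto
    have "deriv y w = deriv (\<lambda>w. k w / (w - z0) ^ N) w"
    proof (rule deriv_cong_ev)
      have "eventually (\<lambda>w. w \<in> ball z0 r - {z0}) (nhds w)"
        using w by (intro eventually_nhds_in_open) auto
      then show "\<forall>\<^sub>F w in nhds w. y w = k w / (w - z0) ^ N"
        by eventually_elim (use y in auto)
    qed simp
    also have "((\<lambda>w. k w / (w - z0) ^ N) has_field_derivative
        (deriv k w * (w - z0)^N - k w * (of_nat N * (w - z0) ^ (N - 1))) / ((w - z0) ^ N * (w - z0)^N)) (at w)"
      using w wz by (auto intro!: derivative_eq_intros kd)
    then have "deriv (\<lambda>w. k w / (w - z0) ^ N) w =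
       (deriv k w * (w - z0)^N - k w * (of_nat N * (w - z0) ^ (N - 1))) / ((w - z0) ^ N * (w - z0)^N)"
      by (rule DERIV_imp_deriv)
    also have "\<dots> = (deriv k w * (w - z0) - of_nat N * k w) / (w - z0) ^ (N+1)"
    proof -
      obtain M where M: "N = Suc M" using N by (cases N) auto
      show ?thesis using wz unfolding M by (simp add: divide_simps) (simp add: algebra_simps)
    qed
    finally show ?thesis .
  qed
  have key: "\<forall>\<^sub>F w in at z0. (deriv k w * (w - z0) - of_nat N * k w)^2 * (w - z0) ^ N =
      (w - z0)^2 * (4 * k w ^ 3 - g2 * k w * (w - z0) ^ (2*N) - g3 * (w - z0) ^ (3*N))"
    using ode inb
  proof eventually_elim
    case (elim w)
    define e where "e = w - z0"
    have e: "e \<noteq> 0" using elim by (auto simp: e_def)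
    have E: "((deriv k w * e - of_nat N * k w) / e ^ (N+1))^2 = 4 * (k w / e ^ N) ^ 3 - g2 * (k w / e ^ N) - g3"
      using elim y dy by (simp add: e_def)
    define t where "t = e ^ N"
    have t: "t \<noteq> 0" using e by (simp add: t_def)
    have E': "((deriv k w * e - of_nat N * k w) / (e * t))^2 = 4 * (k w / t) ^ 3 - g2 * (k w / t) - g3"
      using E by (simp add: t_def)
    have "(deriv k w * e - of_nat N * k w)^2 * t = ((deriv k w * e - of_nat N * k w) / (e * t))^2 * (e^2 * t^3)"
      using t e by (simp add: field_simps power2_eq_square power3_eq_cube)
    also have "\<dots> = (4 * (k w / t) ^ 3 - g2 * (k w / t) - g3) * (e^2 * t^3)" by (simp only: E')
    also have "\<dots> = e^2 * (4 * k w ^ 3 - g2 * k w * t^2 - g3 * t^3)"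
      using t by (simp add: field_simps power2_eq_square power3_eq_cube)
    finally show ?case by (simp add: t_def e_def power_mult mult.commute flip: power_mult)
  qed
  define a where "a = k z0"
  have lk: "(k \<longlongrightarrow> a) (at z0)" unfolding a_def using ka analytic_at_imp_isCont isCont_def by blast
  have "isCont (deriv k) z0" using ka analytic_deriv analytic_at_imp_isCont by blast
  then have ldk: "(deriv k \<longlongrightarrow> deriv k z0) (at z0)" using isCont_def by blast
  have lz: "((\<lambda>w. w - z0) \<longlongrightarrow> 0) (at z0)" by (rule LIM_offset_zero_iff[THEN iffD2]) (auto intro!: tendsto_eq_intros)
  have L1: "((\<lambda>w. (deriv k w * (w - z0) - of_nat N * k w)^2) \<longlongrightarrow> (of_nat N * a)^2) (at z0)"
    by (rule tendsto_eq_intros lk ldk lz refl | simp)+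
  have L2: "((\<lambda>w. 4 * k w ^ 3 - g2 * k w * (w - z0) ^ (2*N) - g3 * (w - z0) ^ (3*N)) \<longlongrightarrow> 4 * a ^ 3) (at z0)"
    using N by (auto intro!: tendsto_eq_intros lk lz simp: power_0_left)
  have ne: "\<forall>\<^sub>F w in at z0. w - z0 \<noteq> 0" using inb by eventually_elim auto
  \<comment> \<open>The left-hand side of the equation has a pole of order 2 N + 2, the right-hand side one of order 3 N;
    for N = 2 the leading terms give 4 a^2 = 4 a^3.\<close>
  have "N = 2 \<and> a = 1"
  proof -
    consider "N = 1" | "N = 2" | M where "N = M + 3"
      using N by (metis One_nat_def Suc_1 add.commute le_antisym le_add_diff_inverse not_less_eq_eq numeral_3_eq_3)
    then show ?thesis
    proof cases
      case 1
      have "\<forall>\<^sub>F w in at z0. (deriv k w * (w - z0) - of_nat N * k w)^2 =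
        (w - z0) * (4 * k w ^ 3 - g2 * k w * (w - z0) ^ (2*N) - g3 * (w - z0) ^ (3*N))"
        using key ne by eventually_elim (simp add: 1 power2_eq_square mult.commute)
      then have "((\<lambda>w. (w - z0) * (4 * k w ^ 3 - g2 * k w * (w - z0) ^ (2*N) - g3 * (w - z0) ^ (3*N))) \<longlongrightarrow> (of_nat N * a)^2) (at z0)"
        using L1 by (rule tendsto_cong[THEN iffD1]) 
      moreover have "((\<lambda>w. (w - z0) * (4 * k w ^ 3 - g2 * k w * (w - z0) ^ (2*N) - g3 * (w - z0) ^ (3*N))) \<longlongrightarrow> 0 * (4 * a^3)) (at z0)"
        by (rule tendsto_mult lz L2)+
      ultimately have "(of_nat N * a)^2 = 0 * (4 * a^3)" using tendsto_unique[OF trivial_limit_at] by blast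
      then show ?thesis using k0 N 1 by (simp add: a_def)
    next
      case 2
      have "\<forall>\<^sub>F w in at z0. (deriv k w * (w - z0) - of_nat N * k w)^2 =
        (4 * k w ^ 3 - g2 * k w * (w - z0) ^ (2*N) - g3 * (w - z0) ^ (3*N))"
        using key ne by eventually_elim (simp add: 2 mult.commute)
      then have "((\<lambda>w. (4 * k w ^ 3 - g2 * k w * (w - z0) ^ (2*N) - g3 * (w - z0) ^ (3*N))) \<longlongrightarrow> (of_nat N * a)^2) (at z0)"
        using L1 by (rule tendsto_cong[THEN iffD1]) 
      then have "(of_nat N * a)^2 = 4 * a^3" using tendsto_unique[OF trivial_limit_at] L2 by blast
      then show ?thesis using k0 2 by (simp add: a_def power2_eq_square power3_eq_cube)
    next
      case 3
      have "\<forall>\<^sub>F w in at z0. (deriv k w * (w - z0) - of_nat N * k w)^2 * (w - z0) ^ (M + 1) =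
        (4 * k w ^ 3 - g2 * k w * (w - z0) ^ (2*N) - g3 * (w - z0) ^ (3*N))"
        using key ne
      proof eventually_elim
        case (elim w)
        then have "(w - z0)^2 * ((deriv k w * (w - z0) - of_nat N * k w)^2 * (w - z0) ^ (M + 1)) =
          (w - z0)^2 * (4 * k w ^ 3 - g2 * k w * (w - z0) ^ (2*N) - g3 * (w - z0) ^ (3*N))"
        proof -
          have hN: "(w - z0) ^ N = (w - z0)^2 * (w - z0) ^ (M + 1)"
            unfolding 3 by (simp only: flip: power_add) (simp add: eval_nat_numeral)
          have "(w - z0)^2 * ((deriv k w * (w - z0) - of_nat N * k w)^2 * (w - z0) ^ (M + 1))
              = (deriv k w * (w - z0) - of_nat N * k w)^2 * (w - z0) ^ N"
            unfolding hN by (simp only: mult_ac)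
          then show ?thesis using elim by simp
        qed
        then show ?case using elim by simp
      qed
      moreover have "((\<lambda>w. (deriv k w * (w - z0) - of_nat N * k w)^2 * (w - z0) ^ (M + 1)) \<longlongrightarrow> (of_nat N * a)^2 * 0 ^ (M+1)) (at z0)"
        by (rule tendsto_mult L1 tendsto_power lz)+
      ultimately have "((\<lambda>w. (4 * k w ^ 3 - g2 * k w * (w - z0) ^ (2*N) - g3 * (w - z0) ^ (3*N))) \<longlongrightarrow> (of_nat N * a)^2 * 0 ^ (M+1)) (at z0)"
        by (rule tendsto_cong[THEN iffD1])
      then have "(of_nat N * a)^2 * 0 ^ (M+1) = 4 * a^3" using tendsto_unique[OF trivial_limit_at] L2 by blast
      then show ?thesis using k0 by (simp add: a_def)
    qed
  qed
  then have N2: "N = 2" and k1: "k z0 = 1" by (auto simp: a_def)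
  define s where "s = (\<lambda>w. (w - z0) / csqrt (k w))"
  have sqa: "(\<lambda>w. csqrt (k w)) analytic_on {z0}"
    using ka k1 by (intro analytic_intros) (auto simp: complex_nonpos_Reals_iff)
  have sa: "s analytic_on {z0}"
    unfolding s_def using ka k1 sqa by (intro analytic_intros) (auto simp: complex_nonpos_Reals_iff)
  have sd: "deriv s z0 = 1"
  proof -
    have "((\<lambda>w. csqrt (k w)) has_field_derivative deriv (\<lambda>w. csqrt (k w)) z0) (at z0)"
      using sqa analytic_derivI by blast
    then have "((\<lambda>w. (w - z0) / csqrt (k w)) has_field_derivative
        (1 * csqrt (k z0) - (z0 - z0) * deriv (\<lambda>w. csqrt (k w)) z0) / (csqrt (k z0) * csqrt (k z0))) (at z0)"
      by (intro DERIV_divide) (auto intro!: derivative_eq_intros simp: k1)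
    then have "(s has_field_derivative 1) (at z0)"
      by (simp add: s_def k1)
    then show ?thesis by (rule DERIV_imp_deriv)
  qed
  have ys: "\<forall>\<^sub>F w in at z0. y w = 1 / (s w)^2"
    using inb
  proof eventually_elim
    case (elim w)
    then show ?case using y[of w] N2 by (simp add: s_def power_divide)
  qed
  have s0: "\<forall>\<^sub>F w in at z0. s w \<noteq> 0"
    using inb by eventually_elim (use r in \<open>auto simp: s_def\<close>)
  have sdif: "\<forall>\<^sub>F w in at z0. s analytic_on {w}"
    using sa by (metis analytic_at_imp_isCont eventually_at_filter isolated_singularity_at_analytic isolated_singularity_at_altdef)
  have "\<forall>\<^sub>F w in at z0. (deriv s w)^2 = 1 - g2/4 * s w ^ 4 - g3/4 * s w ^ 6"
    using deriv_eq_at[OF ys] ys s0 sdif ode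
  proof eventually_elim
    case (elim w)
    have "(s has_field_derivative deriv s w) (at w)" using elim analytic_derivI by blast
    then have "((\<lambda>w. 1 / (s w)^2) has_field_derivative - 2 * deriv s w / s w ^ 3) (at w)"
      using elim by (auto intro!: derivative_eq_intros simp: field_simps power2_eq_square power3_eq_cube)
    then have "deriv y w = - 2 * deriv s w / s w ^ 3" using elim DERIV_imp_deriv by metis
    then have "(- 2 * deriv s w / s w ^ 3)^2 = 4 * (1 / (s w)^2) ^ 3 - g2 * (1 / (s w)^2) - g3" using elim by simp
    moreover have "(- 2 * deriv s w / s w ^ 3)^2 = 4 * (deriv s w)^2 / s w ^ 6"
      by (simp add: power_divide power_mult_distrib flip: power_mult)
    moreover have "4 * (1 / (s w)^2) ^ 3 - g2 * (1 / (s w)^2) - g3 = (4 - g2 * s w ^ 4 - g3 * s w ^ 6) / s w ^ 6"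
      using elim by (simp add: field_simps power_numeral_reduce)
    ultimately have e4: "4 * (deriv s w)^2 = 4 - g2 * s w ^ 4 - g3 * s w ^ 6"
      using elim by simp
    have "(deriv s w)^2 = (4 * (deriv s w)^2) / 4" by simp
    also have "\<dots> = (4 - g2 * s w ^ 4 - g3 * s w ^ 6) / 4" by (simp only: e4)
    finally have "(deriv s w)^2 = (4 - g2 * s w ^ 4 - g3 * s w ^ 6) / 4" .
    then show ?case by (simp add: diff_divide_distrib)
  qed
  moreover have "s z0 = 0" by (simp add: s_def)
  ultimately show ?thesis using that sa sd ys by blast
qed

lemma pole_ode_unique:
  assumes "y1 meromorphic_on {z0}" "is_pole y1 z0"
    and "\<forall>\<^sub>F w in at z0. (deriv y1 w)^2 = 4 * y1 w ^ 3 - g2 * y1 w - g3"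
    and "y2 meromorphic_on {z0}" "is_pole y2 z0"
    and "\<forall>\<^sub>F w in at z0. (deriv y2 w)^2 = 4 * y2 w ^ 3 - g2 * y2 w - g3"
  shows "\<forall>\<^sub>F w in at z0. y1 w = y2 w"
proof -
  obtain s1 where s1: "s1 analytic_on {z0}" "s1 z0 = 0" "deriv s1 z0 = 1"
    "\<forall>\<^sub>F w in at z0. y1 w = 1 / (s1 w)^2"
    "\<forall>\<^sub>F w in at z0. (deriv s1 w)^2 = 1 - g2/4 * s1 w ^ 4 - g3/4 * s1 w ^ 6"
    using pole_square_root[OF assms(1-3)] by blast
  obtain s2 where s2: "s2 analytic_on {z0}" "s2 z0 = 0" "deriv s2 z0 = 1"
    "\<forall>\<^sub>F w in at z0. y2 w = 1 / (s2 w)^2"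
    "\<forall>\<^sub>F w in at z0. (deriv s2 w)^2 = 1 - g2/4 * s2 w ^ 4 - g3/4 * s2 w ^ 6"
    using pole_square_root[OF assms(4-6)] by blast
  define p where "p = (\<lambda>w. - g2/4 * (s1 w ^ 3 + s1 w ^ 2 * s2 w + s1 w * s2 w ^ 2 + s2 w ^ 3)
     - g3/4 * (s1 w ^ 5 + s1 w ^ 4 * s2 w + s1 w ^ 3 * s2 w ^ 2 + s1 w ^ 2 * s2 w ^ 3 + s1 w * s2 w ^ 4 + s2 w ^ 5))"
  have "\<forall>\<^sub>F w in nhds z0. s1 w = s2 w"
  proof (rule regular_ode_unique[where p=p])
    show "p analytic_on {z0}" unfolding p_def using s1 s2 by (intro analytic_intros) auto
    show "\<forall>\<^sub>F w in at z0. (deriv s1 w)\<^sup>2 - (deriv s2 w)\<^sup>2 = p w * (s1 w - s2 w)"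
      using s1(5) s2(5)
    proof eventually_elim
      case (elim w)
      show ?case unfolding elim p_def by (simp add: field_simps power_numeral_reduce)
    qed
  qed (use s1 s2 in auto)
  then have "\<forall>\<^sub>F w in at z0. s1 w = s2 w" by (simp add: eventually_nhds_conv_at)
  then show ?thesis using s1(4) s2(4) by eventually_elim simp
qed

section \<open>Existence of a global solution with a pole at the origin\<close>
lemma eventually_cosparse_minus_finite:
  fixes A :: "complex set"
  assumes "open A" "finite F" "\<And>z. z \<in> A - F \<Longrightarrow> P z"
  shows "\<forall>\<^sub>\<approx>z\<in>A. P z"
proof -
  have "\<forall>\<^sub>\<approx>z\<in>A. z \<in> A" by (rule eventually_in_cosparse) (use assms in auto)
  moreover have "\<forall>\<^sub>\<approx>z\<in>A. z \<notin> F" using assms by (intro eventually_not_in_cosparse finite_imp_sparse)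
  ultimately show ?thesis by eventually_elim (use assms in auto)
qed

text \<open>Separation of variables in s'^2 = 1 - g2/4 s^4 - g3/4 s^6 gives z as an elliptic integral of s; the
local inverse of this integral is s, and y = 1/s^2.\<close>
lemma local_pole_solution:
  fixes g2 g3 :: complex
  obtains r y where "r > 0" "y meromorphic_on ball 0 r" "is_pole y 0"
    "\<forall>\<^sub>\<approx>z\<in>ball 0 r. (deriv y z)^2 = 4 * y z ^ 3 - g2 * y z - g3"
proof -
  define q where "q = (\<lambda>s::complex. 1 - g2/4 * s ^ 4 - g3/4 * s ^ 6)"
  have "isCont q 0" unfolding q_def by (intro continuous_intros)
  then have "(\<lambda>s. Re (q s)) \<midarrow>0\<rightarrow> Re (q 0)" unfolding isCont_def by (rule tendsto_Re)
  moreover have "Re (q 0) > 0" by (simp add: q_def)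
  ultimately have "eventually (\<lambda>s. Re (q s) > 0) (at 0)" by (rule order_tendstoD)
  then have "eventually (\<lambda>s. Re (q s) > 0) (nhds 0)"
    by (simp add: eventually_nhds_conv_at q_def)
  then obtain \<rho> where \<rho>: "\<rho> > 0" "\<And>s. s \<in> ball 0 \<rho> \<Longrightarrow> Re (q s) > 0"
    unfolding eventually_nhds_metric by (auto simp: dist_commute)
  define \<Psi> where "\<Psi> = (\<lambda>s. csqrt (q s))"
  have q0: "q s \<noteq> 0" if "s \<in> ball 0 \<rho>" for s using \<rho>(2)[OF that] by auto
  have \<Psi>0: "\<Psi> s \<noteq> 0" if "s \<in> ball 0 \<rho>" for s using q0[OF that] by (simp add: \<Psi>_def)
  have \<Psi>h: "(\<lambda>s. 1 / \<Psi> s) holomorphic_on ball 0 \<rho>"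
    unfolding \<Psi>_def q_def using \<rho>(2) q0
    by (intro holomorphic_intros) (auto simp: q_def complex_nonpos_Reals_iff not_le)
  \<comment> \<open>G is the elliptic integral; H normalizes it to vanish at 0, and g is the inverse of H.\<close>
  obtain G where G: "\<And>x. x \<in> ball 0 \<rho> \<Longrightarrow> (G has_field_derivative (1 / \<Psi> x)) (at x within ball 0 \<rho>)"
    using holomorphic_convex_primitive'[OF convex_ball open_ball \<Psi>h] by blast
  define H where "H = (\<lambda>x. G x - G 0)"
  have H: "(H has_field_derivative (1 / \<Psi> x)) (at x)" if "x \<in> ball 0 \<rho>" for x
    using G[OF that] that unfolding H_def by (auto intro!: derivative_eq_intros simp: at_within_open[OF _ open_ball])
  have Hh: "H holomorphic_on ball 0 \<rho>"
    using H by (meson field_differentiable_at_within field_differentiable_def holomorphic_onI)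
  have dH: "deriv H x = 1 / \<Psi> x" if "x \<in> ball 0 \<rho>" for x using H[OF that] by (rule DERIV_imp_deriv)
  have dn: "deriv H 0 \<noteq> 0" using dH[of 0] \<Psi>0[of 0] \<rho> by simp
  have c0: "(0::complex) \<in> ball 0 \<rho>" using \<rho> by simp
  obtain r1 where r1: "r1 > 0" "ball (0::complex) r1 \<subseteq> ball 0 \<rho>" "open (H ` ball 0 r1)" "inj_on H (ball 0 r1)"
    using has_complex_derivative_locally_invertible[OF Hh c0 open_ball dn] by blast
  have Hh1: "H holomorphic_on ball 0 r1" using Hh r1 holomorphic_on_subset by blast
  obtain g where g: "g holomorphic_on (H ` ball 0 r1)"
    "\<And>z. z \<in> ball 0 r1 \<Longrightarrow> deriv H z * deriv g (H z) = 1"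
    "\<And>z. z \<in> ball 0 r1 \<Longrightarrow> g (H z) = z"
    using holomorphic_has_inverse[OF Hh1 open_ball r1(4)] by metis
  have "0 \<in> H ` ball 0 r1" using r1 by (auto simp: H_def intro!: image_eqI[of _ _ 0])
  then obtain r where r: "r > 0" "ball 0 r \<subseteq> H ` ball 0 r1" using r1(3) open_contains_ball by blast
  have gh: "g holomorphic_on ball 0 r" using g(1) r(2) holomorphic_on_subset by blast
  have ga: "g analytic_on ball 0 r" using gh analytic_on_open by blast
  have H0: "H 0 = 0" by (simp add: H_def)
  have g0: "g 0 = 0" using g(3)[of 0] r1 H0 by simp
  have gz: "g z \<noteq> 0" if zr: "z \<in> ball 0 r" "z \<noteq> 0" for z
  proof -
    obtain s where s: "s \<in> ball 0 r1" "z = H s" using zr r by blast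
    then show ?thesis using g(3)[of s] zr H0 by auto
  qed
  have gd: "(deriv g z)^2 = q (g z)" if zr: "z \<in> ball 0 r" for z
  proof -
    obtain s where s: "s \<in> ball 0 r1" "z = H s" using zr r by blast
    have "s \<in> ball 0 \<rho>" using s r1 by blast
    then have "deriv g z = \<Psi> s" using g(2)[OF s(1)] dH[of s] \<Psi>0[of s] s by (simp add: field_simps)
    then show ?thesis using g(3)[OF s(1)] s by (simp add: \<Psi>_def)
  qed
  define y where "y = (\<lambda>z. 1 / (g z)^2)"
  have m: "y meromorphic_on ball 0 r"
    unfolding y_def using analytic_on_imp_meromorphic_on[OF ga] by (intro meromorphic_intros)
  have pole: "is_pole y 0"
    unfolding y_def is_pole_def
  proof (rule filterlim_divide_at_infinity)
    have "g analytic_on {0}" using ga r by (meson analytic_on_subset centre_in_ball empty_subsetI insert_subset)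
    then have "g \<midarrow>0\<rightarrow> 0" using analytic_at_imp_isCont g0 isCont_def by metis
    then have lim: "((\<lambda>z. (g z)^2) \<longlongrightarrow> 0) (at 0)" by (auto intro!: tendsto_eq_intros)
    moreover have "eventually (\<lambda>z. z \<in> ball 0 r - {0}) (at 0)" using r by (intro eventually_at_in_open) auto
    then have "eventually (\<lambda>z. (g z)^2 \<noteq> 0) (at 0)" by eventually_elim (use gz in auto)
    ultimately show "filterlim (\<lambda>z. (g z)^2) (at 0) (at 0)" by (simp add: filterlim_at)
  qed auto
  have ode: "(deriv y z)^2 = 4 * y z ^ 3 - g2 * y z - g3" if "z \<in> ball 0 r - {0}" for z
  proof -
    have d: "(g has_field_derivative deriv g z) (at z)" using gh that holomorphic_derivI[OF gh open_ball] by auto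
    have nz: "g z \<noteq> 0" using gz that by auto
    have "(y has_field_derivative - 2 * deriv g z / g z ^ 3) (at z)"
      unfolding y_def using nz by (auto intro!: derivative_eq_intros d simp: field_simps power2_eq_square power3_eq_cube)
    then have "deriv y z = - 2 * deriv g z / g z ^ 3" by (rule DERIV_imp_deriv)
    then have "(deriv y z)^2 = 4 * (deriv g z)^2 / g z ^ 6" by (simp add: power_divide power_mult_distrib flip: power_mult)
    also have "\<dots> = 4 * q (g z) / g z ^ 6" using gd that by auto
    also have "\<dots> = 4 * y z ^ 3 - g2 * y z - g3"
      using nz by (simp add: q_def y_def field_simps power_numeral_reduce)
    finally show ?thesis .
  qed
  show ?thesis
    by (rule that[OF r(1) m pole]) (rule eventually_cosparse_minus_finite[of _ "{0}"], use ode in auto)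
qed

text \<open>The duplication formula: wp(2 z) is this rational function of wp(z).\<close>
definition wp_dup :: "complex \<Rightarrow> complex \<Rightarrow> complex \<Rightarrow> complex" where
  "wp_dup g2 g3 x = (x^4 + g2/2 * x^2 + 2*g3 * x + g2^2/16) / (4 * x^3 - g2 * x - g3)"

text \<open>The identity behind the fact that the duplication formula maps solutions to solutions; p stands for
the derivative y' and x for y.\<close>
lemma wp_dup_ode_algebra:
  fixes x p g2 g3 C N :: complex
  assumes C: "C = 4 * x^3 - g2 * x - g3" "C \<noteq> 0" and p: "p^2 = C"
    and N: "N = x^4 + g2/2 * x^2 + 2*g3 * x + g2^2/16"
  shows "(((4*x^3 + g2 * x + 2*g3) * C - N * (12 * x^2 - g2)) * p / (2 * C^2))^2 = 4 * (N/C)^3 - g2 * (N/C) - g3"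
proof -
  have key: "((4*x^3 + g2 * x + 2*g3) * C - N * (12 * x^2 - g2))^2 = 4 * (4 * N^3 - g2 * N * C^2 - g3 * C^3)"
    unfolding C(1) N by (simp add: field_simps power_numeral_reduce)
  have "(((4*x^3 + g2 * x + 2*g3) * C - N * (12 * x^2 - g2)) * p / (2 * C^2))^2
     = ((4*x^3 + g2 * x + 2*g3) * C - N * (12 * x^2 - g2))^2 * p^2 / (4 * C^4)"
    by (simp add: power_divide power_mult_distrib flip: power_mult)
  also have "\<dots> = 4 * (4 * N^3 - g2 * N * C^2 - g3 * C^3) * C / (4 * C^4)" unfolding key p ..
  also have "\<dots> = 4 * (N/C)^3 - g2 * (N/C) - g3"
    using C(2) by (simp add: field_simps power_numeral_reduce)
  finally show ?thesis .
qed

lemma cubic_filterlim_at_infinity: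
  fixes y :: "complex \<Rightarrow> complex"
  assumes y: "filterlim y at_infinity F"
  shows "filterlim (\<lambda>w. 4 * y w ^ 3 - g2 * y w - g3) at_infinity F"
proof -
  define t where "t = (\<lambda>w. inverse (y w))"
  have t: "(t \<longlongrightarrow> 0) F" unfolding t_def using y tendsto_inverse_0 filterlim_compose by blast
  have "((\<lambda>w. 4 - g2 * t w^2 - g3 * t w^3) \<longlongrightarrow> 4) F"
    by (auto intro!: tendsto_eq_intros t)
  then have "((\<lambda>w. 4 - g2 * inverse (y w)^2 - g3 * inverse (y w)^3) \<longlongrightarrow> 4) F" by (simp only: t_def)
  moreover have "filterlim (\<lambda>w. y w ^ 3) at_infinity F"
    using filterlim_compose[OF filterlim_power_at_infinity[of 3] y] by simp
  ultimately have "filterlim (\<lambda>w. (4 - g2 * inverse (y w)^2 - g3 * inverse (y w)^3) * y w ^ 3) at_infinity F"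
    by (intro tendsto_mult_filterlim_at_infinity) auto
  moreover have "\<forall>\<^sub>F w in F. y w \<noteq> 0" using filterlim_at_infinity_imp_eventually_ne[OF y] .
  then have "\<forall>\<^sub>F w in F. (4 - g2 * inverse (y w)^2 - g3 * inverse (y w)^3) * y w ^ 3 = 4 * y w ^ 3 - g2 * y w - g3"
    by eventually_elim (simp add: field_simps power2_eq_square power3_eq_cube)
  ultimately show ?thesis using filterlim_cong by force
qed

lemma wp_dup_filterlim_at_infinity:
  fixes y :: "complex \<Rightarrow> complex"
  assumes y: "filterlim y at_infinity F"
  shows "filterlim (\<lambda>w. wp_dup g2 g3 (y w)) at_infinity F"
proof -
  define t where "t = (\<lambda>w. inverse (y w))"
  have t: "(t \<longlongrightarrow> 0) F" unfolding t_def using y tendsto_inverse_0 filterlim_compose by blast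
  have "((\<lambda>w. (1 + g2/2 * t w^2 + 2*g3 * t w^3 + g2^2/16 * t w^4) /
      (4 - g2 * t w^2 - g3 * t w^3)) \<longlongrightarrow> 1/4) F"
    by (auto intro!: tendsto_eq_intros t)
  then have "((\<lambda>w. (1 + g2/2 * inverse (y w)^2 + 2*g3 * inverse (y w)^3 + g2^2/16 * inverse (y w)^4) /
      (4 - g2 * inverse (y w)^2 - g3 * inverse (y w)^3)) \<longlongrightarrow> 1/4) F" by (simp only: t_def)
  then have "filterlim (\<lambda>w. ((1 + g2/2 * inverse (y w)^2 + 2*g3 * inverse (y w)^3 + g2^2/16 * inverse (y w)^4) /
      (4 - g2 * inverse (y w)^2 - g3 * inverse (y w)^3)) * y w) at_infinity F"
    using y by (intro tendsto_mult_filterlim_at_infinity) auto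
  moreover have "\<forall>\<^sub>F w in F. y w \<noteq> 0" using filterlim_at_infinity_imp_eventually_ne[OF y] .
  then have "\<forall>\<^sub>F w in F. ((1 + g2/2 * inverse (y w)^2 + 2*g3 * inverse (y w)^3 + g2^2/16 * inverse (y w)^4) /
      (4 - g2 * inverse (y w)^2 - g3 * inverse (y w)^3)) * y w = wp_dup g2 g3 (y w)"
  proof eventually_elim
    case (elim w)
    define x where "x = y w"
    have x: "x \<noteq> 0" using elim by (simp add: x_def)
    have a: "1 + g2/2 * inverse x^2 + 2*g3 * inverse x^3 + g2^2/16 * inverse x^4 = (x^4 + g2/2 * x^2 + 2*g3 * x + g2^2/16) / x^4"
      using x by (simp add: field_simps power_numeral_reduce)
    have b: "4 - g2 * inverse x^2 - g3 * inverse x^3 = (4 * x^3 - g2 * x - g3) / x^3"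
      using x by (simp add: field_simps power_numeral_reduce)
    show ?case unfolding x_def[symmetric] a b wp_dup_def using x
      by (simp add: power_numeral_reduce)
  qed
  ultimately show ?thesis using filterlim_cong by force
qed

lemma filterlim_half_at: "filterlim (\<lambda>w::complex. w/2) (at (z/2)) (at z)"
  unfolding filterlim_at by (auto intro!: tendsto_eq_intros eventually_at_ball' simp: eventually_at_filter)

text \<open>Doubling the argument doubles the radius of the disc on which the solution is defined.\<close>
lemma duplication_extends:
  assumes r: "r > 0" and m: "y meromorphic_on ball 0 r" and pole: "is_pole y 0"
    and ode: "\<forall>\<^sub>\<approx>z\<in>ball 0 r. (deriv y z)^2 = 4 * y z ^ 3 - g2 * y z - g3"
  defines "Y \<equiv> (\<lambda>z. wp_dup g2 g3 (y (z/2)))"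
  shows "Y meromorphic_on ball 0 (2*r)" "is_pole Y 0"
    "\<forall>\<^sub>\<approx>z\<in>ball 0 (2*r). (deriv Y z)^2 = 4 * Y z ^ 3 - g2 * Y z - g3"
proof -
  have half: "z/2 \<in> ball 0 r" if "z \<in> ball 0 (2*r)" for z :: complex using that by (simp add: norm_divide)
  have "(\<lambda>z. y (z/2)) meromorphic_on ball 0 (2*r)"
    by (rule meromorphic_on_compose[OF m]) (use half in \<open>auto intro!: analytic_intros\<close>)
  then show "Y meromorphic_on ball 0 (2*r)"
    unfolding Y_def wp_dup_def by (intro meromorphic_intros)
  have h0: "filterlim (\<lambda>w. w/2) (at 0) (at (0::complex))" using filterlim_half_at[of 0] by simp
  have "filterlim (\<lambda>z. y (z/2)) at_infinity (at 0)"
    using filterlim_compose[OF pole[unfolded is_pole_def] h0] .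
  then show "is_pole Y 0" unfolding is_pole_def Y_def by (rule wp_dup_filterlim_at_infinity)
  have "(\<lambda>z. 4 * y z ^ 3 - g2 * y z - g3) meromorphic_on ball 0 r" using m by (intro meromorphic_intros)
  then consider "\<forall>\<^sub>\<approx>z\<in>ball 0 r. 4 * y z ^ 3 - g2 * y z - g3 = 0" | "\<forall>\<^sub>\<approx>z\<in>ball 0 r. 4 * y z ^ 3 - g2 * y z - g3 \<noteq> 0"
    using meromorphic_imp_constant_or_avoid open_ball connected_ball by blast
  then have nz: "\<forall>\<^sub>\<approx>z\<in>ball 0 r. 4 * y z ^ 3 - g2 * y z - g3 \<noteq> 0"
  proof cases
    case 1
    then have "\<forall>\<^sub>F z in at 0. 4 * y z ^ 3 - g2 * y z - g3 = 0"
      using eventually_cosparse_imp_eventually_at r by fastforce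
    moreover have "\<forall>\<^sub>F z in at 0. 4 * y z ^ 3 - g2 * y z - g3 \<noteq> 0"
      using cubic_filterlim_at_infinity pole filterlim_at_infinity_imp_eventually_ne unfolding is_pole_def by blast
    ultimately have "\<forall>\<^sub>F z in at (0::complex). False" by eventually_elim auto
    then show ?thesis by simp
  qed
  have *: "\<forall>\<^sub>\<approx>z\<in>ball 0 r. y analytic_on {z} \<and> (deriv y z)^2 = 4 * y z ^ 3 - g2 * y z - g3 \<and> 4 * y z ^ 3 - g2 * y z - g3 \<noteq> 0"
    using nz ode meromorphic_on_imp_analytic_cosparse[OF m] by eventually_elim auto
  have "\<forall>\<^sub>F w in at z. (deriv Y w)^2 = 4 * Y w ^ 3 - g2 * Y w - g3" if z: "z \<in> ball 0 (2*r)" for z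
  proof -
    have "\<forall>\<^sub>F w in at (z/2). y analytic_on {w} \<and> (deriv y w)^2 = 4 * y w ^ 3 - g2 * y w - g3 \<and> 4 * y w ^ 3 - g2 * y w - g3 \<noteq> 0"
      using eventually_cosparse_imp_eventually_at[OF *] half[OF z] by blast
    then have "\<forall>\<^sub>F w in at z. y analytic_on {w/2} \<and> (deriv y (w/2))^2 = 4 * y (w/2) ^ 3 - g2 * y (w/2) - g3 \<and> 4 * y (w/2) ^ 3 - g2 * y (w/2) - g3 \<noteq> 0"
      using eventually_compose_filterlim filterlim_half_at by blast
    then show ?thesis
    proof eventually_elim
      case (elim w)
      define x where "x = y (w/2)"
      define C where "C = 4 * x^3 - g2 * x - g3"
      define N where "N = x^4 + g2/2 * x^2 + 2*g3 * x + g2^2/16"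
      have C0: "C \<noteq> 0" using elim by (simp add: C_def x_def)
      have p: "(deriv y (w/2))^2 = C" using elim by (simp add: C_def x_def)
      have dy: "(y has_field_derivative deriv y (w/2)) (at (w/2))" using elim analytic_derivI by blast
      have dy2: "((\<lambda>w. y (w/2)) has_field_derivative deriv y (w/2) / 2) (at w)"
        by (rule DERIV_chain'[where f="\<lambda>w. w/2" and g=y, THEN DERIV_cong])
           (auto intro!: derivative_eq_intros dy)
      have "(Y has_field_derivative (((4*x^3 + g2 * x + 2*g3) * C - N * (12 * x^2 - g2)) * deriv y (w/2) / (2 * C^2))) (at w)"
      proof -
        have dN: "((\<lambda>w. y (w/2)^4 + g2/2 * y (w/2)^2 + 2*g3 * y (w/2) + g2^2/16) has_field_derivative
            (4*x^3 + g2 * x + 2*g3) * (deriv y (w/2) / 2)) (at w)"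
          by (rule derivative_eq_intros dy2 refl | simp add: x_def algebra_simps)+
        have dC: "((\<lambda>w. 4 * y (w/2)^3 - g2 * y (w/2) - g3) has_field_derivative
            (12 * x^2 - g2) * (deriv y (w/2) / 2)) (at w)"
          by (rule derivative_eq_intros dy2 refl | simp add: x_def algebra_simps)+
        have "(Y has_field_derivative ((4*x^3 + g2 * x + 2*g3) * (deriv y (w/2) / 2) * C - N * ((12 * x^2 - g2) * (deriv y (w/2) / 2))) / (C * C)) (at w)"
          unfolding Y_def wp_dup_def
          using DERIV_divide[OF dN dC] C0 by (simp only: N_def C_def x_def) simp
        moreover have "((4*x^3 + g2 * x + 2*g3) * (deriv y (w/2) / 2) * C - N * ((12 * x^2 - g2) * (deriv y (w/2) / 2))) / (C * C)
           = ((4*x^3 + g2 * x + 2*g3) * C - N * (12 * x^2 - g2)) * deriv y (w/2) / (2 * C^2)"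
          using C0 by (simp add: field_simps power2_eq_square)
        ultimately show ?thesis by simp
      qed
      then have "deriv Y w = (((4*x^3 + g2 * x + 2*g3) * C - N * (12 * x^2 - g2)) * deriv y (w/2) / (2 * C^2))"
        by (rule DERIV_imp_deriv)
      then have "(deriv Y w)^2 = 4 * (N/C)^3 - g2 * (N/C) - g3"
        using wp_dup_ode_algebra[OF C_def C0 p N_def] by simp
      moreover have "Y w = N / C" by (simp add: Y_def wp_dup_def N_def C_def x_def)
      ultimately show ?case by simp
    qed
  qed
  then show "\<forall>\<^sub>\<approx>z\<in>ball 0 (2*r). (deriv Y z)^2 = 4 * Y z ^ 3 - g2 * Y z - g3"
    by (simp add: eventually_cosparse_open_eq)
qed

text \<open>The pole at the origin replaces an initial condition: it determines the solution.\<close>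
definition pole_solution :: "complex \<Rightarrow> complex \<Rightarrow> (complex \<Rightarrow> complex) \<Rightarrow> bool" where
  "pole_solution g2 g3 y \<longleftrightarrow> y meromorphic_on UNIV \<and> is_pole y 0 \<and>
     (\<forall>\<^sub>\<approx>z. (deriv y z)^2 = 4 * y z ^ 3 - g2 * y z - g3)"

text \<open>Repeated duplication defines solutions on discs of radius 2^n r. They agree where they overlap,
since a solution with a pole at 0 is unique there; removing removable singularities makes the glued
values independent of n.\<close>
lemma pole_solution_exists: "\<exists>y. pole_solution g2 g3 y"
proof -
  obtain r y0 where y0: "r > 0" "y0 meromorphic_on ball 0 r" "is_pole y0 0"
    "\<forall>\<^sub>\<approx>z\<in>ball 0 r. (deriv y0 z)^2 = 4 * y0 z ^ 3 - g2 * y0 z - g3"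
    using local_pole_solution by blast
  define B where "B = (\<lambda>n::nat. ball (0::complex) (2^n * r))"
  have "\<exists>y. y meromorphic_on B n \<and> is_pole y 0 \<and> (\<forall>\<^sub>\<approx>z\<in>B n. (deriv y z)^2 = 4 * y z ^ 3 - g2 * y z - g3)" for n
  proof (induction n)
    case 0
    then show ?case using y0 by (auto simp: B_def)
  next
    case (Suc n)
    then obtain y where y: "y meromorphic_on ball 0 (2^n * r)" "is_pole y 0"
      "\<forall>\<^sub>\<approx>z\<in>ball 0 (2^n * r). (deriv y z)^2 = 4 * y z ^ 3 - g2 * y z - g3"
      unfolding B_def by blast
    have r': "2^n * r > 0" using y0(1) by simp
    have e: "2 * (2^n * r) = 2 ^ Suc n * r" by simp
    show ?case using duplication_extends[OF r' y] unfolding B_def e by blast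
  qed
  then have "\<forall>n. \<exists>y. y meromorphic_on B n \<and> is_pole y 0 \<and> (\<forall>\<^sub>\<approx>z\<in>B n. (deriv y z)^2 = 4 * y z ^ 3 - g2 * y z - g3)" ..
  from choice[OF this] obtain Y where Y': "\<forall>n. Y n meromorphic_on B n \<and> is_pole (Y n) 0 \<and>
    (\<forall>\<^sub>\<approx>z\<in>B n. (deriv (Y n) z)^2 = 4 * Y n z ^ 3 - g2 * Y n z - g3)" ..
  have Y: "Y n meromorphic_on B n" "is_pole (Y n) 0"
    "\<forall>\<^sub>\<approx>z\<in>B n. (deriv (Y n) z)^2 = 4 * Y n z ^ 3 - g2 * Y n z - g3" for n
    using Y'[rule_format, of n] by simp_all
  have B0: "0 \<in> B n" for n using y0 by (simp add: B_def)
  have Bo: "open (B n)" "connected (B n)" for n by (auto simp: B_def)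
  have mono: "B n \<subseteq> B m" if "n \<le> m" for n m
    unfolding B_def using that y0 by (intro subset_ball mult_right_mono power_increasing) auto
  have cons: "\<forall>\<^sub>\<approx>z\<in>B n. Y n z = Y m z" if nm: "n \<le> m" for n m
  proof (rule meromorphic_eq_cosparseI[where ?z0.0=0])
    show "Y m meromorphic_on B n" using Y(1) mono[OF nm] meromorphic_on_subset by blast
    show "\<forall>\<^sub>F z in at 0. Y n z = Y m z"
    proof (rule pole_ode_unique)
      show "Y n meromorphic_on {0}" by (rule meromorphic_on_subset[OF Y(1)]) (use B0 in simp)
      show "Y m meromorphic_on {0}" by (rule meromorphic_on_subset[OF Y(1)]) (use B0 in simp)
      show "\<forall>\<^sub>F z in at 0. (deriv (Y n) z)^2 = 4 * Y n z ^ 3 - g2 * Y n z - g3"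
           "\<forall>\<^sub>F z in at 0. (deriv (Y m) z)^2 = 4 * Y m z ^ 3 - g2 * Y m z - g3"
        using eventually_cosparse_imp_eventually_at[OF Y(3) B0] by auto
    qed (use Y in auto)
  qed (use Y Bo B0 in auto)
  have cons': "\<forall>\<^sub>F w in at z. Y n w = Y m w" if z: "z \<in> B n" "z \<in> B m" for n m z
  proof (cases "n \<le> m")
    case True
    then show ?thesis using eventually_cosparse_imp_eventually_at[OF cons[OF True] z(1)] by simp
  next
    case False
    then have "m \<le> n" by simp
    then have "\<forall>\<^sub>F w in at z. Y m w = Y n w" using eventually_cosparse_imp_eventually_at[OF cons z(2)] by blast
    then show ?thesis by eventually_elim simp
  qed
  have exB: "\<exists>n. z \<in> B n" for z
  proof -
    obtain n where "norm z / r < 2 ^ n" using real_arch_pow[of 2 "norm z / r"] by auto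
    then show ?thesis using y0 by (auto simp: B_def field_simps intro!: exI[of _ n])
  qed
  \<comment> \<open>Any disc that contains z may be used to define the value at z.\<close>
  define N where "N = (\<lambda>z. SOME n. z \<in> B n)"
  have N: "z \<in> B (N z)" for z unfolding N_def using exB someI_ex by metis
  define E where "E = (\<lambda>z. remove_sings (Y (N z)) z)"
  have E: "\<forall>\<^sub>F w in at z. E w = Y n w" if "z \<in> B n" for z n
  proof -
    have "\<forall>\<^sub>F w in at z. w \<in> B n" using that Bo by (intro eventually_at_in_open') auto
    moreover have "\<forall>\<^sub>F w in at z. remove_sings (Y n) w = Y n w"
      using eventually_cosparse_imp_eventually_at[OF eventually_remove_sings_eq[OF Y(1)] that] .
    ultimately show ?thesis
    proof eventually_elim
      case (elim w)
      have "remove_sings (Y (N w)) w = remove_sings (Y n) w"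
        by (rule remove_sings_cong[OF cons' refl]) (use N elim in auto)
      then show ?case using elim by (simp add: E_def)
    qed
  qed
  have "E meromorphic_on {z}" for z
  proof -
    have "Y (N z) meromorphic_on {z}" by (rule meromorphic_on_subset[OF Y(1)]) (use N in simp)
    then show ?thesis
      using meromorphic_on_cong[of "{z}" E "Y (N z)" "{z}"] E[OF N[of z]] by simp
  qed
  then have "E meromorphic_on UNIV" using meromorphic_on_meromorphic_at by blast
  moreover have "is_pole E 0" using is_pole_cong[OF E[OF B0] refl] Y(2) by blast
  moreover have "\<forall>\<^sub>F w in at z. (deriv E w)^2 = 4 * E w ^ 3 - g2 * E w - g3" for z
    using E[OF N[of z]] deriv_eq_at[OF E[OF N[of z]]] eventually_cosparse_imp_eventually_at[OF Y(3)[of "N z"] N[of z], of UNIV]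
    by eventually_elim simp
  ultimately show ?thesis unfolding pole_solution_def by (auto simp: eventually_cosparse_open_eq)
qed

section \<open>Poles of the global solution\<close>
lemma filterlim_affine_at:
  fixes a b :: complex
  assumes "a \<noteq> 0"
  shows "filterlim (\<lambda>w. a * w + b) (at (a * z + b)) (at z)"
  unfolding filterlim_at using assms by (auto intro!: tendsto_eq_intros simp: eventually_at_filter)

lemma eventually_cosparse_affine:
  fixes a b :: complex
  assumes "eventually P (cosparse UNIV)" "a \<noteq> 0"
  shows "\<forall>\<^sub>\<approx>w. P (a * w + b)"
proof -
  have "\<forall>\<^sub>F w in at z. P (a * w + b)" for z
  proof -
    have "eventually P (at (a * z + b))" using assms(1) eventually_cosparse_imp_eventually_at by blast
    then show ?thesis using eventually_compose_filterlim[OF _ filterlim_affine_at[OF assms(2)]] by blast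
  qed
  then show ?thesis by (simp add: eventually_cosparse_open_eq)
qed

lemma meromorphic_on_affine:
  assumes "f meromorphic_on UNIV"
  shows "(\<lambda>w. f (a * w + b)) meromorphic_on UNIV"
  by (rule meromorphic_on_compose[OF assms]) (auto intro!: analytic_intros)

lemma is_pole_affine:
  fixes f :: "complex \<Rightarrow> complex" and a b z :: complex
  assumes "is_pole f (a * z + b)" "a \<noteq> 0"
  shows "is_pole (\<lambda>w. f (a * w + b)) z"
  unfolding is_pole_def
  using filterlim_compose[OF assms(1)[unfolded is_pole_def] filterlim_affine_at[OF assms(2)]] .

lemma pole_solutionD:
  assumes "pole_solution g2 g3 y"
  shows "y meromorphic_on A" "is_pole y 0" "\<forall>\<^sub>\<approx>z. (deriv y z)^2 = 4 * y z ^ 3 - g2 * y z - g3"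
    "\<forall>\<^sub>F z in at w. (deriv y z)^2 = 4 * y z ^ 3 - g2 * y z - g3"
    "\<forall>\<^sub>F z in at w. y analytic_on {z}"
proof -
  have m: "y meromorphic_on UNIV" using assms by (simp add: pole_solution_def)
  then show "y meromorphic_on A" by (rule meromorphic_on_subset) simp
  show "is_pole y 0" using assms by (simp add: pole_solution_def)
  show ode: "\<forall>\<^sub>\<approx>z. (deriv y z)^2 = 4 * y z ^ 3 - g2 * y z - g3" using assms by (simp add: pole_solution_def)
  show "\<forall>\<^sub>F z in at w. (deriv y z)^2 = 4 * y z ^ 3 - g2 * y z - g3"
    by (rule eventually_cosparse_imp_eventually_at[OF ode]) simp
  show "\<forall>\<^sub>F z in at w. y analytic_on {z}"
    by (rule eventually_cosparse_imp_eventually_at[OF meromorphic_on_imp_analytic_cosparse[OF m]]) simp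
qed

lemma cubic_ode_affine:
  fixes e :: complex
  assumes m: "f meromorphic_on UNIV" and ode: "\<forall>\<^sub>\<approx>z. (deriv f z)^2 = 4 * f z ^ 3 - g2 * f z - g3"
    and e: "e^2 = 1"
  shows "\<forall>\<^sub>\<approx>w. (deriv (\<lambda>w. f (e * w + b)) w)^2 = 4 * f (e * w + b) ^ 3 - g2 * f (e * w + b) - g3"
proof -
  have e0: "e \<noteq> 0" using e by auto
  have "\<forall>\<^sub>\<approx>w. f analytic_on {e * w + b}"
    by (rule eventually_cosparse_affine[OF meromorphic_on_imp_analytic_cosparse[OF m] e0])
  moreover have "\<forall>\<^sub>\<approx>w. (deriv f (e * w + b))^2 = 4 * f (e * w + b) ^ 3 - g2 * f (e * w + b) - g3"
    by (rule eventually_cosparse_affine[OF ode e0])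
  ultimately show ?thesis
  proof eventually_elim
    case (elim w)
    have "(f has_field_derivative deriv f (e * w + b)) (at (e * w + b))" using elim analytic_derivI by blast
    then have "((\<lambda>w. f (e * w + b)) has_field_derivative deriv f (e * w + b) * e) (at w)"
      by (rule DERIV_chain'[rotated]) (auto intro!: derivative_eq_intros)
    then have "deriv (\<lambda>w. f (e * w + b)) w = deriv f (e * w + b) * e" by (rule DERIV_imp_deriv)
    then show ?case using elim e by (simp add: power_mult_distrib)
  qed
qed

text \<open>The equation is only known off a discrete set, but both sides are continuous where f is analytic.\<close>
lemma cubic_ode_at_analytic:
  assumes ode: "\<forall>\<^sub>F z in at z0. (deriv f z)^2 = v z * (4 * f z ^ 3 - g2 * f z - g3)"
    and f: "f analytic_on {z0}" and v: "v analytic_on {z0}"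
  shows "(deriv f z0)^2 = v z0 * (4 * f z0 ^ 3 - g2 * f z0 - g3)"
proof -
  have c: "f \<midarrow>z0\<rightarrow> f z0" "deriv f \<midarrow>z0\<rightarrow> deriv f z0" "v \<midarrow>z0\<rightarrow> v z0"
    using f v analytic_at_imp_isCont analytic_deriv unfolding isCont_def by blast+
  have "((\<lambda>z. (deriv f z)^2) \<longlongrightarrow> (deriv f z0)^2) (at z0)" by (intro tendsto_intros c)
  moreover have "((\<lambda>z. v z * (4 * f z ^ 3 - g2 * f z - g3)) \<longlongrightarrow> v z0 * (4 * f z0 ^ 3 - g2 * f z0 - g3)) (at z0)"
    by (intro tendsto_intros c)
  then have "((\<lambda>z. (deriv f z)^2) \<longlongrightarrow> v z0 * (4 * f z0 ^ 3 - g2 * f z0 - g3)) (at z0)"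
    by (rule tendsto_cong[THEN iffD2, OF ode])
  ultimately show ?thesis using tendsto_unique[OF trivial_limit_at] by blast
qed

text \<open>The factor v allows functions of the form wp(h), for which v = h'^2.\<close>
lemma cubic_ode_regular_unique:
  assumes m: "y1 meromorphic_on A" "y2 meromorphic_on A" and A: "open A" "connected A" "z1 \<in> A"
    and an: "y1 analytic_on {z1}" "y2 analytic_on {z1}" "v analytic_on {z1}"
    and ode1: "\<forall>\<^sub>F z in at z1. (deriv y1 z)^2 = v z * (4 * y1 z ^ 3 - g2 * y1 z - g3)"
    and ode2: "\<forall>\<^sub>F z in at z1. (deriv y2 z)^2 = v z * (4 * y2 z ^ 3 - g2 * y2 z - g3)"
    and eq: "y1 z1 = y2 z1" "deriv y1 z1 = deriv y2 z1" "deriv y1 z1 \<noteq> 0"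
  shows "\<forall>\<^sub>\<approx>z\<in>A. y1 z = y2 z"
proof (rule meromorphic_eq_cosparseI[OF m A])
  define p where "p = (\<lambda>w. v w * (4 * (y1 w ^ 2 + y1 w * y2 w + y2 w ^ 2) - g2))"
  have "\<forall>\<^sub>F w in nhds z1. y1 w = y2 w"
  proof (rule regular_ode_unique[where p=p])
    show "p analytic_on {z1}" unfolding p_def using an by (intro analytic_intros)
    show "\<forall>\<^sub>F w in at z1. (deriv y1 w)\<^sup>2 - (deriv y2 w)\<^sup>2 = p w * (y1 w - y2 w)"
      using ode1 ode2
    proof eventually_elim
      case (elim w)
      show ?case unfolding elim p_def by (simp add: algebra_simps power2_eq_square power3_eq_cube)
    qed
  qed (use an eq in auto)
  then show "\<forall>\<^sub>F w in at z1. y1 w = y2 w" by (simp add: eventually_nhds_conv_at)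
qed

lemma pole_solution_unique:
  assumes "pole_solution g2 g3 y1" "pole_solution g2 g3 y2"
  shows "\<forall>\<^sub>\<approx>z. y1 z = y2 z"
proof (rule meromorphic_eq_cosparseI[where ?z0.0 = 0])
  show "\<forall>\<^sub>F z in at 0. y1 z = y2 z"
    by (rule pole_ode_unique[OF pole_solutionD(1,2,4)[OF assms(1)] pole_solutionD(1,2,4)[OF assms(2)]])
qed (use pole_solutionD(1)[OF assms(1)] pole_solutionD(1)[OF assms(2)] connected_UNIV in simp_all)

text \<open>Evenness (e = -1, b = 0) and periodicity with respect to the poles (e = 1) at once.\<close>
lemma pole_solution_affine:
  assumes y: "pole_solution g2 g3 y" and "is_pole y b" "e^2 = 1"
  shows "\<forall>\<^sub>\<approx>z. y (e * z + b) = y z"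
proof (rule pole_solution_unique[OF _ y])
  have "e \<noteq> 0" using assms by auto
  then show "pole_solution g2 g3 (\<lambda>z. y (e * z + b))"
    using assms cubic_ode_affine[of y g2 g3 e b] meromorphic_on_affine[of y e b] is_pole_affine[of y e 0 b]
    unfolding pole_solution_def by simp
qed

lemma pole_solution_pole_add:
  assumes y: "pole_solution g2 g3 y" and p: "is_pole y p" and q: "is_pole y q"
  shows "is_pole y (q + p)"
proof -
  have "\<forall>\<^sub>\<approx>z. y (1 * z + p) = y z" using pole_solution_affine[OF y p, of 1] by simp
  from eventually_cosparse_imp_eventually_at[OF this UNIV_I]
  have "\<forall>\<^sub>F z in at q. y (z + p) = y z" by simp
  from is_pole_cong[OF this refl] have pq: "is_pole (\<lambda>z. y (z + p)) q" using q by simp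
  have "is_pole (\<lambda>w. (\<lambda>z. y (z + p)) (1 * w + (- p))) (q + p)"
    by (rule is_pole_affine) (use pq in auto)
  then show ?thesis by simp
qed

lemma pole_solution_pole_uminus:
  assumes y: "pole_solution g2 g3 y" and q: "is_pole y q"
  shows "is_pole y (- q)"
proof -
  have p0: "is_pole y 0" using y by (simp add: pole_solution_def)
  have "\<forall>\<^sub>\<approx>z. y ((-1) * z + 0) = y z" using pole_solution_affine[OF y p0, of "-1"] by simp
  from eventually_cosparse_imp_eventually_at[OF this UNIV_I]
  have "\<forall>\<^sub>F z in at q. y (- z) = y z" by simp
  from is_pole_cong[OF this refl] have pq: "is_pole (\<lambda>z. y (- z)) q" using q by simp
  have "is_pole (\<lambda>w. (\<lambda>z. y (- z)) ((-1) * w + 0)) (- q)"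
    by (rule is_pole_affine) (use pq in auto)
  then show ?thesis by simp
qed

text \<open>Near 0 the solution is 1/s^2 with s locally biholomorphic, so it covers a neighbourhood of infinity.\<close>
lemma pole_solution_attains_large:
  assumes y: "pole_solution g2 g3 y"
  obtains M where "M > 0" "\<And>x. norm x \<ge> M \<Longrightarrow> \<exists>\<zeta>. norm \<zeta> < 1 \<and> y analytic_on {\<zeta>} \<and> y \<zeta> = x"
proof -
  obtain s where s: "s analytic_on {0}" "s 0 = 0" "deriv s 0 = 1" "\<forall>\<^sub>F w in at 0. y w = 1 / (s w)^2"
    by (rule pole_square_root[OF pole_solutionD(1,2,4)[OF y]])
  from pole_solutionD(5)[OF y] s(4) have "\<forall>\<^sub>F w in at 0. y w = 1 / (s w)^2 \<and> y analytic_on {w}" by eventually_elim auto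
  then obtain T where T: "open T" "0 \<in> T" "\<And>w. w \<in> T \<Longrightarrow> w \<noteq> 0 \<Longrightarrow> y w = 1 / (s w)^2 \<and> y analytic_on {w}"
    unfolding eventually_at_topological by blast
  obtain S where S: "open S" "0 \<in> S" "s holomorphic_on S" using s(1) analytic_at by blast
  define U where "U = S \<inter> T \<inter> ball 0 1"
  have U: "open U" "0 \<in> U" "s holomorphic_on U" using S T holomorphic_on_subset by (auto simp: U_def)
  have "deriv s 0 \<noteq> 0" using s by simp
  then obtain r where r: "r > 0" "ball 0 r \<subseteq> U" "open (s ` ball 0 r)"
    using has_complex_derivative_locally_invertible[OF U(3,2,1)] by blast
  have "0 \<in> s ` ball 0 r" using r s by force
  then obtain \<eta> where \<eta>: "\<eta> > 0" "ball 0 \<eta> \<subseteq> s ` ball 0 r" using r(3) open_contains_ball by blast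
  show ?thesis
  proof (rule that[of "2 / \<eta>^2"])
    fix x :: complex assume x: "norm x \<ge> 2 / \<eta>^2"
    define \<sigma> where "\<sigma> = csqrt (1 / x)"
    have pos: "2 / \<eta>^2 > 0" using \<eta> by simp
    have x0: "x \<noteq> 0" using x pos by (metis norm_zero not_le)
    have "norm x > 0" using x0 by simp
    have s2: "\<sigma>^2 = 1 / x" by (simp add: \<sigma>_def)
    have "norm \<sigma> ^ 2 = 1 / norm x" using s2 by (metis norm_divide norm_one norm_power)
    also have "\<dots> \<le> 1 / (2 / \<eta>^2)" using x pos \<open>norm x > 0\<close> by (intro divide_left_mono mult_pos_pos) auto
    also have "\<dots> < \<eta>^2" using \<eta> by simp
    finally have "norm \<sigma> < \<eta>" using \<eta> by (meson less_imp_le power_less_imp_less_base)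
    then obtain \<zeta> where z: "\<zeta> \<in> ball 0 r" "s \<zeta> = \<sigma>" using \<eta> by (metis image_iff mem_ball_0 subsetD)
    have "\<zeta> \<noteq> 0" using z s s2 x0 by auto
    moreover have "\<zeta> \<in> U" using z r by blast
    ultimately show "\<exists>\<zeta>. norm \<zeta> < 1 \<and> y analytic_on {\<zeta>} \<and> y \<zeta> = x"
      using T(3)[of \<zeta>] z s2 x0 by (intro exI[of _ \<zeta>]) (auto simp: U_def)
  qed (use \<eta> in simp)
qed

lemma cubic_ne_0_if_large:
  fixes x g2 g3 :: complex
  assumes "norm x \<ge> 1 + norm g2 + norm g3"
  shows "4 * x^3 - g2 * x - g3 \<noteq> 0"
proof
  assume "4 * x^3 - g2 * x - g3 = 0"
  then have "4 * x^3 = g2 * x + g3" by (simp add: algebra_simps)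
  then have le: "norm (4 * x^3) \<le> norm g2 * norm x + norm g3" by (metis norm_mult norm_triangle_ineq)
  have x1: "norm x \<ge> 1" using assms norm_ge_zero[of g2] norm_ge_zero[of g3] by linarith
  have "norm g2 * norm x + norm g3 \<le> norm g2 * norm x + norm g3 * norm x"
    using mult_left_mono[OF x1, of "norm g3"] by simp
  also have "\<dots> \<le> norm x * norm x" using assms mult_right_mono[of "norm g2 + norm g3" "norm x" "norm x"] by (simp add: algebra_simps)
  also have "\<dots> \<le> norm x * (norm x * norm x)" using x1 mult_right_mono[OF x1, of "norm x * norm x"] by simp
  finally have "norm g2 * norm x + norm g3 \<le> norm x * (norm x * norm x)" .
  moreover have "norm x * (norm x * norm x) > 0" using x1 by (intro mult_pos_pos) linarith+
  moreover have "norm (4 * x^3) = 4 * (norm x * (norm x * norm x))" by (simp add: norm_mult norm_power power3_eq_cube)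
  ultimately show False using le by linarith
qed

text \<open>A large value is also taken near the pole 0. Up to a change of sign the derivatives agree as well,
so the solution is a translate or a reflected translate of itself, and the pole 0 moves close to the
point in question.\<close>
lemma pole_near_large_value:
  assumes y: "pole_solution g2 g3 y"
  obtains M where "M > 0" "\<And>z. y analytic_on {z} \<Longrightarrow> norm (y z) \<ge> M \<Longrightarrow> \<exists>p. is_pole y p \<and> dist z p < 1"
proof -
  obtain M0 where M0: "M0 > 0" "\<And>x. norm x \<ge> M0 \<Longrightarrow> \<exists>\<zeta>. norm \<zeta> < 1 \<and> y analytic_on {\<zeta>} \<and> y \<zeta> = x"
    using pole_solution_attains_large[OF y] by blast
  define M where "M = max M0 (1 + norm g2 + norm g3)"
  have m: "y meromorphic_on UNIV" and p0: "is_pole y 0"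
    and ode: "\<forall>\<^sub>\<approx>z. (deriv y z)^2 = 4 * y z ^ 3 - g2 * y z - g3" using pole_solutionD[OF y] by simp_all
  have odeat: "\<forall>\<^sub>F z in at w. (deriv y z)^2 = 1 * (4 * y z ^ 3 - g2 * y z - g3)" for w
    using pole_solutionD(4)[OF y, of w] by simp
  have ode1: "(deriv y z)^2 = 4 * y z ^ 3 - g2 * y z - g3" if "y analytic_on {z}" for z
    using cubic_ode_at_analytic[where v="\<lambda>_. 1", OF odeat that] by simp
  have "\<exists>p. is_pole y p \<and> dist z p < 1" if z: "y analytic_on {z}" "norm (y z) \<ge> M" for z
  proof -
    obtain \<zeta> where \<zeta>: "norm \<zeta> < 1" "y analytic_on {\<zeta>}" "y \<zeta> = y z"
      using M0(2)[of "y z"] z by (auto simp: M_def)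
    have nz: "deriv y z \<noteq> 0"
      using ode1[OF z(1)] cubic_ne_0_if_large[of g2 g3 "y z"] z by (auto simp: M_def)
    have "(deriv y z)^2 = (deriv y \<zeta>)^2" using ode1[OF z(1)] ode1[OF \<zeta>(2)] \<zeta>(3) by simp
    then have "deriv y z = deriv y \<zeta> \<or> deriv y z = - deriv y \<zeta>" by (simp add: power2_eq_iff)
    then have "\<exists>e::complex. e^2 = 1 \<and> deriv y z = e * deriv y \<zeta>"
    proof
      assume "deriv y z = deriv y \<zeta>"
      then show ?thesis by (intro exI[of _ 1]) simp
    next
      assume "deriv y z = - deriv y \<zeta>"
      then show ?thesis by (intro exI[of _ "-1"]) simp
    qed
    then obtain e :: complex where e: "e^2 = 1" "deriv y z = e * deriv y \<zeta>" by blast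
    have e0: "e \<noteq> 0" and ee: "e * e = 1" using e by (auto simp: power2_eq_square)
    define b where "b = \<zeta> - e * z"
    define f where "f = (\<lambda>w. y (e * w + b))"
    have bz: "e * z + b = \<zeta>" by (simp add: b_def)
    have fa: "f analytic_on {z}"
      unfolding f_def by (rule analytic_on_compose_gen[of "\<lambda>w. e * w + b" "{z}" y "{\<zeta>}", unfolded o_def])
        (use \<zeta> bz in \<open>auto intro!: analytic_intros\<close>)
    have "(y has_field_derivative deriv y \<zeta>) (at (e * z + b))" using \<zeta> analytic_derivI bz by metis
    then have "(f has_field_derivative deriv y \<zeta> * e) (at z)"
      unfolding f_def by (rule DERIV_chain'[rotated]) (auto intro!: derivative_eq_intros)
    then have df: "deriv f z = deriv y z" using e by (simp add: DERIV_imp_deriv mult.commute)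
    have fm: "f meromorphic_on UNIV" unfolding f_def by (rule meromorphic_on_affine[OF m])
    have fode: "\<forall>\<^sub>F w in at z. (deriv f w)^2 = 1 * (4 * f w ^ 3 - g2 * f w - g3)"
      using eventually_cosparse_imp_eventually_at[OF cubic_ode_affine[OF m ode e(1), of b]] unfolding f_def by simp
    have "\<forall>\<^sub>\<approx>w. y w = f w"
      by (rule cubic_ode_regular_unique[where v="\<lambda>_. 1" and ?z1.0=z, OF m fm])
         (use z fa odeat fode df nz bz \<zeta>(3) in \<open>auto simp: f_def\<close>)
    from eventually_cosparse_imp_eventually_at[OF this UNIV_I]
    have ev: "\<forall>\<^sub>F w in at (z - e * \<zeta>). y w = f w" .
    have "e * (z - e * \<zeta>) + b = 0" unfolding b_def using ee by (simp add: algebra_simps flip: mult.assoc)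
    then have "is_pole f (z - e * \<zeta>)" unfolding f_def using is_pole_affine[of y e "z - e * \<zeta>" b] p0 e0 by simp
    then have "is_pole y (z - e * \<zeta>)" using is_pole_cong[OF ev refl] by simp
    moreover have "norm e ^ 2 = 1" using e(1) by (metis norm_one norm_power)
    then have "norm e = 1" by (simp add: power2_eq_1_iff) (use norm_ge_zero[of e] in linarith)
    then have "dist z (z - e * \<zeta>) < 1" using \<zeta>(1) by (simp add: dist_norm norm_mult)
    ultimately show ?thesis by blast
  qed
  then show ?thesis using that[of M] M0 by (auto simp: M_def)
qed

text \<open>On a large disc without poles the solution is bounded, so by Cauchy's estimates its first two
derivatives are small at the centre. The equation turns this into smallness of the cubic and of its
derivative at one point x, which a nonzero discriminant excludes.\<close>
lemma pole_solution_poles_dense: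
  assumes y: "pole_solution g2 g3 y" and disc: "g2^3 - 27 * g3^2 \<noteq> 0"
  obtains R where "R > 0" "\<And>z. \<exists>p. is_pole y p \<and> dist z p < R"
proof -
  obtain M where M: "M > 0" "\<And>z. y analytic_on {z} \<Longrightarrow> norm (y z) \<ge> M \<Longrightarrow> \<exists>p. is_pole y p \<and> dist z p < 1"
    using pole_near_large_value[OF y] by blast
  have m: "y meromorphic_on UNIV" and p0: "is_pole y 0"
    and ode: "\<forall>\<^sub>\<approx>z. (deriv y z)^2 = 4 * y z ^ 3 - g2 * y z - g3" using pole_solutionD[OF y] by simp_all
  \<comment> \<open>M bounds the solution away from its poles, and K the coefficients of the identity bez below. The
    radius rho makes Cauchy's bounds for y'^2 and 2 y'' at most epsilon, which is too small for bez.\<close>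
  define K where "K = 3 * (3 * norm g3 + 2 * norm g2 * M) * (3 + M) + norm g2 ^ 2"
  have K: "K \<ge> 0" using M by (simp add: K_def)
  define \<delta> where "\<delta> = norm (g2^3 - 27 * g3^2)"
  have \<delta>: "\<delta> > 0" using disc by (simp add: \<delta>_def)
  define \<epsilon> where "\<epsilon> = \<delta> / (2 * (K + 1))"
  have "0 \<le> K * \<delta>" using \<delta> K by simp
  moreover have "\<delta> * (2 * (K + 1)) = K * \<delta> + K * \<delta> + 2 * \<delta>" by (simp add: algebra_simps)
  ultimately have "K * \<delta> < \<delta> * (2 * (K + 1))" using \<delta> by linarith
  then have "K * \<delta> / (2 * (K + 1)) < \<delta>" using K by (subst pos_divide_less_eq) simp_all
  then have \<epsilon>: "\<epsilon> > 0" "K * \<epsilon> < \<delta>" using \<delta> K by (auto simp: \<epsilon>_def)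
  define \<rho> where "\<rho> = 1 + M / \<epsilon> * M + 8 * M / \<epsilon> + M / \<epsilon>"
  have \<rho>: "\<rho> \<ge> 1" using M \<epsilon> by (simp add: \<rho>_def)
  have \<rho>1: "(M / \<rho>)^2 \<le> \<epsilon>" and \<rho>2: "4 * M / \<rho>^2 \<le> \<epsilon>"
  proof -
    have sq: "\<rho> \<le> \<rho>^2" using \<rho> by (simp add: power2_eq_square)
    have nn: "M / \<epsilon> * M \<ge> 0" "M / \<epsilon> \<ge> 0" "8 * M / \<epsilon> \<ge> 0" using M \<epsilon> by simp_all
    have "M^2 / \<epsilon> = M / \<epsilon> * M" by (simp add: power2_eq_square)
    also have "\<dots> \<le> \<rho>" unfolding \<rho>_def using nn by linarith
    finally have "M^2 / \<epsilon> \<le> \<rho>" .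
    then have "M^2 / \<epsilon> \<le> \<rho>^2" using sq by linarith
    then show "(M / \<rho>)^2 \<le> \<epsilon>" using \<epsilon> \<rho> by (simp add: power_divide field_simps)
    have "4 * M / \<epsilon> \<le> 8 * M / \<epsilon>" using M \<epsilon> by (simp add: field_simps)
    also have "8 * M / \<epsilon> \<le> \<rho>" unfolding \<rho>_def using nn by linarith
    finally have "4 * M / \<epsilon> \<le> \<rho>^2" using sq by linarith
    then show "4 * M / \<rho>^2 \<le> \<epsilon>" using \<epsilon> \<rho> by (simp add: field_simps)
  qed
  have "\<exists>p. is_pole y p \<and> dist z0 p < 2 + \<rho>" for z0
  proof (rule ccontr)
    assume no: "\<not> ?thesis"
    define f where "f = remove_sings y"
    define A where "A = ball z0 (1 + \<rho>)"
    have fa: "f analytic_on A"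
    proof (rule nicely_meromorphic_without_singularities)
      show "f nicely_meromorphic_on A"
        unfolding f_def by (rule remove_sings_nicely_meromorphic[OF pole_solutionD(1)[OF y]])
      show "\<forall>z\<in>A. \<not> is_pole f z"
      proof
        fix z assume z: "z \<in> A"
        have "\<not> is_pole y z" using no z by (fastforce simp: A_def)
        moreover have "isolated_singularity_at y z"
          by (rule meromorphic_on_isolated_singularity[OF pole_solutionD(1)[OF y]])
        ultimately show "\<not> is_pole f z" by (simp add: f_def)
      qed
    qed
    have fev: "\<forall>\<^sub>\<approx>z. f z = y z" unfolding f_def by (rule eventually_remove_sings_eq[OF m])
    have fode: "\<forall>\<^sub>F w in at z. (deriv f w)^2 = 1 * (4 * f w ^ 3 - g2 * f w - g3)" for z
      using eventually_cosparse_imp_eventually_at[OF fev UNIV_I] deriv_eq_at[OF eventually_cosparse_imp_eventually_at[OF fev UNIV_I]]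
        pole_solutionD(4)[OF y] by eventually_elim simp
    have fan: "f analytic_on {z}" if "z \<in> A" for z by (rule analytic_on_subset[OF fa]) (use that in simp)
    have bnd1: "norm (f z) \<le> M" if z: "z \<in> A" "y analytic_on {z}" for z
    proof (rule ccontr)
      assume "\<not> norm (f z) \<le> M"
      then have "norm (y z) \<ge> M" using z by (simp add: f_def)
      then obtain p where p: "is_pole y p" "dist z p < 1" using M z by blast
      then have "dist z0 p < 2 + \<rho>" using z dist_triangle[of z0 p z] by (simp add: A_def)
      then show False using no p by blast
    qed
    have bnd: "norm (f z) \<le> M" if z: "z \<in> A" for z
    proof (rule tendsto_upperbound[where F="at z"])
      have "f \<midarrow>z\<rightarrow> f z" using analytic_at_imp_isCont[OF fan[OF z]] by (simp add: isCont_def)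
      then show "((\<lambda>w. norm (f w)) \<longlongrightarrow> norm (f z)) (at z)" by (rule tendsto_norm)
      have "\<forall>\<^sub>F w in at z. w \<in> A" using z by (intro eventually_at_in_open') (auto simp: A_def)
      moreover note pole_solutionD(5)[OF y, of z]
      ultimately show "\<forall>\<^sub>F w in at z. norm (f w) \<le> M" by eventually_elim (rule bnd1)
    qed auto
    have fhA: "f holomorphic_on A" using fa by (rule analytic_imp_holomorphic)
    have sub: "cball z0 \<rho> \<subseteq> A" by (auto simp: A_def)
    have d1: "norm ((deriv ^^ n) f z0) \<le> fact n * M / \<rho> ^ n" for n
    proof (rule Cauchy_inequality)
      show "f holomorphic_on ball z0 \<rho>" by (rule holomorphic_on_subset[OF fhA]) (use sub ball_subset_cball in blast)
      show "continuous_on (cball z0 \<rho>) f"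
        by (rule continuous_on_subset[OF holomorphic_on_imp_continuous_on[OF fhA] sub])
      show "norm (f x) \<le> M" if "norm (z0 - x) = \<rho>" for x
        using that by (intro bnd) (simp add: A_def dist_norm)
    qed (use \<rho> in simp)
    have e1: "norm (deriv f z0) \<le> M / \<rho>" using d1[of 1] by simp
    have e2: "norm (deriv (deriv f) z0) \<le> 2 * M / \<rho>^2" using d1[of 2] by (simp add: numeral_2_eq_2)
    have fz0: "f analytic_on {z0}" using fan \<rho> by (simp add: A_def)
    define x where "x = f z0"
    have xM: "norm x \<le> M" using bnd[of z0] \<rho> by (simp add: x_def A_def)
    have c1: "4 * x^3 - g2 * x - g3 = (deriv f z0)^2"
      using cubic_ode_at_analytic[where v="\<lambda>_. 1", OF fode fz0] by (simp add: x_def)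
    have c2: "12 * x^2 - g2 = 2 * deriv (deriv f) z0"
    proof -
      have "\<forall>\<^sub>F w in at z0. (deriv f w) \<noteq> 0"
      proof -
        consider "\<forall>\<^sub>\<approx>z. deriv y z = 0" | "\<forall>\<^sub>\<approx>z. deriv y z \<noteq> 0"
          using meromorphic_imp_constant_or_avoid[OF meromorphic_on_deriv[OF m] open_UNIV connected_UNIV, of 0] by blast
        then have "\<forall>\<^sub>\<approx>z. deriv y z \<noteq> 0"
        proof cases
          case 1
          have "\<forall>\<^sub>F w in at 0. 4 * y w ^ 3 - g2 * y w - g3 \<noteq> 0"
            using cubic_filterlim_at_infinity p0 filterlim_at_infinity_imp_eventually_ne unfolding is_pole_def by blast
          with eventually_cosparse_imp_eventually_at[OF 1 UNIV_I, of 0] pole_solutionD(4)[OF y, of 0]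
          have "\<forall>\<^sub>F w in at (0::complex). False" by eventually_elim simp
          then show ?thesis by simp
        qed
        from eventually_cosparse_imp_eventually_at[OF this UNIV_I]
        have "\<forall>\<^sub>F w in at z0. deriv y w \<noteq> 0" .
        with deriv_eq_at[OF eventually_cosparse_imp_eventually_at[OF fev UNIV_I]] show ?thesis
          by eventually_elim simp
      qed
      moreover have "\<forall>\<^sub>F w in at z0. w \<in> A" using \<rho> by (intro eventually_at_in_open') (auto simp: A_def)
      ultimately have ev: "\<forall>\<^sub>F w in at z0. 12 * f w^2 - g2 = 2 * deriv (deriv f) w"
        using eventually_at_imp_eventually_nhds[OF fode[of z0]]
      proof eventually_elim
        case (elim w)
        have d: "(f has_field_derivative deriv f w) (at w)" using fan elim analytic_derivI by blast
        have dd: "(deriv f has_field_derivative deriv (deriv f) w) (at w)" using fan elim analytic_derivI analytic_deriv by blast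
        have "((\<lambda>w. (deriv f w)^2) has_field_derivative 2 * deriv f w * deriv (deriv f) w) (at w)"
          by (auto intro!: derivative_eq_intros dd)
        moreover have "((\<lambda>w. 1 * (4 * f w ^ 3 - g2 * f w - g3)) has_field_derivative (12 * f w^2 - g2) * deriv f w) (at w)"
          by (auto intro!: derivative_eq_intros d simp: algebra_simps)
        ultimately have "2 * deriv f w * deriv (deriv f) w = (12 * f w^2 - g2) * deriv f w"
          using deriv_cong_ev[OF elim(3) refl] by (simp only: DERIV_imp_deriv)
        then show ?case using elim(1) by simp
      qed
      have c: "f \<midarrow>z0\<rightarrow> f z0" "deriv (deriv f) \<midarrow>z0\<rightarrow> deriv (deriv f) z0"
        using fz0 analytic_at_imp_isCont analytic_deriv unfolding isCont_def by blast+
      have "((\<lambda>w. 12 * f w^2 - g2) \<longlongrightarrow> 12 * f z0^2 - g2) (at z0)" by (intro tendsto_intros c)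
      moreover have "((\<lambda>w. 2 * deriv (deriv f) w) \<longlongrightarrow> 2 * deriv (deriv f) z0) (at z0)" by (intro tendsto_intros c)
      then have "((\<lambda>w. 12 * f w^2 - g2) \<longlongrightarrow> 2 * deriv (deriv f) z0) (at z0)"
        by (rule tendsto_cong[THEN iffD2, OF ev])
      ultimately show ?thesis unfolding x_def using tendsto_unique[OF trivial_limit_at] by blast
    qed
    have n1: "norm (4 * x^3 - g2 * x - g3) \<le> \<epsilon>"
      unfolding c1 norm_power using power_mono[OF e1, of 2] \<rho>1 by simp
    have n2: "norm (12 * x^2 - g2) \<le> \<epsilon>"
      unfolding c2 norm_mult using e2 \<rho>2 by simp
    \<comment> \<open>A Bezout identity for the cubic and its derivative.\<close>
    have bez: "g2^3 - 27 * g3^2 = 3 * (3 * g3 - 2 * g2 * x) * (3 * (4 * x^3 - g2 * x - g3) - x * (12 * x^2 - g2)) - g2^2 * (12 * x^2 - g2)"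
      by (simp add: algebra_simps power2_eq_square power3_eq_cube)
    have b1: "norm (3 * g3 - 2 * g2 * x) \<le> 3 * norm g3 + 2 * norm g2 * M"
      using norm_triangle_ineq4[of "3 * g3" "2 * g2 * x"] mult_left_mono[OF xM, of "2 * norm g2"] by (simp add: norm_mult)
    have b2: "norm (3 * (4 * x^3 - g2 * x - g3) - x * (12 * x^2 - g2)) \<le> (3 + M) * \<epsilon>"
    proof -
      have "norm (3 * (4 * x^3 - g2 * x - g3)) \<le> 3 * \<epsilon>" using n1 by (simp only: norm_mult norm_numeral)
      moreover have "norm (x * (12 * x^2 - g2)) \<le> M * \<epsilon>"
        unfolding norm_mult using M by (intro mult_mono xM n2) auto
      ultimately show ?thesis
        using norm_triangle_ineq4[of "3 * (4 * x^3 - g2 * x - g3)" "x * (12 * x^2 - g2)"]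
        unfolding distrib_right by linarith
    qed
    have "\<delta> \<le> norm (3 * (3 * g3 - 2 * g2 * x) * (3 * (4 * x^3 - g2 * x - g3) - x * (12 * x^2 - g2))) + norm (g2^2 * (12 * x^2 - g2))"
      unfolding \<delta>_def bez by (rule norm_triangle_ineq4)
    also have "\<dots> \<le> 3 * (3 * norm g3 + 2 * norm g2 * M) * ((3 + M) * \<epsilon>) + norm g2^2 * \<epsilon>"
      unfolding norm_mult norm_power using b1 b2 n2 M by (intro add_mono mult_mono) auto
    also have "\<dots> = K * \<epsilon>" by (simp add: K_def algebra_simps)
    finally show False using \<epsilon> by simp
  qed
  then show ?thesis using that[of "2 + \<rho>"] \<rho> by auto
qed

section \<open>Lattices in the complex plane\<close>
lemma finite_closed_bound_argmin:
  fixes f :: "'a \<Rightarrow> real"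
  assumes "S \<noteq> {}" "\<And>r. finite {x\<in>S. f x \<le> r}"
  obtains m where "m \<in> S" "\<And>x. x \<in> S \<Longrightarrow> f m \<le> f x"
proof -
  obtain a where a: "a \<in> S" using assms by auto
  let ?T = "{x\<in>S. f x \<le> f a}"
  have "finite ?T" "?T \<noteq> {}" using assms a by auto
  then obtain m where m: "m \<in> ?T" "\<forall>x\<in>?T. f m \<le> f x"
    by (meson finite_imageI arg_min_if_finite(1) arg_min_least)
  show ?thesis
  proof (rule that[of m])
    show "m \<in> S" using m by auto
    fix x assume "x \<in> S"
    then show "f m \<le> f x" using m by (cases "f x \<le> f a") auto
  qed
qed

text \<open>The usual reduction: w1 is a shortest nonzero element and w2 has the least distance to the real line
through w1 among the elements off that line. Density is what makes elements off the line exist.\<close>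
lemma discrete_dense_subgroup_is_lattice:
  fixes L :: "complex set"
  assumes zero: "0 \<in> L" and add: "\<And>x y. x \<in> L \<Longrightarrow> y \<in> L \<Longrightarrow> x + y \<in> L" and minus: "\<And>x. x \<in> L \<Longrightarrow> - x \<in> L"
    and fin: "\<And>r. finite {x\<in>L. norm x \<le> r}" and dense: "\<And>z. \<exists>p\<in>L. dist z p < R"
  shows "is_lattice L"
proof -
  have diff: "x - y \<in> L" if "x \<in> L" "y \<in> L" for x y using add[OF that(1) minus[OF that(2)]] by simp
  have natmul: "of_nat n * x \<in> L" if "x \<in> L" for n x
    by (induction n) (use zero add[OF that, of "of_nat n * x" for n] in \<open>auto simp: distrib_right\<close>)
  have intmul: "of_int m * x \<in> L" if "x \<in> L" for m x
    by (cases m rule: int_cases2) (use natmul[OF that] minus in auto)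
  have R: "R > 0" using dense[of 0] zero_le_dist[of 0] by (meson le_less_trans)
  have "L - {0} \<noteq> {}"
  proof -
    obtain p where "p \<in> L" "dist (of_real R) p < R" using dense by blast
    then show ?thesis using R by (auto simp: dist_norm)
  qed
  moreover have "finite {x\<in>L - {0}. norm x \<le> r}" for r by (rule finite_subset[OF _ fin[of r]]) auto
  ultimately obtain w1 where w1: "w1 \<in> L - {0}" "\<And>x. x \<in> L - {0} \<Longrightarrow> norm w1 \<le> norm x"
    using finite_closed_bound_argmin[of "L - {0}" norm] by blast
  have w10: "w1 \<noteq> 0" using w1 by auto
  \<comment> \<open>Reducing modulo w1 bounds the real part, so that for any bound on the imaginary part only finitely
    many candidates for w2 remain.\<close>
  define S where "S = {w\<in>L. Im (w / w1) \<noteq> 0 \<and> \<bar>Re (w / w1)\<bar> \<le> 1}"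
  have reduce: "\<exists>m::int. \<bar>Re ((w - of_int m * w1) / w1)\<bar> \<le> 1/2 \<and> Im ((w - of_int m * w1) / w1) = Im (w / w1)" for w
  proof (intro exI conjI)
    show "\<bar>Re ((w - of_int (round (Re (w / w1))) * w1) / w1)\<bar> \<le> 1/2"
      using w10 of_int_round_abs_le[of "Re (w / w1)"] by (simp add: diff_divide_distrib abs_minus_commute)
    show "Im ((w - of_int (round (Re (w / w1))) * w1) / w1) = Im (w / w1)"
      using w10 by (simp add: diff_divide_distrib)
  qed
  have "S \<noteq> {}"
  proof -
    define t where "t = R / norm w1 + 1"
    have t: "t > 0" using R by (simp add: t_def add_nonneg_pos)
    obtain p where p: "p \<in> L" "dist (\<i> * of_real t * w1) p < R" using dense by blast
    have "norm ((\<i> * of_real t * w1 - p) / w1) < t"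
    proof -
      have "R / norm w1 < t" by (simp add: t_def)
      moreover have "norm ((\<i> * of_real t * w1 - p) / w1) < R / norm w1"
        unfolding norm_divide using p(2) w10 by (intro divide_strict_right_mono) (auto simp: dist_norm)
      ultimately show ?thesis by linarith
    qed
    then have "norm (\<i> * of_real t - p / w1) < t" using w10 by (simp add: diff_divide_distrib)
    then have "\<bar>Im (\<i> * of_real t - p / w1)\<bar> < t" using abs_Im_le_cmod le_less_trans by blast
    then have Imp: "Im (p / w1) \<noteq> 0" using t by auto
    obtain m :: int where m: "\<bar>Re ((p - of_int m * w1) / w1)\<bar> \<le> 1/2" "Im ((p - of_int m * w1) / w1) = Im (p / w1)"
      using reduce by blast
    have "p - of_int m * w1 \<in> S" unfolding S_def using m Imp p intmul w1 diff by auto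
    then show ?thesis by blast
  qed
  moreover have "finite {x\<in>S. \<bar>Im (x / w1)\<bar> \<le> r}" for r
  proof (rule finite_subset[OF _ fin[of "(1 + r) * norm w1"]], safe)
    fix x assume x: "x \<in> S" "\<bar>Im (x / w1)\<bar> \<le> r"
    then show "x \<in> L" by (simp add: S_def)
    have "norm (x / w1) \<le> 1 + r" using cmod_le[of "x / w1"] x by (auto simp: S_def)
    then show "norm x \<le> (1 + r) * norm w1" using w10 by (simp add: norm_divide field_simps)
  qed
  ultimately obtain w2 where w2: "w2 \<in> S" "\<And>x. x \<in> S \<Longrightarrow> \<bar>Im (w2 / w1)\<bar> \<le> \<bar>Im (x / w1)\<bar>"
    using finite_closed_bound_argmin[of S "\<lambda>x. \<bar>Im (x / w1)\<bar>"] by blast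
  have Imw2: "Im (w2 / w1) \<noteq> 0" and w2L: "w2 \<in> L" using w2 by (auto simp: S_def)
  have "\<exists>m n. z = of_int m * w1 + of_int n * w2" if z: "z \<in> L" for z
  proof -
    define n where "n = round (Im (z / w1) / Im (w2 / w1))"
    define x where "x = z - of_int n * w2"
    have xL: "x \<in> L" unfolding x_def using z w2L intmul diff by auto
    have "Im (x / w1) = (Im (z / w1) / Im (w2 / w1) - of_int n) * Im (w2 / w1)"
    proof -
      have "x / w1 = z / w1 - of_int n * (w2 / w1)" by (simp add: x_def diff_divide_distrib)
      then have "Im (x / w1) = Im (z / w1) - of_int n * Im (w2 / w1)"
        by (simp del: times_divide_eq_right times_divide_eq_left)
      then show ?thesis using Imw2 by (simp add: left_diff_distrib)
    qed
    then have "\<bar>Im (x / w1)\<bar> = \<bar>Im (z / w1) / Im (w2 / w1) - of_int n\<bar> * \<bar>Im (w2 / w1)\<bar>" by (simp add: abs_mult)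
    also have "\<dots> \<le> 1/2 * \<bar>Im (w2 / w1)\<bar>"
      using of_int_round_abs_le[of "Im (z / w1) / Im (w2 / w1)"]
      by (intro mult_right_mono) (auto simp: n_def abs_minus_commute)
    also have "\<dots> < \<bar>Im (w2 / w1)\<bar>" using Imw2 by simp
    finally have lt: "\<bar>Im (x / w1)\<bar> < \<bar>Im (w2 / w1)\<bar>" .
    obtain m :: int where m: "\<bar>Re ((x - of_int m * w1) / w1)\<bar> \<le> 1/2" "Im ((x - of_int m * w1) / w1) = Im (x / w1)"
      using reduce by blast
    define x' where "x' = x - of_int m * w1"
    have x'L: "x' \<in> L" unfolding x'_def using xL w1 intmul diff by auto
    have Im0: "Im (x' / w1) = 0"
    proof (rule ccontr)
      assume "Im (x' / w1) \<noteq> 0"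
      then have "x' \<in> S" using x'L m by (auto simp: S_def x'_def)
      then show False using w2(2)[of x'] lt m(2) by (simp add: x'_def)
    qed
    have "norm (x' / w1) \<le> 1/2" using cmod_le[of "x' / w1"] Im0 m(1) by (simp add: x'_def)
    then have "2 * norm x' \<le> norm w1" using w10 by (simp add: norm_divide field_simps)
    moreover have "norm w1 > 0" using w10 by simp
    ultimately have "norm x' < norm w1" by linarith
    then have "x' = 0" using w1(2)[of x'] x'L by auto
    then have "z = of_int m * w1 + of_int n * w2" by (simp add: x'_def x_def algebra_simps)
    then show ?thesis by blast
  qed
  moreover have "of_int m * w1 + of_int n * w2 \<in> L" for m n using w1 w2L intmul add by auto
  ultimately have "L = {of_int m * w1 + of_int n * w2 | m n. True}" by blast
  then show ?thesis unfolding is_lattice_def using Imw2 by blast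
qed

lemma lattice_closed:
  assumes "is_lattice L"
  shows "0 \<in> L" "x \<in> L \<Longrightarrow> y \<in> L \<Longrightarrow> x + y \<in> L" "x \<in> L \<Longrightarrow> - x \<in> L" "x \<in> L \<Longrightarrow> y \<in> L \<Longrightarrow> x - y \<in> L"
proof -
  obtain w1 w2 where L: "L = {of_int m * w1 + of_int n * w2 | m n. True}" using assms is_lattice_def by auto
  show "0 \<in> L" unfolding L by (auto intro!: exI[of _ 0])
  show A: "x + y \<in> L" if "x \<in> L" "y \<in> L" for x y
  proof -
    obtain a b c d where "x = of_int a * w1 + of_int b * w2" "y = of_int c * w1 + of_int d * w2" using \<open>x \<in> L\<close> \<open>y \<in> L\<close> L by auto
    then have "x + y = of_int (a+c) * w1 + of_int (b+d) * w2" by (simp add: algebra_simps)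
    then show ?thesis unfolding L by blast
  qed
  show B: "- x \<in> L" if "x \<in> L" for x
  proof -
    obtain a b where "x = of_int a * w1 + of_int b * w2" using \<open>x \<in> L\<close> L by auto
    then have "- x = of_int (-a) * w1 + of_int (-b) * w2" by (simp add: algebra_simps)
    then show ?thesis unfolding L by blast
  qed
  show "x \<in> L \<Longrightarrow> y \<in> L \<Longrightarrow> x - y \<in> L" using A[of x "-y"] B by simp
qed

text \<open>With t = w2/w1, the imaginary parts of m + n t and of (m + n t) times the conjugate of t are
n Im t and - m Im t; they bound n and m.\<close>
lemma lattice_norm_bound:
  assumes "Im (w2 / w1) \<noteq> 0"
  obtains C where "C > 0" "\<And>m n::int. real_of_int (\<bar>m\<bar> + \<bar>n\<bar>) \<le> C * norm (of_int m * w1 + of_int n * w2)"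
proof -
  define t where "t = w2 / w1"
  have w10: "w1 \<noteq> 0" using assms by auto
  have It: "\<bar>Im t\<bar> > 0" using assms by (simp add: t_def)
  define C where "C = (1 + norm t) / (\<bar>Im t\<bar> * norm w1)"
  have "real_of_int (\<bar>m\<bar> + \<bar>n\<bar>) \<le> C * norm (of_int m * w1 + of_int n * w2)" for m n :: int
  proof -
    define s where "s = of_int m + of_int n * t"
    have e: "of_int m * w1 + of_int n * w2 = w1 * s" using w10 by (simp add: s_def t_def algebra_simps)
    have "\<bar>of_int n\<bar> * \<bar>Im t\<bar> = \<bar>Im s\<bar>" by (simp add: s_def abs_mult)
    also have "\<dots> \<le> norm s" by (rule abs_Im_le_cmod)
    finally have n: "\<bar>of_int n\<bar> * \<bar>Im t\<bar> \<le> norm s" .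
    have "Im (s * cnj t) = - (of_int m * Im t)" by (simp add: s_def algebra_simps)
    then have "\<bar>of_int m\<bar> * \<bar>Im t\<bar> = \<bar>Im (s * cnj t)\<bar>" by (simp add: abs_mult)
    also have "\<dots> \<le> norm (s * cnj t)" by (rule abs_Im_le_cmod)
    also have "\<dots> = norm s * norm t" by (simp add: norm_mult)
    finally have "\<bar>of_int m\<bar> * \<bar>Im t\<bar> \<le> norm s * norm t" .
    with n have "real_of_int (\<bar>m\<bar> + \<bar>n\<bar>) * \<bar>Im t\<bar> \<le> (1 + norm t) * norm s" by (simp add: algebra_simps)
    then have "real_of_int (\<bar>m\<bar> + \<bar>n\<bar>) \<le> (1 + norm t) * norm s / \<bar>Im t\<bar>" using It by (subst pos_le_divide_eq) auto
    also have "\<dots> = C * norm (w1 * s)" using w10 It by (simp add: C_def norm_mult)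
    finally show ?thesis unfolding e .
  qed
  moreover have "C > 0" using It w10 by (simp add: C_def add_pos_nonneg)
  ultimately show ?thesis using that by blast
qed

lemma lattice_finite:
  assumes "is_lattice L"
  shows "finite {w\<in>L. norm w \<le> r}"
proof -
  obtain w1 w2 where I: "Im (w2 / w1) \<noteq> 0" and L: "L = {of_int m * w1 + of_int n * w2 | m n. True}" using assms is_lattice_def by auto
  obtain C where C: "C > 0" "\<And>m n::int. real_of_int (\<bar>m\<bar> + \<bar>n\<bar>) \<le> C * norm (of_int m * w1 + of_int n * w2)"
    using lattice_norm_bound[OF I] by blast
  define N where "N = \<lceil>C * r\<rceil>"
  have "{w\<in>L. norm w \<le> r} \<subseteq> (\<lambda>(m,n). of_int m * w1 + of_int n * w2) ` ({-N..N} \<times> {-N..N})"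
  proof
    fix w assume "w \<in> {w\<in>L. norm w \<le> r}"
    then obtain m n where w: "w = of_int m * w1 + of_int n * w2" "norm w \<le> r" using L by auto
    have "real_of_int (\<bar>m\<bar> + \<bar>n\<bar>) \<le> C * r" using order_trans[OF C(2)[of m n, folded w(1)] mult_left_mono[OF w(2) less_imp_le[OF C(1)]]] .
    then have "\<bar>m\<bar> + \<bar>n\<bar> \<le> N" unfolding N_def by linarith
    then have "m \<in> {-N..N}" "n \<in> {-N..N}" by auto
    then show "w \<in> (\<lambda>(m,n). of_int m * w1 + of_int n * w2) ` ({-N..N} \<times> {-N..N})"
      using w by (intro image_eqI[of _ _ "(m, n)"]) auto
  qed
  then show ?thesis by (rule finite_subset) auto
qed

lemma lattice_dense:
  assumes "is_lattice L"
  obtains R where "R > 0" "\<And>z. \<exists>p\<in>L. dist z p < R"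
proof -
  obtain w1 w2 where I: "Im (w2 / w1) \<noteq> 0" and L: "L = {of_int m * w1 + of_int n * w2 | m n. True}" using assms is_lattice_def by auto
  define t where "t = w2 / w1"
  have w10: "w1 \<noteq> 0" using I by auto
  have It: "Im t \<noteq> 0" using I by (simp add: t_def)
  have "\<exists>p\<in>L. dist z p < norm w1 + norm w2" for z
  proof -
    define b where "b = Im (z / w1) / Im t"
    define a where "a = Re (z / w1) - b * Re t"
    have "z / w1 = of_real a + of_real b * t" using It by (simp add: complex_eq_iff a_def b_def)
    then have z: "z = of_real a * w1 + of_real b * w2" using w10 by (simp add: t_def field_simps)
    define p where "p = of_int (round a) * w1 + of_int (round b) * w2"
    have "z - p = of_real (a - of_int (round a)) * w1 + of_real (b - of_int (round b)) * w2"
      by (simp add: z p_def algebra_simps)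
    then have "norm (z - p) \<le> \<bar>a - of_int (round a)\<bar> * norm w1 + \<bar>b - of_int (round b)\<bar> * norm w2"
      using norm_triangle_ineq by (metis norm_mult norm_of_real)
    also have "\<dots> \<le> 1/2 * norm w1 + 1/2 * norm w2"
      using of_int_round_abs_le[of a] of_int_round_abs_le[of b]
      by (intro add_mono mult_right_mono) (auto simp: abs_minus_commute)
    also have "\<dots> < norm w1 + norm w2" using zero_less_norm_iff[of w1] w10 norm_ge_zero[of w2] by linarith
    finally show ?thesis unfolding L p_def dist_norm by blast
  qed
  moreover have "norm w1 + norm w2 > 0" using w10 by (simp add: add_pos_nonneg)
  ultimately show ?thesis using that by blast
qed

lemma summable_on_int_powr:
  "(\<lambda>m::int. (1 + \<bar>real_of_int m\<bar>) powr (-3/2)) summable_on UNIV"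
proof -
  let ?f = "\<lambda>m::int. (1 + \<bar>real_of_int m\<bar>) powr (-3/2)"
  have "summable (\<lambda>n. real n powr (-3/2))" by (simp add: summable_real_powr_iff)
  then have s: "summable (\<lambda>n. real (Suc n) powr (-3/2))" by (subst summable_Suc_iff)
  then have s1: "(\<lambda>n. real (Suc n) powr (-3/2)) summable_on UNIV"
    by (subst summable_on_UNIV_nonneg_real_iff) auto
  have "summable (\<lambda>n. real (Suc (Suc n)) powr (-3/2))" using s by (subst summable_Suc_iff)
  then have s2: "(\<lambda>n. real (Suc (Suc n)) powr (-3/2)) summable_on UNIV"
    by (subst summable_on_UNIV_nonneg_real_iff) auto
  have "?f summable_on (int ` UNIV)"
    by (subst summable_on_reindex) (use s1 in \<open>auto simp: o_def add.commute\<close>)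
  moreover have "?f summable_on ((\<lambda>n. - int n - 1) ` UNIV)"
    by (subst summable_on_reindex) (use s2 in \<open>auto simp: o_def add.commute inj_on_def\<close>)
  moreover have "int ` UNIV \<inter> (\<lambda>n. - int n - 1) ` UNIV = {}" by auto
  ultimately have "?f summable_on (int ` UNIV \<union> (\<lambda>n. - int n - 1) ` UNIV)"
    by (rule summable_on_Un_disjoint)
  moreover have "int ` UNIV \<union> (\<lambda>n. - int n - 1) ` UNIV = UNIV"
  proof -
    have "m \<in> int ` UNIV \<union> (\<lambda>n. - int n - 1) ` UNIV" for m
      by (cases "m \<ge> 0") (auto intro: image_eqI[of _ _ "nat m"] image_eqI[of _ _ "nat (- m - 1)"])
    then show ?thesis by auto
  qed
  ultimately show ?thesis by simp
qed

text \<open>Comparison with a product of two one-dimensional series: (1 + |m|)(1 + |n|) is at most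
4 (|m| + |n|)^2, hence the cube of |m| + |n| dominates the product to the power 3/2 up to a constant.\<close>
lemma lattice_cube_summable:
  assumes "is_lattice L"
  shows "(\<lambda>w. 1 / norm w ^ 3) summable_on L"
proof -
  obtain w1 w2 where I: "Im (w2 / w1) \<noteq> 0" and L: "L = {of_int m * w1 + of_int n * w2 | m n. True}" using assms is_lattice_def by auto
  obtain C where C: "C > 0" "\<And>m n::int. real_of_int (\<bar>m\<bar> + \<bar>n\<bar>) \<le> C * norm (of_int m * w1 + of_int n * w2)"
    using lattice_norm_bound[OF I] by blast
  define h where "h = (\<lambda>(m::int,n::int). of_int m * w1 + of_int n * w2)"
  have Lh: "L = h ` UNIV" unfolding L h_def by auto
  have inj: "inj h"
  proof (rule injI)
    fix x y :: "int \<times> int" assume e: "h x = h y"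
    obtain a b c d where xy: "x = (a,b)" "y = (c,d)" by (cases x, cases y) auto
    have "of_int (a - c) * w1 + of_int (b - d) * w2 = 0" using e by (simp add: h_def xy algebra_simps)
    then have "real_of_int (\<bar>a - c\<bar> + \<bar>b - d\<bar>) \<le> 0" using C(2)[of "a - c" "b - d"] by simp
    then have "\<bar>a - c\<bar> + \<bar>b - d\<bar> \<le> 0" by (simp only: of_int_le_0_iff)
    then have "a = c" "b = d" by linarith+
    then show "x = y" by (simp add: xy)
  qed
  define \<phi> where "\<phi> = (\<lambda>m::int. (1 + \<bar>real_of_int m\<bar>) powr (-3/2))"
  have \<phi>0: "\<phi> m \<ge> 0" for m by (simp add: \<phi>_def)
  have \<phi>s: "\<phi> summable_on UNIV" unfolding \<phi>_def by (rule summable_on_int_powr)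
  have "(\<lambda>(m,n). \<phi> m * \<phi> n) summable_on (Sigma UNIV (\<lambda>_. UNIV))"
  proof (rule summable_on_SigmaI)
    show "((\<lambda>n. (case (m, n) of (m, n) \<Rightarrow> \<phi> m * \<phi> n)) has_sum \<phi> m * infsum \<phi> UNIV) UNIV" for m
      using has_sum_cmult_right[OF has_sum_infsum[OF \<phi>s]] by simp
    show "(\<lambda>m. \<phi> m * infsum \<phi> UNIV) summable_on UNIV" using \<phi>s by (rule summable_on_cmult_left)
  qed (use \<phi>0 in auto)
  then have ps: "(\<lambda>x. 8 * C^3 * (\<phi> (fst x) * \<phi> (snd x))) summable_on UNIV"
    by (intro summable_on_cmult_right) (simp add: case_prod_unfold)
  have "((\<lambda>w. 1 / norm w ^ 3) \<circ> h) summable_on UNIV"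
  proof (rule summable_on_comparison_test[OF ps])
    fix x :: "int \<times> int"
    obtain m n where x: "x = (m,n)" by (cases x)
    define s where "s = real_of_int (\<bar>m\<bar> + \<bar>n\<bar>)"
    show "((\<lambda>w. 1 / norm w ^ 3) \<circ> h) x \<le> 8 * C^3 * (\<phi> (fst x) * \<phi> (snd x))"
    proof (cases "m = 0 \<and> n = 0")
      case True
      then show ?thesis using C \<phi>0 by (simp add: x h_def)
    next
      case False
      then have "\<bar>m\<bar> + \<bar>n\<bar> \<ge> 1" by linarith
      then have s1: "s \<ge> 1" unfolding s_def by linarith
      define a b where "a = 1 + \<bar>real_of_int m\<bar>" and "b = 1 + \<bar>real_of_int n\<bar>"
      have ab: "a > 0" "b > 0" by (auto simp: a_def b_def)
      have "a * b \<le> (2 * s) * (2 * s)"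
        by (rule mult_mono) (use s1 in \<open>auto simp: a_def b_def s_def\<close>)
      then have "(a * b) powr (3/2) \<le> ((2 * s)^2) powr (3/2)"
        using ab by (intro powr_mono2) (auto simp: power2_eq_square)
      also have "\<dots> = ((2 * s) powr 2) powr (3/2)" using s1 by (simp add: powr_numeral)
      also have "\<dots> = (2 * s) powr 3" by (simp add: powr_powr)
      also have "\<dots> = 8 * s^3" using s1 by (simp add: powr_numeral power_mult_distrib)
      finally have le: "(a * b) powr (3/2) \<le> 8 * s^3" .
      have phi: "\<phi> m * \<phi> n = 1 / (a * b) powr (3/2)"
        using ab by (simp add: \<phi>_def a_def[symmetric] b_def[symmetric] powr_mult powr_minus_divide)
      have sC: "s \<le> C * norm (h x)" using C(2)[of m n] by (simp add: s_def h_def x)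
      then have hx: "norm (h x) > 0" using s1 C by (metis less_le_trans mult_pos_pos zero_less_one norm_ge_zero not_less mult_nonneg_nonpos less_imp_le linorder_not_le zero_less_mult_pos)
      have "s^3 \<le> (C * norm (h x))^3" using sC s1 by (intro power_mono) auto
      then have "s^3 / norm (h x)^3 \<le> C^3" using hx by (simp add: power_mult_distrib field_simps)
      then have "1 / norm (h x)^3 \<le> C^3 / s^3" using s1 hx by (simp add: field_simps)
      also have "\<dots> \<le> C^3 * (8 / (a * b) powr (3/2))"
      proof -
        have "1 / s^3 \<le> 8 / (a * b) powr (3/2)" using le s1 ab by (simp add: field_simps)
        then show ?thesis using C mult_left_mono[of "1 / s^3" "8 / (a * b) powr (3/2)" "C^3"] by simp
      qed
      finally show ?thesis using phi by (simp add: x mult.commute)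
    qed
  qed auto
  then show ?thesis unfolding Lh using summable_on_reindex[OF inj, of "\<lambda>w. 1 / norm w ^ 3"] by simp
qed

section \<open>The Weierstrass function of a lattice\<close>

text \<open>The term for w = 0 is 1/z^2, because 1/0 = 0; thus the Weierstrass function is one sum over the
whole lattice.\<close>
definition wp_term :: "complex \<Rightarrow> complex \<Rightarrow> complex" where
  "wp_term w z = 1 / (z - w)\<^sup>2 - 1 / w\<^sup>2"

lemma wp_term_bound:
  assumes "norm z \<le> \<rho>" "norm w \<ge> 2 * \<rho>" "\<rho> > 0"
  shows "norm (wp_term w z) \<le> 10 * \<rho> * (1 / norm w ^ 3)"
proof -
  have wpos: "norm w > 0" using assms by linarith
  have h: "norm (z - w) \<ge> norm w / 2" using norm_triangle_ineq2[of w z] assms by (simp add: norm_minus_commute)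
  then have zw: "norm (z - w) > 0" using wpos by linarith
  have w0: "w \<noteq> 0" "z - w \<noteq> 0" using wpos zw by auto
  have "wp_term w z = z * (2 * w - z) / ((z - w)^2 * w^2)"
    using w0 by (simp add: wp_term_def divide_simps) (simp add: power2_eq_square algebra_simps)
  then have "norm (wp_term w z) = norm z * norm (2 * w - z) / (norm (z - w)^2 * norm w^2)"
    by (simp add: norm_divide norm_mult norm_power)
  also have "\<dots> \<le> (\<rho> * (5/2 * norm w)) / ((norm w / 2)^2 * norm w^2)"
  proof (rule frac_le)
    have "norm (2 * w - z) \<le> 2 * norm w + norm z" using norm_triangle_ineq4[of "2 * w" z] by (simp add: norm_mult)
    also have "\<dots> \<le> 5/2 * norm w" using assms by linarith
    finally show "norm z * norm (2 * w - z) \<le> \<rho> * (5/2 * norm w)" using assms by (intro mult_mono) auto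
    show "(norm w / 2)^2 * norm w^2 \<le> norm (z - w)^2 * norm w^2"
      using h by (intro mult_right_mono power_mono) auto
  qed (use wpos assms in auto)
  also have "\<dots> = 10 * \<rho> * (1 / norm w ^ 3)"
    using wpos by (simp add: field_simps power2_eq_square power3_eq_cube)
  finally show ?thesis .
qed

lemma wp_term_summable:
  assumes L: "is_lattice L"
  shows "(\<lambda>w. wp_term w z) summable_on L"
proof -
  define \<rho> where "\<rho> = norm z + 1"
  have \<rho>: "\<rho> > 0" "norm z \<le> \<rho>" by (auto simp: \<rho>_def add_nonneg_pos)
  define F where "F = {w\<in>L. norm w \<le> 2 * \<rho>}"
  have F: "finite F" unfolding F_def by (rule lattice_finite[OF L])
  have "(\<lambda>w. 1 / norm w ^ 3) summable_on (L - F)"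
    by (rule summable_on_subset_banach[OF lattice_cube_summable[OF L]]) auto
  then have "(\<lambda>w. 10 * \<rho> * (1 / norm w ^ 3)) summable_on (L - F)" by (rule summable_on_cmult_right)
  moreover have "norm (wp_term w z) \<le> 10 * \<rho> * (1 / norm w ^ 3)" if "w \<in> L - F" for w
    by (rule wp_term_bound) (use \<rho> that in \<open>auto simp: F_def\<close>)
  ultimately have "(\<lambda>w. norm (wp_term w z)) summable_on (L - F)"
    by (rule Infinite_Sum.abs_summable_on_comparison_test')
  then have "(\<lambda>w. wp_term w z) summable_on (L - F)" by (rule abs_summable_summable)
  moreover have "(\<lambda>w. wp_term w z) summable_on F" using F by simp
  ultimately have "(\<lambda>w. wp_term w z) summable_on ((L - F) \<union> F)" by (intro summable_on_Un_disjoint) auto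
  moreover have "(L - F) \<union> F = L" by (auto simp: F_def)
  ultimately show ?thesis by simp
qed

lemma lattice_wp_eq_infsum:
  assumes L: "is_lattice L"
  shows "lattice_wp L z = (\<Sum>\<^sub>\<infinity>w\<in>L. wp_term w z)"
proof -
  have s: "(\<lambda>w. wp_term w z) summable_on L - {0}"
    by (rule summable_on_subset_banach[OF wp_term_summable[OF L]]) auto
  have "L = insert 0 (L - {0})" using lattice_closed(1)[OF L] by auto
  then have "(\<Sum>\<^sub>\<infinity>w\<in>L. wp_term w z) = (\<Sum>\<^sub>\<infinity>w\<in>insert 0 (L - {0}). wp_term w z)" by simp
  also have "\<dots> = wp_term 0 z + (\<Sum>\<^sub>\<infinity>w\<in>L-{0}. wp_term w z)"
    by (rule infsum_insert[OF s]) simp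
  finally show ?thesis by (simp add: lattice_wp_def wp_term_def)
qed

text \<open>On a disc only finitely many terms are singular. The others converge uniformly, and their sum can
be differentiated term by term.\<close>
lemma lattice_wp_local:
  assumes L: "is_lattice L" and \<rho>: "\<rho> > 0"
  defines "F \<equiv> {w\<in>L. norm w \<le> 2 * \<rho>}"
  defines "A \<equiv> (\<lambda>z. \<Sum>\<^sub>\<infinity>w\<in>L - F. wp_term w z)"
  shows "finite F" "A holomorphic_on ball 0 \<rho>"
    "lattice_wp L z = (\<Sum>w\<in>F. wp_term w z) + A z"
    "uniform_limit (ball 0 \<rho>) (\<lambda>X z. \<Sum>w\<in>X. wp_term w z) A (finite_subsets_at_top (L - F))"
    "finite X \<Longrightarrow> X \<subseteq> L - F \<Longrightarrow> (\<lambda>z. \<Sum>w\<in>X. wp_term w z) holomorphic_on ball 0 \<rho>"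
proof -
  show F: "finite F" unfolding F_def by (rule lattice_finite[OF L])
  have far: "z \<noteq> w" if "w \<in> L - F" "z \<in> cball 0 \<rho>" for w z using that \<rho> by (auto simp: F_def)
  have hol: "(\<lambda>z. \<Sum>w\<in>X. wp_term w z) holomorphic_on cball 0 \<rho>" if "X \<subseteq> L - F" for X
    unfolding wp_term_def using that far by (intro holomorphic_intros) auto
  show holb: "finite X \<Longrightarrow> X \<subseteq> L - F \<Longrightarrow> (\<lambda>z. \<Sum>w\<in>X. wp_term w z) holomorphic_on ball 0 \<rho>" for X
    by (rule holomorphic_on_subset[OF hol ball_subset_cball])
  have "(\<lambda>w. 1 / norm w ^ 3) summable_on (L - F)"
    by (rule summable_on_subset_banach[OF lattice_cube_summable[OF L]]) auto
  then have sm: "(\<lambda>w. 10 * \<rho> * (1 / norm w ^ 3)) summable_on (L - F)" by (rule summable_on_cmult_right)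
  have ul: "uniform_limit (cball 0 \<rho>) (\<lambda>X z. \<Sum>w\<in>X. wp_term w z) A (finite_subsets_at_top (L - F))"
    unfolding A_def
  proof (rule Weierstrass_m_test_general[OF _ sm])
    show "norm (wp_term w z) \<le> 10 * \<rho> * (1 / norm w ^ 3)" if "w \<in> L - F" "z \<in> cball 0 \<rho>" for w z
      by (rule wp_term_bound) (use that \<rho> in \<open>auto simp: F_def\<close>)
  qed
  then show "uniform_limit (ball 0 \<rho>) (\<lambda>X z. \<Sum>w\<in>X. wp_term w z) A (finite_subsets_at_top (L - F))"
    by (rule uniform_limit_on_subset) (rule ball_subset_cball)
  show "A holomorphic_on ball 0 \<rho>"
  proof (rule holomorphic_uniform_limit[OF _ ul])
    show "\<forall>\<^sub>F X in finite_subsets_at_top (L - F).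
        continuous_on (cball 0 \<rho>) (\<lambda>z. \<Sum>w\<in>X. wp_term w z) \<and> (\<lambda>z. \<Sum>w\<in>X. wp_term w z) holomorphic_on ball 0 \<rho>"
    proof (rule eventually_finite_subsets_at_top_weakI)
      fix X assume "finite X" "X \<subseteq> L - F"
      then show "continuous_on (cball 0 \<rho>) (\<lambda>z. \<Sum>w\<in>X. wp_term w z) \<and> (\<lambda>z. \<Sum>w\<in>X. wp_term w z) holomorphic_on ball 0 \<rho>"
        by (intro conjI holomorphic_on_imp_continuous_on hol holb)
    qed
  qed auto
  have "L = F \<union> (L - F)" by (auto simp: F_def)
  then have "lattice_wp L z = (\<Sum>\<^sub>\<infinity>w\<in>F \<union> (L - F). wp_term w z)" using lattice_wp_eq_infsum[OF L] by simp
  also have "\<dots> = (\<Sum>\<^sub>\<infinity>w\<in>F. wp_term w z) + A z"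
    unfolding A_def by (rule infsum_Un_disjoint)
      (use F in \<open>auto intro: summable_on_subset_banach[OF wp_term_summable[OF L]]\<close>)
  finally show "lattice_wp L z = (\<Sum>w\<in>F. wp_term w z) + A z" using F by simp
qed

lemma
  assumes L: "is_lattice L"
  shows lattice_wp_meromorphic: "lattice_wp L meromorphic_on UNIV" and lattice_wp_analytic: "z \<notin> L \<Longrightarrow> lattice_wp L analytic_on {z}"
proof -
  have *: "lattice_wp L meromorphic_on {z} \<and> (z \<notin> L \<longrightarrow> lattice_wp L analytic_on {z})" for z
  proof -
    define \<rho> where "\<rho> = norm z + 1"
    have \<rho>: "\<rho> > 0" "z \<in> ball 0 \<rho>" by (auto simp: \<rho>_def add_nonneg_pos)
    define F where "F = {w\<in>L. norm w \<le> 2 * \<rho>}"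
    define A where "A = (\<lambda>z. \<Sum>\<^sub>\<infinity>w\<in>L - F. wp_term w z)"
    note loc = lattice_wp_local[OF L \<rho>(1), folded F_def, folded A_def]
    have eq: "lattice_wp L = (\<lambda>z. (\<Sum>w\<in>F. wp_term w z) + A z)" using loc(3) by (auto simp: A_def)
    have "A analytic_on ball 0 \<rho>" using loc(2) analytic_on_open by blast
    then have Aa: "A analytic_on {z}" by (rule analytic_on_subset) (use \<rho> in auto)
    have "lattice_wp L meromorphic_on {z}"
      unfolding eq wp_term_def using analytic_on_imp_meromorphic_on[OF Aa] by (intro meromorphic_intros)
    moreover have "lattice_wp L analytic_on {z}" if "z \<notin> L"
      unfolding eq wp_term_def using Aa that by (intro analytic_intros) (auto simp: F_def)
    ultimately show ?thesis by blast
  qed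
  show "lattice_wp L meromorphic_on UNIV" using * meromorphic_on_meromorphic_at by blast
  show "z \<notin> L \<Longrightarrow> lattice_wp L analytic_on {z}" using * by blast
qed

lemma lattice_wp_uminus:
  assumes L: "is_lattice L"
  shows "lattice_wp L (- z) = lattice_wp L z"
  unfolding lattice_wp_eq_infsum[OF L]
  by (rule infsum_reindex_bij_witness[where i=uminus and j=uminus])
     (use lattice_closed[OF L] in \<open>auto simp: wp_term_def power2_eq_square algebra_simps\<close>)

text \<open>Shifting z and w by p changes the function by a constant D, and the reflection of w at - p/2 turns
D into - D.\<close>
lemma lattice_wp_periodic:
  assumes L: "is_lattice L" and p: "p \<in> L"
  shows "lattice_wp L (z + p) = lattice_wp L z"
proof -
  define D where "D = (\<Sum>\<^sub>\<infinity>w\<in>L. 1 / (w + p)\<^sup>2 - 1 / w\<^sup>2)"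
  note cl = lattice_closed[OF L]
  have "lattice_wp L (z + p) = (\<Sum>\<^sub>\<infinity>w\<in>L. wp_term (w + p) (z + p))"
    unfolding lattice_wp_eq_infsum[OF L]
    by (rule infsum_reindex_bij_witness[where i="\<lambda>w. w + p" and j="\<lambda>w. w - p"]) (use cl p in auto)
  moreover have sh: "(\<lambda>w. wp_term (w + p) (z + p)) summable_on L"
  proof -
    have "(\<lambda>w. wp_term w (z + p)) summable_on L" by (rule wp_term_summable[OF L])
    also have "?this \<longleftrightarrow> ?thesis"
      by (rule summable_on_reindex_bij_witness[where i="\<lambda>w. w + p" and j="\<lambda>w. w - p"]) (use cl p in auto)
    finally show ?thesis .
  qed
  ultimately have hs: "((\<lambda>w. wp_term (w + p) (z + p)) has_sum lattice_wp L (z + p)) L" by simp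
  have "((\<lambda>w. wp_term w z) has_sum lattice_wp L z) L"
    unfolding lattice_wp_eq_infsum[OF L] by (rule has_sum_infsum[OF wp_term_summable[OF L]])
  moreover have "((\<lambda>w. - wp_term (w + p) (z + p)) has_sum - lattice_wp L (z + p)) L"
    using hs by (simp add: has_sum_uminus)
  ultimately have "((\<lambda>w. wp_term w z + - wp_term (w + p) (z + p)) has_sum lattice_wp L z + - lattice_wp L (z + p)) L"
    by (rule has_sum_add)
  from infsumI[OF this] have "lattice_wp L z - lattice_wp L (z + p) = (\<Sum>\<^sub>\<infinity>w\<in>L. wp_term w z - wp_term (w + p) (z + p))"
    by simp
  also have "\<dots> = D" unfolding D_def by (rule infsum_cong) (simp add: wp_term_def)
  finally have eq: "lattice_wp L z - lattice_wp L (z + p) = D" .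
  have "D = (\<Sum>\<^sub>\<infinity>w\<in>L. - (1 / (w + p)\<^sup>2 - 1 / w\<^sup>2))"
    unfolding D_def
    by (rule infsum_reindex_bij_witness[where i="\<lambda>w. - p - w" and j="\<lambda>w. - p - w"])
       (use cl p in \<open>auto simp: power2_eq_square algebra_simps\<close>)
  also have "\<dots> = - D" unfolding D_def by (rule infsum_uminus)
  finally have "D = 0" by simp
  then show ?thesis using eq by simp
qed

lemma higher_deriv_inverse_square:
  fixes w z :: complex
  assumes "z \<noteq> w"
  shows "(deriv ^^ n) (\<lambda>z. 1 / (z - w)\<^sup>2) z = (-1)^n * fact (n + 1) / (z - w)^(n + 2)"
  using assms
proof (induction n arbitrary: z)
  case 0
  then show ?case by (simp add: power2_eq_square)
next
  case (Suc n)
  have "\<forall>\<^sub>F x in nhds z. x \<in> - {w}" using Suc.prems by (intro eventually_nhds_in_open) auto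
  then have ev: "\<forall>\<^sub>F x in nhds z. (deriv ^^ n) (\<lambda>z. 1 / (z - w)\<^sup>2) x = (-1)^n * fact (n + 1) / (x - w)^(n + 2)"
    by eventually_elim (use Suc.IH in auto)
  have "(deriv ^^ Suc n) (\<lambda>z. 1 / (z - w)\<^sup>2) z = deriv (\<lambda>x. (-1)^n * fact (n + 1) / (x - w)^(n + 2)) z"
    using deriv_cong_ev[OF ev refl] by simp
  also have "\<dots> = (-1)^Suc n * fact (Suc n + 1) / (z - w)^(Suc n + 2)"
  proof (rule DERIV_imp_deriv)
    have nz: "z - w \<noteq> 0" using Suc.prems by simp
    have d: "((\<lambda>x. (x - w)^(n+2)) has_field_derivative of_nat (n+2) * (z - w)^(n+1)) (at z)"
      by (rule derivative_eq_intros refl | simp)+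
    have "((\<lambda>x. (-1)^n * fact (n + 1) / (x - w)^(n + 2)) has_field_derivative
       (0 * (z - w)^(n+2) - (-1)^n * fact (n + 1) * (of_nat (n+2) * (z - w)^(n+1))) / ((z - w)^(n+2) * (z - w)^(n+2))) (at z)"
      by (rule DERIV_divide[OF DERIV_const d]) (use nz in simp)
    moreover have "(0 * (z - w)^(n+2) - (-1)^n * fact (n + 1) * (of_nat (n+2) * (z - w)^(n+1))) / ((z - w)^(n+2) * (z - w)^(n+2))
       = (-1)^Suc n * fact (Suc n + 1) / (z - w)^(Suc n + 2)"
    proof -
      have f: "fact (Suc n + 1) = (of_nat (n+2) * fact (n+1) :: complex)" by (simp add: algebra_simps)
      have p: "(z - w)^(n+2) * (z - w)^(n+2) = (z - w)^(n+1) * (z - w)^(Suc n + 2)" by (simp flip: power_add)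
      have g: "(0 * u - s * f * (k * t)) / (t * v) = (- 1 * s) * (k * f) / v" if "t \<noteq> 0" for u s f k t v :: complex
        using that by (simp add: field_simps)
      show ?thesis unfolding f p using g[of "(z - w)^(n+1)"] nz by (simp only: power_Suc power_not_zero not_False_eq_True)
    qed
    ultimately show "((\<lambda>x. (-1)^n * fact (n + 1) / (x - w)^(n + 2)) has_field_derivative
       (-1)^Suc n * fact (Suc n + 1) / (z - w)^(Suc n + 2)) (at z)" by simp
  qed
  finally show ?case .
qed

lemma higher_deriv_wp_term:
  assumes "w \<noteq> 0" "n > 0"
  shows "(deriv ^^ n) (wp_term w) 0 = fact (n + 1) / w^(n + 2)"
proof -
  have h: "(\<lambda>z. 1 / (z - w)\<^sup>2) holomorphic_on - {w}" by (intro holomorphic_intros) auto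
  have "(deriv ^^ n) (wp_term w) 0 = (deriv ^^ n) (\<lambda>z. 1 / (z - w)\<^sup>2) 0 - (deriv ^^ n) (\<lambda>z. 1 / w\<^sup>2) 0"
    unfolding wp_term_def using assms by (intro higher_deriv_diff[OF h]) auto
  also have "(deriv ^^ n) (\<lambda>z. 1 / w\<^sup>2) (0::complex) = 0" using assms by (simp add: higher_deriv_const)
  also have "(deriv ^^ n) (\<lambda>z. 1 / (z - w)\<^sup>2) 0 = (-1)^n * fact (n + 1) / (- w)^(n + 2)"
    using higher_deriv_inverse_square[of 0 w n] assms by simp
  also have "\<dots> = fact (n + 1) / w^(n + 2)"
    by (cases "even n") auto
  finally show ?thesis by simp
qed

text \<open>In contrast to a factorization by the exact order of the zero, this includes f = 0.\<close>
lemma analytic_factor_power: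
  fixes f :: "complex \<Rightarrow> complex"
  assumes f: "f analytic_on {0}" and z: "\<And>i. i < n \<Longrightarrow> (deriv ^^ i) f 0 = 0"
  obtains g where "g analytic_on {0}" "\<forall>\<^sub>F z in nhds 0. f z = z ^ n * g z"
proof -
  define F where "F = fps_expansion f 0"
  have F: "f has_fps_expansion F" unfolding F_def by (rule analytic_at_imp_has_fps_expansion_0[OF f])
  define G where "G = fps_shift n F"
  have FG: "F = fps_X ^ n * G"
    by (rule fps_ext) (auto simp: G_def fps_X_power_mult_nth F_def fps_expansion_def z)
  have pos: "fps_conv_radius F > 0" using F by (simp add: has_fps_expansion_def)
  then have G: "eval_fps G has_fps_expansion G" by (auto simp: G_def has_fps_expansion_def)
  have "(\<lambda>z. z ^ n * eval_fps G z) has_fps_expansion F"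
    unfolding FG by (intro fps_expansion_intros G)
  then have "\<forall>\<^sub>F z in nhds 0. eval_fps F z = z ^ n * eval_fps G z" by (simp add: has_fps_expansion_def)
  moreover have "\<forall>\<^sub>F z in nhds 0. eval_fps F z = f z" using F by (simp add: has_fps_expansion_def)
  ultimately have "\<forall>\<^sub>F z in nhds 0. f z = z ^ n * eval_fps G z" by eventually_elim simp
  then show ?thesis using that[of "eval_fps G"] has_fps_expansion_imp_analytic_0[OF G] by blast
qed

lemma lattice_odd_sum_zero:
  assumes L: "is_lattice L" and "odd n"
  shows "(\<Sum>\<^sub>\<infinity>w\<in>L-{0}. c / w ^ n) = (0::complex)"
proof -
  have "(\<Sum>\<^sub>\<infinity>w\<in>L-{0}. c / w ^ n) = (\<Sum>\<^sub>\<infinity>w\<in>L-{0}. - (c / w ^ n))"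
    by (rule infsum_reindex_bij_witness[where i=uminus and j=uminus])
       (use lattice_closed[OF L] \<open>odd n\<close> in auto)
  also have "\<dots> = - (\<Sum>\<^sub>\<infinity>w\<in>L-{0}. c / w ^ n)" by (rule infsum_uminus)
  finally show ?thesis by simp
qed

text \<open>The even Taylor coefficients are the lattice sums that define g2 and g3, up to the factors
1/20 and 1/28; the odd ones vanish by symmetry.\<close>
lemma lattice_wp_taylor:
  assumes L: "is_lattice L"
  obtains B where "B analytic_on {0}"
    "\<forall>\<^sub>F z in at 0. lattice_wp L z = 1/z\<^sup>2 + (lattice_g2 L / 20 * z^2 + lattice_g3 L / 28 * z^4 + z^5 * B z)"
proof -
  have finL: "finite {w\<in>L - {0}. norm w \<le> 1}" by (rule finite_subset[OF _ lattice_finite[OF L, of 1]]) auto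
  obtain \<rho> where \<rho>: "\<rho> > 0" "{w\<in>L. norm w \<le> 2 * \<rho>} = {0}"
  proof -
    obtain d where d: "d > 0" "\<forall>w\<in>{w\<in>L - {0}. norm w \<le> 1}. d \<le> dist 0 w"
      using finite_set_avoid[OF finL, of 0] by auto
    define \<rho> where "\<rho> = min d 1 / 4"
    have "{w\<in>L. norm w \<le> 2 * \<rho>} = {0}"
    proof safe
      fix w assume w: "w \<in> L" "norm w \<le> 2 * \<rho>"
      show "w = 0"
      proof (rule ccontr)
        assume "w \<noteq> 0"
        moreover have "norm w \<le> 1" using w d(1) by (simp add: \<rho>_def min_def split: if_splits)
        ultimately have "d \<le> norm w" using d(2) w by auto
        then show False using w d(1) by (simp add: \<rho>_def min_def split: if_splits)
      qed
    next
      show "0 \<in> L" by (rule lattice_closed(1)[OF L])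
      show "norm (0::complex) \<le> 2 * \<rho>" using d(1) by (simp add: \<rho>_def)
    qed
    then show ?thesis using that[of \<rho>] d(1) by (simp add: \<rho>_def)
  qed
  define A where "A = (\<lambda>z. \<Sum>\<^sub>\<infinity>w\<in>L - {0}. wp_term w z)"
  note loc = lattice_wp_local[OF L \<rho>(1), unfolded \<rho>(2), folded A_def]
  have wpA: "lattice_wp L z = 1/z\<^sup>2 + A z" for z using loc(3)[of z] by (simp add: A_def wp_term_def)
  have Aa: "A analytic_on {0}" using loc(2) \<rho>(1) analytic_at by (metis centre_in_ball open_ball)
  have A0: "A 0 = 0" by (simp add: A_def wp_term_def)
  have sumn: "((\<lambda>w. fact (n + 1) / w^(n + 2)) has_sum (deriv ^^ n) A 0) (L - {0})" if n: "n > 0" for n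
  proof -
    have "((\<lambda>X. (deriv ^^ n) (\<lambda>z. \<Sum>w\<in>X. wp_term w z) 0) \<longlongrightarrow> (deriv ^^ n) A 0) (finite_subsets_at_top (L - {0}))"
      by (rule higher_deriv_complex_uniform_limit[OF loc(4)])
         (use \<rho> loc(5) in \<open>auto intro!: eventually_finite_subsets_at_top_weakI\<close>)
    moreover have "\<forall>\<^sub>F X in finite_subsets_at_top (L - {0}).
        (deriv ^^ n) (\<lambda>z. \<Sum>w\<in>X. wp_term w z) 0 = (\<Sum>w\<in>X. fact (n + 1) / w^(n + 2))"
    proof (rule eventually_finite_subsets_at_top_weakI)
      fix X assume X: "finite X" "X \<subseteq> L - {0}"
      have "(deriv ^^ n) (\<lambda>z. \<Sum>w\<in>X. wp_term w z) 0 = (\<Sum>w\<in>X. (deriv ^^ n) (wp_term w) 0)"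
        using X
      proof (induction X rule: finite_induct)
        case empty
        then show ?case using n by (simp add: higher_deriv_const)
      next
        case (insert x X)
        have h1: "wp_term x holomorphic_on ball 0 \<rho>" using loc(5)[of "{x}"] insert by simp
        have h2: "(\<lambda>z. \<Sum>w\<in>X. wp_term w z) holomorphic_on ball 0 \<rho>" using loc(5)[of X] insert by simp
        show ?case using insert higher_deriv_add[OF h1 h2 open_ball, of 0 n] \<rho> by simp
      qed
      also have "\<dots> = (\<Sum>w\<in>X. fact (n + 1) / w^(n + 2))"
        using X n by (intro sum.cong refl higher_deriv_wp_term) auto
      finally show "(deriv ^^ n) (\<lambda>z. \<Sum>w\<in>X. wp_term w z) 0 = (\<Sum>w\<in>X. fact (n + 1) / w^(n + 2))" .
    qed
    ultimately have "((\<lambda>X. \<Sum>w\<in>X. fact (n + 1) / w^(n + 2)) \<longlongrightarrow> (deriv ^^ n) A 0) (finite_subsets_at_top (L - {0}))"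
      by (rule Lim_transform_eventually)
    then show ?thesis by (simp add: has_sum_def)
  qed
  have dA: "(deriv ^^ n) A 0 = (\<Sum>\<^sub>\<infinity>w\<in>L-{0}. fact (n + 1) / w^(n + 2))" if "n > 0" for n
    using infsumI[OF sumn[OF that]] by simp
  have cm: "(\<Sum>\<^sub>\<infinity>w\<in>L-{0}. fact (n + 1) / w^(n + 2)) = fact (n+1) * (\<Sum>\<^sub>\<infinity>w\<in>L-{0}. 1 / w^(n + 2))" for n
    using infsum_cmult_right'[of "fact (n+1) :: complex" "\<lambda>w. 1 / w^(n+2)" "L - {0}"] by simp
  have o1: "odd (1 + 2 :: nat)" and o3: "odd (3 + 2 :: nat)" and p3: "(3::nat) > 0" by simp_all
  have D1: "(deriv ^^ 1) A 0 = 0" by (rule trans[OF dA[OF zero_less_one] lattice_odd_sum_zero[OF L o1]])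
  have D3: "(deriv ^^ 3) A 0 = 0" by (rule trans[OF dA[OF p3] lattice_odd_sum_zero[OF L o3]])
  have D2: "(deriv ^^ 2) A 0 = lattice_g2 L / 10" using dA[of 2] cm[of 2] by (simp add: lattice_g2_def fact_numeral)
  have D4: "(deriv ^^ 4) A 0 = 6 * lattice_g3 L / 7" using dA[of 4] cm[of 4] by (simp add: lattice_g3_def fact_numeral)
  define a b where "a = lattice_g2 L / 20" and "b = lattice_g3 L / 28"
  define P where "P = (\<lambda>z::complex. a * z^2 + b * z^4)"
  have P1: "deriv P = (\<lambda>z. 2 * a * z + 4 * b * z^3)"
    by (rule ext, rule DERIV_imp_deriv, unfold P_def) (auto intro!: derivative_eq_intros simp: algebra_simps)
  have P2: "deriv (\<lambda>z::complex. 2 * a * z + 4 * b * z^3) = (\<lambda>z. 2 * a + 12 * b * z^2)"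
    by (rule ext, rule DERIV_imp_deriv) (auto intro!: derivative_eq_intros simp: algebra_simps)
  have P3: "deriv (\<lambda>z::complex. 2 * a + 12 * b * z^2) = (\<lambda>z. 24 * b * z)"
    by (rule ext, rule DERIV_imp_deriv) (auto intro!: derivative_eq_intros simp: algebra_simps)
  have P4: "deriv (\<lambda>z::complex. 24 * b * z) = (\<lambda>z. 24 * b)"
    by (rule ext, rule DERIV_imp_deriv) (auto intro!: derivative_eq_intros simp: algebra_simps)
  have Ph: "P holomorphic_on ball 0 \<rho>" unfolding P_def by (intro holomorphic_intros)
  have diff: "(deriv ^^ i) (\<lambda>z. A z - P z) 0 = (deriv ^^ i) A 0 - (deriv ^^ i) P 0" for i
    by (rule higher_deriv_diff[OF loc(2) Ph open_ball]) (use \<rho> in simp)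
  have zero: "(deriv ^^ i) (\<lambda>z. A z - P z) 0 = 0" if i5: "i < 5" for i
  proof -
    consider "i = 0" | "i = 1" | "i = 2" | "i = 3" | "i = 4" using i5 by linarith
    then show ?thesis
    proof cases
      case 1
      then show ?thesis using A0 by (simp add: P_def)
    next
      case 2
      then show ?thesis using D1 diff[of 1] P1 by simp
    next
      case 3
      have "(deriv ^^ 2) P 0 = 2 * a" by (simp add: numeral_2_eq_2 P1 P2)
      then have P20: "(deriv ^^ 2) P 0 = lattice_g2 L / 10" by (simp add: a_def)
      show ?thesis unfolding 3 diff D2 P20 by simp
    next
      case 4
      have "(deriv ^^ 3) P 0 = deriv (deriv (deriv P)) 0" by (simp add: numeral_3_eq_3)
      then have "(deriv ^^ 3) P 0 = 0" by (simp add: P1 P2 P3)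
      then show ?thesis unfolding 4 diff D3 by simp
    next
      case 5
      have "(deriv ^^ 4) P 0 = deriv (deriv (deriv (deriv P))) 0" by (simp add: eval_nat_numeral)
      then have "(deriv ^^ 4) P 0 = 24 * b" by (simp add: P1 P2 P3 P4)
      then have P40: "(deriv ^^ 4) P 0 = 6 * lattice_g3 L / 7" by (simp add: b_def)
      show ?thesis unfolding 5 diff D4 P40 by simp
    qed
  qed
  have Pa: "P analytic_on {0}" unfolding P_def by (intro analytic_intros)
  have "(\<lambda>z. A z - P z) analytic_on {0}" using Aa Pa by (intro analytic_intros)
  from analytic_factor_power[OF this zero]
  obtain B where B: "B analytic_on {0}" "\<forall>\<^sub>F z in nhds 0. A z - P z = z ^ 5 * B z" by blast
  from B(2) have "\<forall>\<^sub>F z in at 0. A z - P z = z ^ 5 * B z" by (simp add: eventually_nhds_conv_at)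
  then have "\<forall>\<^sub>F z in at 0. lattice_wp L z = 1/z\<^sup>2 + (lattice_g2 L / 20 * z^2 + lattice_g3 L / 28 * z^4 + z^5 * B z)"
    by eventually_elim (simp add: wpA P_def a_def b_def algebra_simps)
  then show ?thesis using that[OF B(1)] by blast
qed

lemma periodic_entire_constant:
  assumes L: "is_lattice L" and H: "H holomorphic_on UNIV" and per: "\<And>w z. w \<in> L \<Longrightarrow> H (z + w) = H z"
  obtains c where "\<And>z. H z = (c::complex)"
proof -
  obtain R where R: "R > 0" "\<And>z. \<exists>p\<in>L. dist z p < R" using lattice_dense[OF L] by blast
  have "compact (H ` cball 0 R)"
    by (intro compact_continuous_image holomorphic_on_imp_continuous_on holomorphic_on_subset[OF H]) auto
  then have bd: "bounded (H ` cball 0 R)" by (rule compact_imp_bounded)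
  have "range H \<subseteq> H ` cball 0 R"
  proof safe
    fix z
    obtain p where p: "p \<in> L" "dist z p < R" using R by blast
    have "H z = H ((z - p) + p)" by simp
    also have "\<dots> = H (z - p)" by (rule per[OF p(1)])
    finally show "H z \<in> H ` cball 0 R" using p(2) by (intro image_eqI[of _ _ "z - p"]) (auto simp: dist_norm norm_minus_commute)
  qed
  then have "bounded (range H)" using bd bounded_subset by blast
  then have "H constant_on UNIV" using Liouville_theorem[OF H] by (auto simp: constant_on_def)
  then show ?thesis using that by (auto simp: constant_on_def)
qed

text \<open>A lattice-periodic function whose only possible singularities are lattice points, with a finite
limit there, is entire and bounded.\<close>
lemma lattice_periodic_Liouville:
  assumes L: "is_lattice L" and Fm: "F meromorphic_on UNIV" and Fa: "\<And>z. z \<notin> L \<Longrightarrow> F analytic_on {z}"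
    and Fper: "\<And>w z. w \<in> L \<Longrightarrow> F (z + w) = F z" and lim0: "F \<midarrow>0\<rightarrow> l" and z: "z \<notin> L"
  shows "F z = l"
proof -
  have limw: "F \<midarrow>w\<rightarrow> l" if w: "w \<in> L" for w
  proof -
    have "filterlim (\<lambda>z. 1 * z + (- w)) (at (1 * w + (- w))) (at w)" by (rule filterlim_affine_at) simp
    then have "filterlim (\<lambda>z. z - w) (at 0) (at w)" by simp
    then have "((\<lambda>z. F (z - w)) \<longlongrightarrow> l) (at w)" using filterlim_compose[OF lim0] by blast
    moreover have "F (z - w) = F z" for z using Fper[OF w, of "z - w"] by simp
    ultimately show ?thesis by simp
  qed
  define H where "H = remove_sings F"
  have "H analytic_on {z}" for z
  proof (cases "z \<in> L")
    case True
    have "isolated_singularity_at F z" by (rule meromorphic_on_isolated_singularity, rule meromorphic_on_subset[OF Fm]) simp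
    then show ?thesis unfolding H_def using limw[OF True] by (rule remove_sings_analytic_at)
  next
    case False
    then show ?thesis unfolding H_def using Fa remove_sings_analytic_on by blast
  qed
  then have "H analytic_on UNIV" using analytic_on_analytic_at by blast
  then have Hh: "H holomorphic_on UNIV" by (rule analytic_imp_holomorphic)
  have HF: "H z = F z" if "z \<notin> L" for z unfolding H_def using Fa[OF that] by simp
  have HL: "H z = l" if "z \<in> L" for z unfolding H_def using limw[OF that] by (rule remove_sings_eqI)
  have Hper: "H (z + w) = H z" if w: "w \<in> L" for z w
  proof (cases "z \<in> L")
    case True
    then show ?thesis using HL lattice_closed(2)[OF L _ w] by simp
  next
    case False
    then have "z + w \<notin> L" using lattice_closed(4)[OF L _ w, of "z + w"] by auto
    then show ?thesis using HF False Fper[OF w] by simp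
  qed
  obtain c where c: "\<And>z. H z = c" using periodic_entire_constant[OF L Hh Hper] by blast
  have "c = l" using c[of 0] HL[OF lattice_closed(1)[OF L]] by simp
  then show "F z = l" using HF[OF z] c by simp
qed

lemma lattice_wp_pole: "is_lattice L \<Longrightarrow> is_pole (lattice_wp L) 0"
proof -
  assume L: "is_lattice L"
  obtain B where B: "B analytic_on {0}"
    "\<forall>\<^sub>F z in at 0. lattice_wp L z = 1/z\<^sup>2 + (lattice_g2 L / 20 * z^2 + lattice_g3 L / 28 * z^4 + z^5 * B z)"
    using lattice_wp_taylor[OF L] by blast
  have "(B \<longlongrightarrow> B 0) (at 0)" using analytic_at_imp_isCont[OF B(1)] by (simp add: isCont_def)
  then have l: "((\<lambda>z. lattice_g2 L / 20 * z^2 + lattice_g3 L / 28 * z^4 + z^5 * B z) \<longlongrightarrow> 0) (at 0)"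
    by (auto intro!: tendsto_eq_intros)
  have "filterlim (\<lambda>z::complex. 1 / z^2) at_infinity (at 0)"
    by (rule filterlim_divide_at_infinity[where c=1])
       (auto simp: filterlim_at eventually_at_filter intro!: tendsto_eq_intros)
  then have "filterlim (\<lambda>z. 1/z\<^sup>2 + (lattice_g2 L / 20 * z^2 + lattice_g3 L / 28 * z^4 + z^5 * B z)) at_infinity (at 0)"
    using l by (intro tendsto_add_filterlim_at_infinity')
  then show ?thesis unfolding is_pole_def using filterlim_cong[OF refl refl B(2)] by simp
qed

text \<open>The difference of the two sides is periodic, and by the Taylor expansion it tends to 0 at the
lattice points.\<close>
lemma lattice_wp_ode:
  assumes L: "is_lattice L" and z: "z \<notin> L"
  shows "(deriv (lattice_wp L) z)^2 = 4 * lattice_wp L z ^ 3 - lattice_g2 L * lattice_wp L z - lattice_g3 L"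
proof -
  let ?p = "lattice_wp L"
  define g2 g3 where "g2 = lattice_g2 L" and "g3 = lattice_g3 L"
  define F where "F = (\<lambda>z. (deriv ?p z)^2 - 4 * ?p z ^ 3 + g2 * ?p z + g3)"
  note pm = lattice_wp_meromorphic[OF L] and pa = lattice_wp_analytic[OF L]
  have Fm: "F meromorphic_on UNIV" unfolding F_def using pm by (intro meromorphic_intros)
  have Fa: "F analytic_on {z}" if "z \<notin> L" for z
    unfolding F_def using pa[OF that] by (intro analytic_intros)
  have dper: "deriv ?p (z + w) = deriv ?p z" if w: "w \<in> L" for z w
  proof -
    have "deriv (\<lambda>z. ?p (z + w)) z = deriv ?p (z + w)"
      by (simp add: deriv_def DERIV_shift)
    then show ?thesis using lattice_wp_periodic[OF L w] by simp
  qed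
  have Fper: "F (z + w) = F z" if "w \<in> L" for z w
    using dper[OF that] lattice_wp_periodic[OF L that] by (simp add: F_def)
  obtain B where B: "B analytic_on {0}"
    "\<forall>\<^sub>F z in at 0. ?p z = 1/z\<^sup>2 + (g2 / 20 * z^2 + g3 / 28 * z^4 + z^5 * B z)"
    using lattice_wp_taylor[OF L] unfolding g2_def g3_def by blast
  obtain S where S: "open S" "0 \<in> S" "B holomorphic_on S" using B(1) analytic_at by blast
  have nS: "\<forall>\<^sub>F z in at 0. z \<in> S - {0}" using S by (intro eventually_at_in_open) auto
  define a b where "a = g2 / 20" and "b = g3 / 28"
  \<comment> \<open>wp = 1/z^2 + z^2 U; the singular terms of the difference F cancel by the choice of a and b.\<close>
  define U where "U = (\<lambda>z. a + b * z^2 + z^3 * B z)"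
  have F0: "\<forall>\<^sub>F z in at 0. F z = (- 4 * z * (5 * B z + z * deriv B z) - 12 * z * B z
      + (2*a*z + 4*b*z^3 + z^4 * (5 * B z + z * deriv B z))^2 - 12 * z^2 * U z^2 - 4 * z^6 * U z^3 + 20 * a * z^2 * U z)"
    using B(2) deriv_eq_at[OF B(2)] nS
  proof eventually_elim
    case (elim z)
    have Bd: "(B has_field_derivative deriv B z) (at z)" using elim S holomorphic_derivI by blast
    have z0: "z \<noteq> 0" using elim by simp
    have "((\<lambda>z. 1/z\<^sup>2 + (g2 / 20 * z^2 + g3 / 28 * z^4 + z^5 * B z)) has_field_derivative
      (- 2 / z^3 + (2*a*z + 4*b*z^3 + z^4 * (5 * B z + z * deriv B z)))) (at z)"
      unfolding a_def b_def
      by (auto intro!: derivative_eq_intros Bd simp: z0 field_simps power_numeral_reduce)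
    then have d: "deriv ?p z = - 2 / z^3 + (2*a*z + 4*b*z^3 + z^4 * (5 * B z + z * deriv B z))"
      using elim(2) by (simp only: DERIV_imp_deriv)
    have p: "?p z = 1/z\<^sup>2 + z^2 * U z" unfolding elim(1) U_def a_def b_def by (simp add: algebra_simps power_numeral_reduce)
    have g: "g2 = 20 * a" "g3 = 28 * b" by (simp_all add: a_def b_def)
    define V where "V = 2*a*z + 4*b*z^3 + z^4 * (5 * B z + z * deriv B z)"
    have "F z = (- 2 / z^3 + V)^2 - 4 * (1/z\<^sup>2 + z^2 * U z)^3 + 20 * a * (1/z\<^sup>2 + z^2 * U z) + 28 * b"
      unfolding F_def d p g V_def ..
    also have "\<dots> = (- 4 * V / z^3 - 12 * U z / z^2 + 20 * a / z^2 + 28 * b) + V^2 - 12 * z^2 * U z^2 - 4 * z^6 * U z^3 + 20 * a * z^2 * U z"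
      using z0 by (simp add: field_simps power_numeral_reduce)
    also have "- 4 * V / z^3 - 12 * U z / z^2 + 20 * a / z^2 + 28 * b = - 4 * z * (5 * B z + z * deriv B z) - 12 * z * B z"
      unfolding V_def U_def using z0 by (simp add: field_simps power_numeral_reduce)
    finally show ?case by (simp only: V_def)
  qed
  have lB: "(B \<longlongrightarrow> B 0) (at 0)" "(deriv B \<longlongrightarrow> deriv B 0) (at 0)"
    using analytic_at_imp_isCont[OF B(1)] analytic_at_imp_isCont[OF analytic_deriv[OF B(1)]] by (simp_all add: isCont_def)
  have lU: "(U \<longlongrightarrow> a) (at 0)" unfolding U_def by (auto intro!: tendsto_eq_intros lB)
  have "((\<lambda>z. - 4 * z * (5 * B z + z * deriv B z) - 12 * z * B z
      + (2*a*z + 4*b*z^3 + z^4 * (5 * B z + z * deriv B z))^2 - 12 * z^2 * U z^2 - 4 * z^6 * U z^3 + 20 * a * z^2 * U z) \<longlongrightarrow> 0) (at 0)"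
    by (auto intro!: tendsto_eq_intros lB lU)
  then have lim0: "F \<midarrow>0\<rightarrow> 0" by (rule tendsto_cong[THEN iffD2, OF F0])
  have "F z = 0" by (rule lattice_periodic_Liouville[OF L Fm Fa Fper lim0 z])
  then show ?thesis by (simp add: F_def g2_def g3_def algebra_simps)
qed

lemma lattice_wp_pole_solution:
  assumes L: "is_lattice L"
  shows "pole_solution (lattice_g2 L) (lattice_g3 L) (lattice_wp L)"
  unfolding pole_solution_def
proof (intro conjI)
  show "lattice_wp L meromorphic_on UNIV" by (rule lattice_wp_meromorphic[OF L])
  show "is_pole (lattice_wp L) 0" by (rule lattice_wp_pole[OF L])
  have "L sparse_in UNIV"
    unfolding sparse_in_def
  proof safe
    fix x
    have "\<not> y islimpt L" for y
    proof
      assume "y islimpt L"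
      then have "infinite (L \<inter> ball y 1)" by (simp add: islimpt_eq_infinite_ball)
      moreover have "L \<inter> ball y 1 \<subseteq> {w\<in>L. norm w \<le> norm y + 1}"
      proof safe
        fix w assume "w \<in> ball y 1"
        then show "norm w \<le> norm y + 1" using norm_triangle_ineq2[of w y] by (simp add: dist_norm norm_minus_commute)
      qed
      ultimately show False using lattice_finite[OF L] finite_subset by blast
    qed
    then show "\<exists>B. x \<in> B \<and> open B \<and> (\<forall>y\<in>B. \<not> y islimpt L)" by blast
  qed
  then have "\<forall>\<^sub>\<approx>z. z \<notin> L" by (rule eventually_not_in_cosparse)
  then show "\<forall>\<^sub>\<approx>z. (deriv (lattice_wp L) z)\<^sup>2 = 4 * lattice_wp L z ^ 3 - lattice_g2 L * lattice_wp L z - lattice_g3 L"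
    by eventually_elim (rule lattice_wp_ode[OF L])
qed

section \<open>Uniformization and lifting\<close>
lemma lattice_wp_is_pole_iff:
  assumes L: "is_lattice L"
  shows "is_pole (lattice_wp L) z \<longleftrightarrow> z \<in> L"
proof
  assume "is_pole (lattice_wp L) z"
  then show "z \<in> L" using lattice_wp_analytic[OF L, of z] analytic_at_imp_no_pole by blast
next
  assume z: "z \<in> L"
  have "is_pole (\<lambda>w. lattice_wp L (1 * w + (- z))) z"
    by (rule is_pole_affine) (use lattice_wp_pole[OF L] in simp_all)
  moreover have "lattice_wp L (w - z) = lattice_wp L w" for w
    using lattice_wp_periodic[OF L z, of "w - z"] by simp
  ultimately show "is_pole (lattice_wp L) z" by simp
qed

lemma cosparse_ex:
  assumes "\<forall>\<^sub>\<approx>z::complex. P z"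
  obtains z where "P z"
proof -
  have "\<forall>\<^sub>F z in at (0::complex). P z" by (rule eventually_cosparse_imp_eventually_at[OF assms UNIV_I])
  then show ?thesis using eventually_happens'[OF trivial_limit_at] that by blast
qed

text \<open>Serves to compare the coefficients of polynomials in a function with a pole.\<close>
lemma quadratic_zero_at_infinity:
  fixes y :: "'a \<Rightarrow> complex"
  assumes y: "filterlim y at_infinity F" and F: "F \<noteq> bot"
    and ev: "\<forall>\<^sub>F z in F. \<alpha> * y z ^ 2 + \<beta> * y z + \<gamma> = 0"
  shows "\<alpha> = 0" "\<beta> = 0" "\<gamma> = 0"
proof -
  define t where "t = (\<lambda>w. inverse (y w))"
  have t: "(t \<longlongrightarrow> 0) F" unfolding t_def using y tendsto_inverse_0 filterlim_compose by blast
  have nz: "\<forall>\<^sub>F z in F. y z \<noteq> 0" by (rule filterlim_at_infinity_imp_eventually_ne[OF y])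
  have "\<forall>\<^sub>F z in F. \<alpha> + \<beta> * t z + \<gamma> * t z ^ 2 = 0"
    using ev nz
  proof eventually_elim
    case (elim z)
    have "(\<alpha> + \<beta> * t z + \<gamma> * t z ^ 2) = (\<alpha> * y z ^ 2 + \<beta> * y z + \<gamma>) / y z ^ 2"
      using elim(2) by (simp add: t_def field_simps power2_eq_square)
    then show ?case using elim(1) by simp
  qed
  then have "((\<lambda>z. \<alpha> + \<beta> * t z + \<gamma> * t z ^ 2) \<longlongrightarrow> 0) F" by (rule tendsto_eventually)
  moreover have "((\<lambda>z. \<alpha> + \<beta> * t z + \<gamma> * t z ^ 2) \<longlongrightarrow> \<alpha>) F" by (auto intro!: tendsto_eq_intros t)
  ultimately show a: "\<alpha> = 0" using tendsto_unique[OF F] by blast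
  have "\<forall>\<^sub>F z in F. \<beta> + \<gamma> * t z = 0"
    using ev nz
  proof eventually_elim
    case (elim z)
    have "\<beta> + \<gamma> * t z = (\<alpha> * y z ^ 2 + \<beta> * y z + \<gamma>) / y z"
      using elim(2) a by (simp add: t_def field_simps)
    then show ?case using elim(1) by simp
  qed
  then have "((\<lambda>z. \<beta> + \<gamma> * t z) \<longlongrightarrow> 0) F" by (rule tendsto_eventually)
  moreover have "((\<lambda>z. \<beta> + \<gamma> * t z) \<longlongrightarrow> \<beta>) F" by (auto intro!: tendsto_eq_intros t)
  ultimately show b: "\<beta> = 0" using tendsto_unique[OF F] by blast
  have "\<forall>\<^sub>F z in F. \<gamma> = 0" using ev by eventually_elim (simp add: a b)
  then show "\<gamma> = 0" using F by simp
qed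

text \<open>With y = 1/s^2, differentiation of the equation for s at 0 gives s'' = 0. So s - z vanishes to
third order and 1/s^2 - 1/z^2 has a limit.\<close>
lemma pole_solution_principal_part:
  assumes y: "pole_solution g2 g3 y"
  obtains c where "((\<lambda>z. y z - 1 / z\<^sup>2) \<longlongrightarrow> c) (at 0)"
proof -
  obtain s where s: "s analytic_on {0}" "s 0 = 0" "deriv s 0 = 1" "\<forall>\<^sub>F w in at 0. y w = 1 / (s w)^2"
    "\<forall>\<^sub>F w in at 0. (deriv s w)^2 = 1 - g2/4 * s w ^ 4 - g3/4 * s w ^ 6"
    by (rule pole_square_root[OF pole_solutionD(1,2,4)[OF y]])
  have ev: "\<forall>\<^sub>F w in nhds 0. (deriv s w)^2 = 1 - g2/4 * s w ^ 4 - g3/4 * s w ^ 6"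
    using s by (simp add: eventually_nhds_conv_at)
  have d: "(s has_field_derivative deriv s 0) (at 0)" using s(1) analytic_derivI by blast
  have dd: "(deriv s has_field_derivative deriv (deriv s) 0) (at 0)" using analytic_deriv[OF s(1)] analytic_derivI by blast
  have "((\<lambda>w. (deriv s w)^2) has_field_derivative 2 * deriv s 0 * deriv (deriv s) 0) (at 0)"
    by (auto intro!: derivative_eq_intros dd)
  moreover have "((\<lambda>w. 1 - g2/4 * s w ^ 4 - g3/4 * s w ^ 6) has_field_derivative 0) (at 0)"
    by (auto intro!: derivative_eq_intros d simp: s(2))
  ultimately have "2 * deriv s 0 * deriv (deriv s) 0 = 0"
    using deriv_cong_ev[OF ev refl] by (simp only: DERIV_imp_deriv)
  then have s2: "deriv (deriv s) 0 = 0" using s(3) by simp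
  obtain S where S: "open S" "0 \<in> S" "s holomorphic_on S" using s(1) analytic_at by blast
  have idh: "(\<lambda>z::complex. z) holomorphic_on S" by (intro holomorphic_intros)
  have "(deriv ^^ i) (\<lambda>z. s z - z) 0 = 0" if i3: "i < 3" for i
  proof -
    have df: "(deriv ^^ i) (\<lambda>z. s z - z) 0 = (deriv ^^ i) s 0 - (deriv ^^ i) (\<lambda>z. z) 0"
      by (rule higher_deriv_diff[OF S(3) idh S(1,2)])
    have "i = 0 \<or> i = 1 \<or> i = 2" using i3 by linarith
    moreover have "(deriv ^^ 2) (\<lambda>z::complex. z) 0 = 0" by (simp add: numeral_2_eq_2)
    moreover have "(deriv ^^ 2) s 0 = 0" using s2 by (simp add: numeral_2_eq_2)
    ultimately show ?thesis unfolding df using s by auto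
  qed
  moreover have "(\<lambda>z. s z - z) analytic_on {0}" using s(1) by (intro analytic_intros)
  ultimately obtain g where g: "g analytic_on {0}" "\<forall>\<^sub>F z in nhds 0. s z - z = z ^ 3 * g z"
    using analytic_factor_power[of "\<lambda>z. s z - z" 3] by blast
  have lg: "(g \<longlongrightarrow> g 0) (at 0)" using analytic_at_imp_isCont[OF g(1)] by (simp add: isCont_def)
  have l1: "((\<lambda>z. 1 + z^2 * g z) \<longlongrightarrow> 1) (at 0)" by (auto intro!: tendsto_eq_intros lg)
  have ne: "\<forall>\<^sub>F z in at 0. 1 + z^2 * g z \<noteq> 0" by (rule tendsto_imp_eventually_ne[OF l1]) simp
  have g2: "\<forall>\<^sub>F z in at 0. s z - z = z ^ 3 * g z" using g(2) by (simp add: eventually_nhds_conv_at)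
  have z0: "\<forall>\<^sub>F z::complex in at 0. z \<noteq> 0" by (simp add: eventually_at_filter)
  have "\<forall>\<^sub>F z in at 0. y z - 1 / z\<^sup>2 = (- 2 * g z - z^2 * g z ^ 2) / (1 + z^2 * g z)^2"
    using s(4) g2 ne z0
  proof eventually_elim
    case (elim z)
    have sz: "s z = z * (1 + z^2 * g z)" using elim(2) by (simp add: algebra_simps power2_eq_square power3_eq_cube)
    define q where "q = 1 + z^2 * g z"
    have q0: "q \<noteq> 0" using elim(3) by (simp add: q_def)
    have "y z - 1 / z\<^sup>2 = (1 - q^2) / (z^2 * q^2)"
      unfolding elim(1) sz q_def[symmetric] using q0 elim(4) by (simp add: field_simps power2_eq_square)
    also have "1 - q^2 = z^2 * (- 2 * g z - z^2 * g z ^ 2)" by (simp add: q_def algebra_simps power2_eq_square)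
    finally show ?case using elim(4) by (simp add: q_def)
  qed
  moreover have "((\<lambda>z. (- 2 * g z - z^2 * g z ^ 2) / (1 + z^2 * g z)^2) \<longlongrightarrow> - 2 * g 0) (at 0)"
    by (auto intro!: tendsto_eq_intros lg)
  ultimately have "((\<lambda>z. y z - 1 / z\<^sup>2) \<longlongrightarrow> - 2 * g 0) (at 0)" by (rule tendsto_cong[THEN iffD2])
  then show ?thesis using that by blast
qed

text \<open>The solution and the function wp of its lattice of poles differ by a constant k. As both satisfy
a Weierstrass equation, comparing coefficients gives k = 0 and equal invariants.\<close>
lemma pole_solution_is_lattice_wp:
  assumes E: "pole_solution g2 g3 E" and disc: "g2^3 - 27 * g3^2 \<noteq> 0"
  shows "is_lattice {p. is_pole E p}" "lattice_g2 {p. is_pole E p} = g2" "lattice_g3 {p. is_pole E p} = g3"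
proof -
  define L where "L = {p. is_pole E p}"
  have sp: "L sparse_in UNIV"
    using meromorphic_on_imp_not_pole_cosparse[OF pole_solutionD(1)[OF E, of UNIV]] by (simp add: eventually_cosparse L_def)
  obtain R where R: "R > 0" "\<And>z. \<exists>p. is_pole E p \<and> dist z p < R" using pole_solution_poles_dense[OF E disc] by blast
  have L: "is_lattice L"
  proof (rule discrete_dense_subgroup_is_lattice)
    show "0 \<in> L" using pole_solutionD(2)[OF E] by (simp add: L_def)
    show "x + y \<in> L" if "x \<in> L" "y \<in> L" for x y
      using pole_solution_pole_add[OF E, of y x] that by (simp add: L_def)
    show "- x \<in> L" if "x \<in> L" for x
      using pole_solution_pole_uminus[OF E, of x] that by (simp add: L_def)
    have "finite (cball 0 r \<inter> L)" for r
      by (rule sparse_in_compact_finite[OF sparse_in_subset[OF sp]]) simp_all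
    moreover have "{x \<in> L. norm x \<le> r} = cball 0 r \<inter> L" for r by auto
    ultimately show "finite {x \<in> L. norm x \<le> r}" for r by simp
    show "\<exists>p\<in>L. dist z p < R" for z using R(2)[of z] by (auto simp: L_def)
  qed
  then show "is_lattice {p. is_pole E p}" by (simp add: L_def)
  define e where "e = remove_sings E"
  have Em: "E meromorphic_on A" for A by (rule pole_solutionD(1)[OF E])
  have em: "e meromorphic_on UNIV" unfolding e_def by (rule remove_sings_meromorphic[OF Em])
  have eE: "\<forall>\<^sub>\<approx>z. e z = E z" unfolding e_def by (rule eventually_remove_sings_eq[OF Em])
  have ea: "e analytic_on {z}" if "z \<notin> L" for z
  proof (rule nicely_meromorphic_without_singularities)
    show "e nicely_meromorphic_on {z}" unfolding e_def by (rule remove_sings_nicely_meromorphic[OF Em])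
    have "isolated_singularity_at E z" by (rule meromorphic_on_isolated_singularity[OF Em])
    then show "\<forall>z\<in>{z}. \<not> is_pole e z" using that by (simp add: e_def L_def)
  qed
  have eper: "e (z + w) = e z" if w: "w \<in> L" for w z
  proof -
    have wp: "is_pole E w" using w by (simp add: L_def)
    have "\<forall>\<^sub>\<approx>z. E (z + w) = E z" using pole_solution_affine[OF E wp, of 1] by simp
    from eventually_cosparse_imp_eventually_at[OF this UNIV_I]
    have ev: "\<forall>\<^sub>F x in at z. (E \<circ> (\<lambda>z. z + w)) x = E x" by (simp add: o_def)
    have "filtermap (\<lambda>z. z + w) (at z) = at (z + w)"
      using filtermap_at_shift[of "- w" z] by simp
    then have "e (z + w) = remove_sings (E \<circ> (\<lambda>z. z + w)) z" unfolding e_def by (rule remove_sings_compose[symmetric])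
    also have "\<dots> = e z" unfolding e_def by (rule remove_sings_cong[OF ev refl])
    finally show ?thesis .
  qed
  define F where "F = (\<lambda>z. e z - lattice_wp L z)"
  obtain c where c: "((\<lambda>z. E z - 1 / z\<^sup>2) \<longlongrightarrow> c) (at 0)" using pole_solution_principal_part[OF E] by blast
  obtain c' where c': "((\<lambda>z. lattice_wp L z - 1 / z\<^sup>2) \<longlongrightarrow> c') (at 0)"
    using pole_solution_principal_part[OF lattice_wp_pole_solution[OF L]] by blast
  have "((\<lambda>z. (E z - 1 / z\<^sup>2) - (lattice_wp L z - 1 / z\<^sup>2)) \<longlongrightarrow> c - c') (at 0)" by (rule tendsto_diff[OF c c'])
  moreover have "\<forall>\<^sub>F z in at 0. F z = (E z - 1 / z\<^sup>2) - (lattice_wp L z - 1 / z\<^sup>2)"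
    using eventually_cosparse_imp_eventually_at[OF eE UNIV_I] by eventually_elim (simp add: F_def)
  ultimately have lim: "F \<midarrow>0\<rightarrow> c - c'" by (rule tendsto_cong[THEN iffD2, rotated])
  have FL: "F z = c - c'" if "z \<notin> L" for z
  proof (rule lattice_periodic_Liouville[OF L _ _ _ lim that])
    show "F meromorphic_on UNIV" unfolding F_def using em lattice_wp_meromorphic[OF L] by (intro meromorphic_intros)
    show "F analytic_on {z}" if "z \<notin> L" for z
      unfolding F_def using ea[OF that] lattice_wp_analytic[OF L that] by (intro analytic_intros)
    show "F (z + w) = F z" if "w \<in> L" for w z
      unfolding F_def using eper[OF that] lattice_wp_periodic[OF L that] by simp
  qed
  define k where "k = c - c'"
  let ?p = "lattice_wp L"
  have nL: "\<forall>\<^sub>\<approx>z. z \<notin> L" by (rule eventually_not_in_cosparse[OF sp])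
  have Ep: "\<forall>\<^sub>\<approx>z. E z = ?p z + k"
    using nL eE
  proof eventually_elim
    case (elim z)
    show ?case using FL[OF elim(1)] elim(2) by (simp add: F_def k_def algebra_simps)
  qed
  note Ep0 = eventually_cosparse_imp_eventually_at[OF Ep UNIV_I, of 0]
  have nL0: "\<forall>\<^sub>F z in at 0. z \<notin> L" by (rule eventually_cosparse_imp_eventually_at[OF nL UNIV_I])
  have "\<forall>\<^sub>F z in at 0. (12 * k) * ?p z ^ 2 + (12 * k^2 - g2 + lattice_g2 L) * ?p z + (4 * k^3 - g2 * k - g3 + lattice_g3 L) = 0"
    using Ep0 deriv_eq_at[OF Ep0] pole_solutionD(4)[OF E] pole_solutionD(4)[OF lattice_wp_pole_solution[OF L]] nL0
  proof eventually_elim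
    case (elim z)
    have "(?p has_field_derivative deriv ?p z) (at z)" using lattice_wp_analytic[OF L elim(5)] analytic_derivI by blast
    then have "((\<lambda>z. ?p z + k) has_field_derivative deriv ?p z) (at z)" by (auto intro!: derivative_eq_intros)
    then have "deriv E z = deriv ?p z" using elim(2) by (simp only: DERIV_imp_deriv)
    then have "4 * (?p z + k) ^ 3 - g2 * (?p z + k) - g3 = 4 * ?p z ^ 3 - lattice_g2 L * ?p z - lattice_g3 L"
      using elim(1,3,4) by simp
    then show ?case by (simp add: algebra_simps power2_eq_square power3_eq_cube)
  qed
  note q = quadratic_zero_at_infinity[OF lattice_wp_pole[OF L, unfolded is_pole_def] trivial_limit_at this]
  have "k = 0" using q(1) by simp
  then show "lattice_g2 {p. is_pole E p} = g2" "lattice_g3 {p. is_pole E p} = g3"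
    using q(2,3) by (simp_all add: L_def algebra_simps)
qed

text \<open>The poles of a solution with a pole at the origin form the required lattice. It is the only one,
because such a solution is unique and every function wp with these invariants is one.\<close>
theorem uniformization:
  assumes disc: "g2^3 - 27 * g3^2 \<noteq> 0"
  shows "\<exists>!L. is_lattice L \<and> lattice_g2 L = g2 \<and> lattice_g3 L = g3"
proof (rule ex_ex1I)
  obtain E where E: "pole_solution g2 g3 E" using pole_solution_exists by blast
  show "\<exists>L. is_lattice L \<and> lattice_g2 L = g2 \<and> lattice_g3 L = g3"
    using pole_solution_is_lattice_wp[OF E disc] by blast
next
  fix L L' assume L: "is_lattice L \<and> lattice_g2 L = g2 \<and> lattice_g3 L = g3"
    and L': "is_lattice L' \<and> lattice_g2 L' = g2 \<and> lattice_g3 L' = g3"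
  have "\<forall>\<^sub>\<approx>z. lattice_wp L z = lattice_wp L' z"
    using pole_solution_unique[of g2 g3] lattice_wp_pole_solution[of L] lattice_wp_pole_solution[of L'] L L' by simp
  from eventually_cosparse_imp_eventually_at[OF this UNIV_I]
  have "is_pole (lattice_wp L) z \<longleftrightarrow> is_pole (lattice_wp L') z" for z by (rule is_pole_cong[OF _ refl])
  then show "L = L'" using lattice_wp_is_pole_iff L L' by blast
qed

lemma wp_eq_lattice_wp:
  assumes "g2^3 - 27 * g3^2 \<noteq> 0"
  obtains L where "is_lattice L" "lattice_g2 L = g2" "lattice_g3 L = g3" "wp g2 g3 = lattice_wp L"
  using theI'[OF uniformization[OF assms]] unfolding wp_def by blast

text \<open>Otherwise 1/(wp - x) would be entire and periodic, hence constant.\<close>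
lemma lattice_wp_surj:
  assumes L: "is_lattice L"
  shows "\<exists>z. z \<notin> L \<and> lattice_wp L z = x"
proof (rule ccontr)
  assume "\<not> ?thesis"
  then have ne: "lattice_wp L z \<noteq> x" if "z \<notin> L" for z using that by blast
  define F where "F = (\<lambda>z. 1 / (lattice_wp L z - x))"
  have "filterlim (\<lambda>z. - x + lattice_wp L z) at_infinity (at 0)"
    by (rule tendsto_add_filterlim_at_infinity[OF tendsto_const lattice_wp_pole[OF L, unfolded is_pole_def]])
  then have "((\<lambda>z. inverse (- x + lattice_wp L z)) \<longlongrightarrow> 0) (at 0)" using tendsto_inverse_0 filterlim_compose by blast
  then have lim: "F \<midarrow>0\<rightarrow> 0" by (simp add: F_def inverse_eq_divide)
  have "F z = 0" if "z \<notin> L" for z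
  proof (rule lattice_periodic_Liouville[OF L _ _ _ lim that])
    show "F meromorphic_on UNIV" unfolding F_def using lattice_wp_meromorphic[OF L] by (intro meromorphic_intros)
    show "F analytic_on {z}" if "z \<notin> L" for z
      unfolding F_def using lattice_wp_analytic[OF L that] ne[OF that] by (intro analytic_intros) auto
    show "F (z + w) = F z" if "w \<in> L" for w z
      unfolding F_def using lattice_wp_periodic[OF L that] by simp
  qed
  moreover obtain z where "z \<notin> L"
  proof -
    have "finite {w\<in>L. norm w \<le> 1}" by (rule lattice_finite[OF L])
    moreover have "infinite (cball (0::complex) 1)" using uncountable_cball[of 1 "0::complex"] countable_finite by auto
    ultimately have "\<not> cball 0 1 \<subseteq> {w\<in>L. norm w \<le> 1}" using finite_subset by blast
    then show ?thesis using that by auto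
  qed
  ultimately show False using ne[of z] by (auto simp: F_def)
qed

lemma meromorphic_deriv_nonzero_cosparse:
  assumes m: "y meromorphic_on UNIV" and nc: "\<not> (\<exists>k. \<forall>\<^sub>\<approx>z. y z = k)"
  shows "\<forall>\<^sub>\<approx>z. deriv y z \<noteq> 0"
proof -
  consider "\<forall>\<^sub>\<approx>z. deriv y z = 0" | "\<forall>\<^sub>\<approx>z. deriv y z \<noteq> 0"
    using meromorphic_imp_constant_or_avoid[OF meromorphic_on_deriv[OF m] open_UNIV connected_UNIV, of 0] by blast
  then show ?thesis
  proof cases
    case 1
    have "\<forall>\<^sub>\<approx>z. y analytic_on {z} \<and> (\<forall>\<^sub>F w in nhds z. deriv y w = 0)"
      using eventually_cosparse_imp_nhds[OF 1 open_UNIV] meromorphic_on_imp_analytic_cosparse[OF m] by eventually_elim auto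
    then obtain z where z: "y analytic_on {z}" "\<forall>\<^sub>F w in nhds z. deriv y w = 0"
      using cosparse_ex by blast
    obtain S where S: "open S" "z \<in> S" "y holomorphic_on S" using z(1) analytic_at by blast
    obtain T where T: "open T" "z \<in> T" "\<forall>w\<in>T. deriv y w = 0" using z(2) unfolding eventually_nhds by blast
    obtain r where r: "r > 0" "ball z r \<subseteq> S \<inter> T" using S T open_contains_ball by (metis IntI open_Int)
    have "\<exists>c. \<forall>x\<in>ball z r. y x = c"
    proof (rule has_field_derivative_zero_constant)
      fix x assume x: "x \<in> ball z r"
      have "(y has_field_derivative deriv y x) (at x)" by (rule holomorphic_derivI[OF S(3,1)]) (use x r in blast)
      moreover have "deriv y x = 0" using x r T by blast
      ultimately show "(y has_field_derivative 0) (at x within ball z r)" using has_field_derivative_at_within by metis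
    qed simp
    then obtain c where c: "\<forall>x\<in>ball z r. y x = c" by blast
    have "\<forall>\<^sub>F x in at z. x \<in> ball z r" using r by (intro eventually_at_in_open') auto
    then have "\<forall>\<^sub>F x in at z. y x = (\<lambda>_. c) x" by eventually_elim (use c in auto)
    then have "\<forall>\<^sub>\<approx>x. y x = (\<lambda>_. c) x"
      by (rule meromorphic_eq_cosparseI[OF m meromorphic_on_const open_UNIV connected_UNIV UNIV_I])
    then show ?thesis using nc by auto
  qed
qed

text \<open>At a point where y' is nonzero, choose zeta with wp(h + zeta) = y there. The derivatives agree up
to sign, and wp being even allows the sign to be corrected. Uniqueness for the equation and the
identity theorem do the rest; no path lifting is involved.\<close>
lemma lattice_wp_lift:
  assumes L: "is_lattice L" and m: "y meromorphic_on UNIV" and nc: "\<not> (\<exists>k. \<forall>\<^sub>\<approx>z. y z = k)"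
    and h: "h holomorphic_on UNIV"
    and ode: "\<forall>\<^sub>\<approx>z. (deriv y z)^2 = (deriv h z)^2 * (4 * y z ^ 3 - lattice_g2 L * y z - lattice_g3 L)"
  obtains \<zeta> where "\<forall>\<^sub>\<approx>z. y z = lattice_wp L (h z + \<zeta>)"
proof -
  let ?p = "lattice_wp L"
  have ha: "h analytic_on A" for A using h analytic_on_holomorphic by blast
  have "\<forall>\<^sub>\<approx>z. y analytic_on {z} \<and> deriv y z \<noteq> 0"
    using meromorphic_deriv_nonzero_cosparse[OF m nc] meromorphic_on_imp_analytic_cosparse[OF m]
    by eventually_elim auto
  then obtain z1 where z1: "y analytic_on {z1}" "deriv y z1 \<noteq> 0"
    using cosparse_ex by blast
  note odeat = eventually_cosparse_imp_eventually_at[OF ode UNIV_I, of z1]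
  have va: "(\<lambda>z. (deriv h z)^2) analytic_on {z1}" using ha by (intro analytic_intros)
  have y1: "(deriv y z1)^2 = (deriv h z1)^2 * (4 * y z1 ^ 3 - lattice_g2 L * y z1 - lattice_g3 L)"
    by (rule cubic_ode_at_analytic[OF odeat z1(1) va])
  obtain \<zeta>1 where \<zeta>1: "\<zeta>1 \<notin> L" "?p \<zeta>1 = y z1" using lattice_wp_surj[OF L] by blast
  have pd: "(?p has_field_derivative deriv ?p z) (at z)" if "z \<notin> L" for z
    using lattice_wp_analytic[OF L that] analytic_derivI by blast
  have m\<zeta>: "- \<zeta>1 \<notin> L" using \<zeta>1(1) lattice_closed(3)[OF L, of "- \<zeta>1"] by auto
  have podd: "deriv ?p (- \<zeta>1) = - deriv ?p \<zeta>1"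
  proof -
    have "((\<lambda>z. ?p (- z)) has_field_derivative deriv ?p (- \<zeta>1) * (- 1)) (at \<zeta>1)"
      by (rule DERIV_chain'[where f=uminus and g="?p"]) (auto intro!: derivative_eq_intros pd m\<zeta>)
    then have "(?p has_field_derivative - deriv ?p (- \<zeta>1)) (at \<zeta>1)" using lattice_wp_uminus[OF L] by simp
    then show ?thesis by (simp add: DERIV_imp_deriv)
  qed
  have "(deriv y z1)^2 = (deriv h z1 * deriv ?p \<zeta>1)^2"
    unfolding y1 power_mult_distrib using lattice_wp_ode[OF L \<zeta>1(1)] \<zeta>1(2) by simp
  then have "deriv y z1 = deriv h z1 * deriv ?p \<zeta>1 \<or> deriv y z1 = - (deriv h z1 * deriv ?p \<zeta>1)" by (simp add: power2_eq_iff)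
  then have "\<exists>\<zeta>2. \<zeta>2 \<notin> L \<and> ?p \<zeta>2 = y z1 \<and> deriv y z1 = deriv h z1 * deriv ?p \<zeta>2"
  proof
    assume "deriv y z1 = deriv h z1 * deriv ?p \<zeta>1"
    then show ?thesis using \<zeta>1 by blast
  next
    assume "deriv y z1 = - (deriv h z1 * deriv ?p \<zeta>1)"
    then show ?thesis using \<zeta>1 m\<zeta> podd lattice_wp_uminus[OF L, of \<zeta>1] by (intro exI[of _ "- \<zeta>1"]) simp
  qed
  then obtain \<zeta>2 where \<zeta>2: "\<zeta>2 \<notin> L" "?p \<zeta>2 = y z1" "deriv y z1 = deriv h z1 * deriv ?p \<zeta>2" by blast
  define \<zeta> where "\<zeta> = \<zeta>2 - h z1"
  define f where "f = (\<lambda>z. ?p (h z + \<zeta>))"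
  have hz: "h z1 + \<zeta> = \<zeta>2" by (simp add: \<zeta>_def)
  have fm: "f meromorphic_on UNIV"
    unfolding f_def by (rule meromorphic_on_compose[OF lattice_wp_meromorphic[OF L]]) (use ha in \<open>auto intro!: analytic_intros\<close>)
  have fa: "f analytic_on {z1}"
    unfolding f_def by (rule analytic_on_compose_gen[of "\<lambda>z. h z + \<zeta>" "{z1}" ?p "{\<zeta>2}", unfolded o_def])
      (use ha lattice_wp_analytic[OF L \<zeta>2(1)] hz in \<open>auto intro!: analytic_intros\<close>)
  have hd: "(h has_field_derivative deriv h z) (at z)" for z by (rule holomorphic_derivI[OF h open_UNIV UNIV_I])
  have fd: "deriv f z = deriv ?p (h z + \<zeta>) * deriv h z" if "h z + \<zeta> \<notin> L" for z
  proof (rule DERIV_imp_deriv)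
    show "(f has_field_derivative deriv ?p (h z + \<zeta>) * deriv h z) (at z)"
      unfolding f_def by (rule DERIV_chain'[where f="\<lambda>z. h z + \<zeta>" and g="?p"])
        (auto intro!: derivative_eq_intros pd that hd)
  qed
  obtain S where S: "open S" "\<zeta>2 \<in> S" "?p holomorphic_on S" using lattice_wp_analytic[OF L \<zeta>2(1)] analytic_at by blast
  have notL: "w \<notin> L" if "w \<in> S" for w
  proof
    assume "w \<in> L"
    then have "is_pole ?p w" using lattice_wp_is_pole_iff[OF L] by simp
    moreover have "?p analytic_on {w}" using S that analytic_at by blast
    ultimately show False using analytic_at_imp_no_pole by blast
  qed
  have "((\<lambda>z. h z + \<zeta>) \<longlongrightarrow> h z1 + \<zeta>) (at z1)"
    using analytic_at_imp_isCont[OF ha[of "{z1}"]] by (intro tendsto_intros) (simp add: isCont_def)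
  then have "\<forall>\<^sub>F z in at z1. h z + \<zeta> \<in> S" using S hz topological_tendstoD by metis
  then have fode: "\<forall>\<^sub>F z in at z1. (deriv f z)^2 = (deriv h z)^2 * (4 * f z ^ 3 - lattice_g2 L * f z - lattice_g3 L)"
  proof eventually_elim
    case (elim z)
    have "h z + \<zeta> \<notin> L" using notL elim by blast
    then show ?case using fd[of z] lattice_wp_ode[OF L, of "h z + \<zeta>"] by (simp add: f_def power_mult_distrib)
  qed
  have "\<forall>\<^sub>\<approx>z. y z = f z"
  proof (rule cubic_ode_regular_unique[OF m fm open_UNIV connected_UNIV UNIV_I z1(1) fa va odeat fode])
    show "y z1 = f z1" using \<zeta>2 hz by (simp add: f_def)
    show "deriv y z1 = deriv f z1" using fd[of z1] \<zeta>2 hz by (simp add: mult.commute)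
  qed (rule z1(2))
  then show ?thesis using that by (simp add: f_def)
qed

section \<open>Local analysis of the Schwarzian equation\<close>

text \<open>The numerator of the Schwarzian derivative along u'^2 = K Q(u), up to the factor K/8.\<close>
definition schwarz_quartic :: "complex poly \<Rightarrow> complex poly" where
  "schwarz_quartic Q = 4 * Q * pderiv (pderiv Q) - 3 * (pderiv Q)^2"

text \<open>Two differentiations give u'' = K Q'(u)/2 and u''' = K Q''(u) u'/2.\<close>
lemma Schwarzian_of_square_ode:
  assumes m: "u meromorphic_on UNIV" and nc: "\<not> (\<exists>k. \<forall>\<^sub>\<approx>z. u z = k)"
    and ode: "\<forall>\<^sub>\<approx>z. (deriv u z)^2 = K * poly Q (u z)"
  shows "\<forall>\<^sub>\<approx>z. Schwarzian u z = K * poly (schwarz_quartic Q) (u z) / (8 * poly Q (u z))"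
proof -
  have d0: "\<forall>\<^sub>\<approx>z. u analytic_on {z} \<and> deriv u z \<noteq> 0 \<and> (deriv u z)^2 = K * poly Q (u z)"
    using meromorphic_on_imp_analytic_cosparse[OF m] meromorphic_deriv_nonzero_cosparse[OF m nc] ode
    by eventually_elim auto
  have d1: "\<forall>\<^sub>\<approx>z. deriv (deriv u) z = K * poly (pderiv Q) (u z) / 2"
    using eventually_cosparse_imp_nhds[OF ode open_UNIV] d0
  proof eventually_elim
    case (elim z)
    have a: "u analytic_on {z}" using elim by simp
    have d: "(u has_field_derivative deriv u z) (at z)" using a analytic_derivI by blast
    have dd: "(deriv u has_field_derivative deriv (deriv u) z) (at z)" using analytic_deriv[OF a] analytic_derivI by blast
    have "((\<lambda>w. (deriv u w)^2) has_field_derivative 2 * deriv u z * deriv (deriv u) z) (at z)"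
      by (auto intro!: derivative_eq_intros dd)
    moreover have "((\<lambda>w. K * poly Q (u w)) has_field_derivative K * (poly (pderiv Q) (u z) * deriv u z)) (at z)"
      by (intro DERIV_cmult DERIV_chain2[OF poly_DERIV d])
    ultimately have "2 * deriv u z * deriv (deriv u) z = K * (poly (pderiv Q) (u z) * deriv u z)"
      using deriv_cong_ev[OF elim(1) refl] by (simp only: DERIV_imp_deriv)
    then show ?case using elim(2) by (simp add: field_simps)
  qed
  show ?thesis
    using eventually_cosparse_imp_nhds[OF d1 open_UNIV] d1 d0
  proof eventually_elim
    case (elim z)
    have a: "u analytic_on {z}" using elim by simp
    have d: "(u has_field_derivative deriv u z) (at z)" using a analytic_derivI by blast
    have dd: "(deriv u has_field_derivative K * poly (pderiv Q) (u z) / 2) (at z)"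
      using analytic_deriv[OF a] analytic_derivI elim(2) by metis
    have "((\<lambda>w. K * poly (pderiv Q) (u w) / 2) has_field_derivative K * (poly (pderiv (pderiv Q)) (u z) * deriv u z) / 2) (at z)"
      by (intro DERIV_cdivide DERIV_cmult DERIV_chain2[OF poly_DERIV d])
    then have d3: "(deriv (deriv u) has_field_derivative K * (poly (pderiv (pderiv Q)) (u z) * deriv u z) / 2) (at z)"
      using DERIV_cong_ev[OF refl elim(1) refl] by blast
    define q1 q2 u1 where "q1 = poly (pderiv Q) (u z)" and "q2 = poly (pderiv (pderiv Q)) (u z)" and "u1 = deriv u z"
    have u1: "u1 \<noteq> 0" using elim by (simp add: u1_def)
    have sq: "u1^2 = K * poly Q (u z)" using elim by (simp add: u1_def)
    then have nz: "K \<noteq> 0" "poly Q (u z) \<noteq> 0" using u1 by auto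
    have "((\<lambda>w. deriv (deriv u) w / deriv u w) has_field_derivative
        ((K * (q2 * u1) / 2) * u1 - deriv (deriv u) z * (K * q1 / 2)) / (u1 * u1)) (at z)"
      unfolding q1_def q2_def u1_def by (rule DERIV_divide[OF d3 dd]) (use elim in simp)
    from DERIV_imp_deriv[OF this]
    have "Schwarzian u z = ((K * (q2 * u1) / 2) * u1 - deriv (deriv u) z * (K * q1 / 2)) / (u1 * u1) - (1/2) * (deriv (deriv u) z / u1)^2"
      unfolding Schwarzian_def u1_def by (simp only:)
    also have "deriv (deriv u) z = K * q1 / 2" using elim(2) by (simp only: q1_def)
    also have "((K * (q2 * u1) / 2) * u1 - (K * q1 / 2) * (K * q1 / 2)) / (u1 * u1) - (1/2) * ((K * q1 / 2) / u1)^2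
       = K * q2 / 2 - 3 * K^2 * q1^2 / (8 * u1^2)"
      using u1 by (simp add: field_simps power2_eq_square)
    also have "\<dots> = K * (4 * poly Q (u z) * q2 - 3 * q1^2) / (8 * poly Q (u z))"
      unfolding sq using nz by (simp add: field_simps power2_eq_square)
    finally show ?case by (simp add: schwarz_quartic_def q1_def q2_def)
  qed
qed

text \<open>One normal form for regular points, where n is the multiplicity of the value t, and for poles, where
- n is the order, so that both can be treated together.\<close>
lemma meromorphic_local_power_form:
  assumes m: "u meromorphic_on UNIV" and nc: "\<not> (\<exists>k. \<forall>\<^sub>\<approx>z. u z = k)"
  obtains t n k where "n \<noteq> 0" "k analytic_on {z0}" "k z0 \<noteq> 0" "n < 0 \<longrightarrow> t = 0"
    "\<forall>\<^sub>F z in at z0. u z = t + k z * (z - z0) powi n"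
proof -
  note res = that
  have mz: "u meromorphic_on {z0}" by (rule meromorphic_on_subset[OF m]) simp
  have avoid: "\<forall>\<^sub>F z in at z0. u z \<noteq> t" for t
    using meromorphic_imp_constant_or_avoid[OF m open_UNIV connected_UNIV, of t] nc
      eventually_cosparse_imp_eventually_at[OF _ UNIV_I, of "\<lambda>z. u z \<noteq> t"] by blast
  have main: thesis if n: "zorder (\<lambda>z. u z - t) z0 \<noteq> 0" "zorder (\<lambda>z. u z - t) z0 < 0 \<longrightarrow> t = 0" for t
  proof -
    let ?x = "\<lambda>z. u z - t"
    have xm: "?x meromorphic_on {z0}" using mz by (intro meromorphic_intros)
    have fr: "\<exists>\<^sub>F z in at z0. ?x z \<noteq> 0" using avoid[of t] by (simp add: eventually_frequently)
    obtain r where r: "zor_poly ?x z0 z0 \<noteq> 0" "r > 0" "zor_poly ?x z0 holomorphic_on cball z0 r"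
      "\<forall>w\<in>cball z0 r - {z0}. ?x w = zor_poly ?x z0 w * (w - z0) powi zorder ?x z0 \<and> zor_poly ?x z0 w \<noteq> 0"
      using zorder_exist[OF meromorphic_on_isolated_singularity[OF xm] meromorphic_on_not_essential[OF xm] fr] by blast
    have inb: "\<forall>\<^sub>F w in at z0. w \<in> ball z0 r - {z0}" using r(2) by (intro eventually_at_in_open) auto
    have ev: "\<forall>\<^sub>F z in at z0. u z = t + zor_poly ?x z0 z * (z - z0) powi zorder ?x z0"
      using inb
    proof eventually_elim
      case (elim w)
      then have "?x w = zor_poly ?x z0 w * (w - z0) powi zorder ?x z0" using r(4) by auto
      then show ?case by (simp add: algebra_simps)
    qed
    have "zor_poly ?x z0 holomorphic_on ball z0 r" by (rule holomorphic_on_subset[OF r(3) ball_subset_cball])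
    then have "zor_poly ?x z0 analytic_on {z0}" using r(2) analytic_at by (metis centre_in_ball open_ball)
    then show ?thesis using res[OF n(1) _ r(1) n(2) ev] by blast
  qed
  show ?thesis
  proof (cases "is_pole u z0")
    case True
    have "zorder (\<lambda>z. u z - 0) z0 < 0"
      using isolated_pole_imp_neg_zorder[OF meromorphic_on_isolated_singularity[OF mz] True] by simp
    then show ?thesis by (intro main[of 0]) auto
  next
    case False
    then obtain t where t: "u \<midarrow>z0\<rightarrow> t" using meromorphic_on_not_essential[OF mz] by (auto simp: not_essential_def)
    have xm: "(\<lambda>z. u z - t) meromorphic_on {z0}" using mz by (intro meromorphic_intros)
    have "isolated_zero (\<lambda>z. u z - t) z0"
      unfolding isolated_zero_def using avoid[of t] t by (auto simp: LIM_zero)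
    then have "zorder (\<lambda>z. u z - t) z0 > 0"
      by (rule zorder_isolated_zero_pos') (rule meromorphic_on_isolated_singularity[OF xm])
    then show ?thesis by (intro main[of t]) auto
  qed
qed

lemma local_power_form_deriv:
  assumes k: "k analytic_on {z0}" and u: "\<forall>\<^sub>F z in at z0. u z = t + k z * (z - z0) powi n"
  shows "\<forall>\<^sub>F z in at z0. deriv u z = (of_int n * k z + (z - z0) * deriv k z) * (z - z0) powi (n - 1)"
proof -
  obtain S where S: "open S" "z0 \<in> S" "k holomorphic_on S" using k analytic_at by blast
  have "\<forall>\<^sub>F z in at z0. z \<in> S - {z0}" using S by (intro eventually_at_in_open) auto
  with deriv_eq_at[OF u] show ?thesis
  proof eventually_elim
    case (elim z)
    have z0: "z - z0 \<noteq> 0" using elim by simp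
    have kd: "(k has_field_derivative deriv k z) (at z)" using elim S holomorphic_derivI by blast
    have "((\<lambda>z. t + k z * (z - z0) powi n) has_field_derivative
        (deriv k z * (z - z0) powi n + k z * (of_int n * (z - z0) powi (n - 1)))) (at z)"
      using z0 by (auto intro!: derivative_eq_intros kd)
    then have "deriv u z = deriv k z * (z - z0) powi n + k z * (of_int n * (z - z0) powi (n - 1))"
      using elim(1) by (simp only: DERIV_imp_deriv)
    moreover have "(z - z0) powi n = (z - z0) * (z - z0) powi (n - 1)" using z0 by (simp add: power_int_diff)
    ultimately show ?case by (simp add: algebra_simps)
  qed
qed

text \<open>With H = k'/k the quotient u''/u' is n/(z - z0) + H, from which both limits can be read off.
In terms of the local degree m = n + 1 the first limit is (1 - m^2)/2.\<close>
lemma Schwarzian_local: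
  assumes k: "k analytic_on {z0}" "k z0 \<noteq> 0" and u: "\<forall>\<^sub>F z in at z0. deriv u z = k z * (z - z0) powi n"
  shows "((\<lambda>z. (z - z0)^2 * Schwarzian u z) \<longlongrightarrow> - of_int n * (of_int n + 2) / 2) (at z0)"
    and "n = 0 \<Longrightarrow> \<exists>c. (Schwarzian u \<longlongrightarrow> c) (at z0)"
proof -
  define H where "H = (\<lambda>z. deriv k z / k z)"
  have Ha: "H analytic_on {z0}" unfolding H_def using k by (intro analytic_intros) auto
  obtain S where S: "open S" "z0 \<in> S" "H holomorphic_on S" using Ha analytic_at by blast
  obtain T where T: "open T" "z0 \<in> T" "k holomorphic_on T" using k analytic_at by blast
  have kl: "(k \<longlongrightarrow> k z0) (at z0)" using analytic_at_imp_isCont[OF k(1)] by (simp add: isCont_def)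
  have kn: "\<forall>\<^sub>F z in at z0. k z \<noteq> 0" by (rule tendsto_imp_eventually_ne[OF kl k(2)])
  have inS: "\<forall>\<^sub>F z in at z0. z \<in> (S \<inter> T) - {z0}" using S T by (intro eventually_at_in_open) auto
  have ratio: "\<forall>\<^sub>F z in at z0. deriv (deriv u) z / deriv u z = of_int n / (z - z0) + H z"
    using deriv_eq_at[OF u] u kn inS
  proof eventually_elim
    case (elim z)
    have z0: "z - z0 \<noteq> 0" using elim by simp
    have kd: "(k has_field_derivative deriv k z) (at z)" using elim T holomorphic_derivI by blast
    have "((\<lambda>z. k z * (z - z0) powi n) has_field_derivative
        (deriv k z * (z - z0) powi n + k z * (of_int n * (z - z0) powi (n - 1)))) (at z)"
      using z0 by (auto intro!: derivative_eq_intros kd)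
    then have "deriv (deriv u) z = deriv k z * (z - z0) powi n + k z * (of_int n * (z - z0) powi (n - 1))"
      using elim(1) by (simp only: DERIV_imp_deriv)
    moreover define p where "p = (z - z0) powi (n - 1)"
    moreover have pn: "(z - z0) powi n = (z - z0) * p" using z0 by (simp add: p_def power_int_diff)
    moreover have p0: "p \<noteq> 0" using z0 by (simp add: p_def)
    ultimately have "deriv (deriv u) z / deriv u z = (deriv k z * ((z - z0) * p) + k z * (of_int n * p)) / (k z * ((z - z0) * p))"
      unfolding elim(2) by simp
    also have "\<dots> = of_int n / (z - z0) + H z"
      unfolding H_def using elim(3) z0 p0 by (simp add: add_divide_distrib)
    finally show ?case .
  qed
  have S0: "\<forall>\<^sub>F z in at z0. Schwarzian u z = - of_int n / (z - z0)^2 + deriv H z - (1/2) * (of_int n / (z - z0) + H z)^2"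
    using ratio deriv_eq_at[OF ratio] inS
  proof eventually_elim
    case (elim z)
    have z0: "z - z0 \<noteq> 0" using elim by simp
    have Hd: "(H has_field_derivative deriv H z) (at z)" using elim S holomorphic_derivI by blast
    have "((\<lambda>z. of_int n / (z - z0) + H z) has_field_derivative - of_int n / (z - z0)^2 + deriv H z) (at z)"
      using z0 by (auto intro!: derivative_eq_intros Hd simp: power2_eq_square)
    then show ?case unfolding Schwarzian_def elim(1) elim(2) by (simp add: DERIV_imp_deriv)
  qed
  have Hl: "(H \<longlongrightarrow> H z0) (at z0)" "(deriv H \<longlongrightarrow> deriv H z0) (at z0)"
    using analytic_at_imp_isCont[OF Ha] analytic_at_imp_isCont[OF analytic_deriv[OF Ha]] by (simp_all add: isCont_def)
  have ez: "((\<lambda>z. z - z0) \<longlongrightarrow> 0) (at z0)" by (auto intro!: tendsto_eq_intros)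
  have nz: "\<forall>\<^sub>F z in at z0. z - z0 \<noteq> 0" using inS by eventually_elim simp
  have "\<forall>\<^sub>F z in at z0. (z - z0)^2 * Schwarzian u z = - of_int n + (z - z0)^2 * deriv H z - (1/2) * (of_int n + (z - z0) * H z)^2"
    using S0 nz
  proof eventually_elim
    case (elim z)
    have g: "e^2 * (- N / e^2 + D - (1/2) * (N / e + G)^2) = - N + e^2 * D - (1/2) * (N + e * G)^2" if "e \<noteq> 0" for e N D G :: complex
      using that by (simp add: field_simps power2_eq_square)
    show ?case unfolding elim(1) by (rule g[OF elim(2)])
  qed
  moreover have "((\<lambda>z. - of_int n + (z - z0)^2 * deriv H z - (1/2) * (of_int n + (z - z0) * H z)^2)
      \<longlongrightarrow> - of_int n * (of_int n + 2) / 2) (at z0)"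
    by (rule tendsto_eq_intros ez Hl refl | simp add: field_simps power2_eq_square)+
  ultimately show "((\<lambda>z. (z - z0)^2 * Schwarzian u z) \<longlongrightarrow> - of_int n * (of_int n + 2) / 2) (at z0)"
    by (rule tendsto_cong[THEN iffD2])
  assume n: "n = 0"
  have lim: "((\<lambda>z. deriv H z - (1/2) * (H z)^2) \<longlongrightarrow> deriv H z0 - (1/2) * (H z0)^2) (at z0)" by (intro tendsto_intros Hl)
  have ev: "\<forall>\<^sub>F z in at z0. Schwarzian u z = deriv H z - (1/2) * (H z)^2" using S0 by eventually_elim (simp add: n)
  from tendsto_cong[THEN iffD2, OF ev lim] show "\<exists>c. (Schwarzian u \<longlongrightarrow> c) (at z0)" by blast
qed

lemma poly_ratio_at_infinity:
  fixes p :: "complex poly"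
  assumes u: "filterlim u at_infinity F"
  shows "((\<lambda>z. poly p (u z) / u z ^ degree p) \<longlongrightarrow> lead_coeff p) F"
proof -
  have t: "((\<lambda>z. inverse (u z)) \<longlongrightarrow> 0) F" using u tendsto_inverse_0 filterlim_compose by blast
  have "((\<lambda>z. poly (reflect_poly p) (inverse (u z))) \<longlongrightarrow> poly (reflect_poly p) 0) F"
    by (rule tendsto_poly[OF t])
  then have "((\<lambda>z. poly (reflect_poly p) (inverse (u z))) \<longlongrightarrow> lead_coeff p) F" by (simp add: poly_0_coeff_0)
  moreover have "\<forall>\<^sub>F z in F. u z \<noteq> 0" by (rule filterlim_at_infinity_imp_eventually_ne[OF u])
  then have "\<forall>\<^sub>F z in F. poly p (u z) / u z ^ degree p = poly (reflect_poly p) (inverse (u z))"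
    by eventually_elim (simp add: poly_reflect_poly_nz field_simps)
  ultimately show ?thesis by (rule tendsto_cong[THEN iffD2, rotated])
qed

lemma tendsto_power_times_finite:
  fixes f :: "complex \<Rightarrow> complex"
  assumes "(f \<longlongrightarrow> c) (at z0)" "j > 0"
  shows "((\<lambda>z. (z - z0)^j * f z) \<longlongrightarrow> 0) (at z0)"
proof -
  have ez: "((\<lambda>z. z - z0) \<longlongrightarrow> 0) (at z0)" by (auto intro!: tendsto_eq_intros)
  have "((\<lambda>z. (z - z0)^j * f z) \<longlongrightarrow> 0^j * c) (at z0)" by (intro tendsto_mult tendsto_power ez assms)
  then show ?thesis using assms by (simp add: power_0_left)
qed

text \<open>A finite right-hand side forces local degree n = 1, or n = -1 at a pole. At a root t of Q the
right-hand side has a pole of order n, while the left-hand side has a finite limit if n = 1 and a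
pole of order two if n > 1. For n = 2 the leading coefficients determine k(z0), and hence
the value l.\<close>
lemma Schwarzian_solution_first_integral_local:
  fixes P Q :: "complex poly"
  assumes m: "u meromorphic_on UNIV" and nc: "\<not> (\<exists>k. \<forall>\<^sub>\<approx>z. u z = k)"
    and sol: "\<forall>\<^sub>\<approx>z. Schwarzian u z = poly P (u z) / poly Q (u z)"
    and deg: "degree Q = 4" "degree P = 4"
    and simple: "\<And>t. poly Q t = 0 \<Longrightarrow> poly (pderiv Q) t \<noteq> 0" and cop: "\<And>t. poly Q t = 0 \<Longrightarrow> poly P t \<noteq> 0"
  obtains l where "l \<noteq> 0" "((\<lambda>z. (deriv u z)^2 / poly Q (u z)) \<longlongrightarrow> l) (at z0)"
    "\<And>t. poly Q t = 0 \<Longrightarrow> (u \<longlongrightarrow> t) (at z0) \<Longrightarrow> l = - 8 * poly P t / (3 * (poly (pderiv Q) t)^2)"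
proof (rule meromorphic_local_power_form[OF m nc, where ?z0.0 = z0])
  fix t n k assume n0: "n \<noteq> 0" and k: "k analytic_on {z0}" "k z0 \<noteq> 0" and t0: "n < 0 \<longrightarrow> t = 0"
    and u: "\<forall>\<^sub>F z in at z0. u z = t + k z * (z - z0) powi n"
  define k2 where "k2 = (\<lambda>z. of_int n * k z + (z - z0) * deriv k z)"
  have k2a: "k2 analytic_on {z0}" unfolding k2_def using k by (intro analytic_intros)
  have k20: "k2 z0 = of_int n * k z0" "k2 z0 \<noteq> 0" using n0 k by (auto simp: k2_def)
  have du: "\<forall>\<^sub>F z in at z0. deriv u z = k2 z * (z - z0) powi (n - 1)"
    using local_power_form_deriv[OF k(1) u] by (simp add: k2_def)
  note S = Schwarzian_local[OF k2a k20(2) du]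
  have solz: "\<forall>\<^sub>F z in at z0. Schwarzian u z = poly P (u z) / poly Q (u z)"
    by (rule eventually_cosparse_imp_eventually_at[OF sol UNIV_I])
  have kl: "(k \<longlongrightarrow> k z0) (at z0)" "(k2 \<longlongrightarrow> k2 z0) (at z0)"
    using analytic_at_imp_isCont[OF k(1)] analytic_at_imp_isCont[OF k2a] by (simp_all add: isCont_def)
  have ez: "((\<lambda>z. z - z0) \<longlongrightarrow> 0) (at z0)" by (auto intro!: tendsto_eq_intros)
  have nz: "\<forall>\<^sub>F z in at z0. z - z0 \<noteq> 0" by (simp add: eventually_at_filter)
  have finite_case: "n = 1 \<or> n = -1" if lim: "((\<lambda>z. poly P (u z) / poly Q (u z)) \<longlongrightarrow> c) (at z0)" for c
  proof -
    have "(Schwarzian u \<longlongrightarrow> c) (at z0)" by (rule tendsto_cong[THEN iffD2, OF solz lim])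
    from tendsto_power_times_finite[OF this, of 2]
    have "((\<lambda>z. (z - z0)^2 * Schwarzian u z) \<longlongrightarrow> 0) (at z0)" by simp
    then have "- of_int (n - 1) * (of_int (n - 1) + 2) / 2 = (0::complex)"
      using S(1) tendsto_unique[OF trivial_limit_at] by blast
    then have "of_int ((n - 1) * (n + 1)) = (0::complex)" by (simp add: algebra_simps)
    then have "(n - 1) * (n + 1) = 0" by (simp only: of_int_eq_0_iff)
    then show ?thesis by auto
  qed
  show ?thesis
  proof (cases "n < 0")
    case True
    then have t: "t = 0" using t0 by simp
    have "filterlim (\<lambda>z. k z * (z - z0) powi n) at_infinity (at z0)"
    proof (rule tendsto_mult_filterlim_at_infinity[OF kl(1) k(2)])
      have "filterlim (\<lambda>z. (z - z0) ^ nat (- n)) (at 0) (at z0)"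
        unfolding filterlim_at using True nz by (auto intro!: tendsto_eq_intros ez simp: power_0_left elim: eventually_mono)
      then have "filterlim (\<lambda>z. inverse ((z - z0) ^ nat (- n))) at_infinity (at z0)"
        by (rule filterlim_compose[OF filterlim_inverse_at_infinity])
      moreover have "inverse ((z - z0) ^ nat (- n)) = (z - z0) powi n" for z
        using True by (simp add: power_int_def power_inverse)
      ultimately show "filterlim (\<lambda>z. (z - z0) powi n) at_infinity (at z0)" by simp
    qed
    then have uinf: "filterlim u at_infinity (at z0)" using filterlim_cong[OF refl refl u] t by simp
    have unz: "\<forall>\<^sub>F z in at z0. u z \<noteq> 0" by (rule filterlim_at_infinity_imp_eventually_ne[OF uinf])
    have lQ: "((\<lambda>z. poly Q (u z) / u z ^ 4) \<longlongrightarrow> lead_coeff Q) (at z0)" and lP: "((\<lambda>z. poly P (u z) / u z ^ 4) \<longlongrightarrow> lead_coeff P) (at z0)"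
      using poly_ratio_at_infinity[OF uinf, of Q] poly_ratio_at_infinity[OF uinf, of P] deg by simp_all
    have "Q \<noteq> 0" using deg by auto
    then have lcQ: "lead_coeff Q \<noteq> 0" by simp
    have "((\<lambda>z. (poly P (u z) / u z ^ 4) / (poly Q (u z) / u z ^ 4)) \<longlongrightarrow> lead_coeff P / lead_coeff Q) (at z0)"
      by (rule tendsto_divide[OF lP lQ lcQ])
    moreover have "\<forall>\<^sub>F z in at z0. poly P (u z) / poly Q (u z) = (poly P (u z) / u z ^ 4) / (poly Q (u z) / u z ^ 4)"
      using unz by eventually_elim simp
    ultimately have "((\<lambda>z. poly P (u z) / poly Q (u z)) \<longlongrightarrow> lead_coeff P / lead_coeff Q) (at z0)"
      by (rule tendsto_cong[THEN iffD2, rotated])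
    from finite_case[OF this] True have n: "n = -1" by auto
    define l where "l = (k2 z0)^2 / (k z0 ^ 4 * lead_coeff Q)"
    have "((\<lambda>z. (k2 z)^2 / (k z ^ 4 * (poly Q (u z) / u z ^ 4))) \<longlongrightarrow> l) (at z0)"
      unfolding l_def using k lcQ by (intro tendsto_intros kl lQ) auto
    moreover have kn: "\<forall>\<^sub>F z in at z0. k z \<noteq> 0" by (rule tendsto_imp_eventually_ne[OF kl(1) k(2)])
    have "\<forall>\<^sub>F z in at z0. (deriv u z)^2 / poly Q (u z) = (k2 z)^2 / (k z ^ 4 * (poly Q (u z) / u z ^ 4))"
      using u du nz kn unz
    proof eventually_elim
      case (elim z)
      have uz: "u z = k z / (z - z0)" using elim(1) t n by (simp add: power_int_minus field_simps)
      have duz: "deriv u z = k2 z / (z - z0)^2" using elim(2) n by (simp add: power_int_minus field_simps)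
      define e where "e = z - z0"
      have e: "e \<noteq> 0" using elim by (simp add: e_def)
      have u4: "u z ^ 4 = k z ^ 4 / e ^ 4" unfolding uz e_def by (simp add: power_divide)
      have d2: "(deriv u z)^2 = (k2 z)^2 / e ^ 4" unfolding duz e_def by (simp add: power_divide flip: power_mult)
      show ?case unfolding u4 d2 using e elim(4) by simp
    qed
    ultimately have lim: "((\<lambda>z. (deriv u z)^2 / poly Q (u z)) \<longlongrightarrow> l) (at z0)"
      by (rule tendsto_cong[THEN iffD2, rotated])
    have "l \<noteq> 0" using k k20 lcQ by (simp add: l_def)
    moreover have False if "(u \<longlongrightarrow> t) (at z0)" for t
      using not_tendsto_and_filterlim_at_infinity[OF trivial_limit_at that uinf] .
    ultimately show ?thesis using that[of l] lim by blast
  next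
    case False
    define j where "j = nat n"
    have j: "j > 0" "n = int j" using False n0 by (auto simp: j_def)
    have u': "\<forall>\<^sub>F z in at z0. u z = t + k z * (z - z0) ^ j" using u by (simp add: j)
    have du': "\<forall>\<^sub>F z in at z0. deriv u z = k2 z * (z - z0) ^ (j - 1)"
      using du j by (simp add: of_nat_diff power_int_def nat_diff_distrib)
    have "((\<lambda>z. t + k z * (z - z0) ^ j) \<longlongrightarrow> t + k z0 * 0 ^ j) (at z0)" by (intro tendsto_intros kl ez)
    then have ul: "(u \<longlongrightarrow> t) (at z0)" using tendsto_cong[OF u'] j by (simp add: power_0_left)
    have ut: "t' = t" if "(u \<longlongrightarrow> t') (at z0)" for t' using tendsto_unique[OF trivial_limit_at that ul] .
    show ?thesis
    proof (cases "poly Q t = 0")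
      case nQ: False
      have "((\<lambda>z. poly P (u z) / poly Q (u z)) \<longlongrightarrow> poly P t / poly Q t) (at z0)"
        by (intro tendsto_intros ul nQ)
      from finite_case[OF this] j have j1: "j = 1" by auto
      have "((\<lambda>z. (k2 z)^2 / poly Q (u z)) \<longlongrightarrow> (k2 z0)^2 / poly Q t) (at z0)"
        by (intro tendsto_intros kl ul nQ)
      moreover have "\<forall>\<^sub>F z in at z0. (deriv u z)^2 / poly Q (u z) = (k2 z)^2 / poly Q (u z)"
        using du' by eventually_elim (simp add: j1)
      ultimately have "((\<lambda>z. (deriv u z)^2 / poly Q (u z)) \<longlongrightarrow> (k2 z0)^2 / poly Q t) (at z0)"
        by (rule tendsto_cong[THEN iffD2, rotated])
      moreover have "(k2 z0)^2 / poly Q t \<noteq> 0" using k20 nQ by simp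
      ultimately show ?thesis using that[of "(k2 z0)^2 / poly Q t"] ut nQ by blast
    next
      case True
      obtain Q1 where Q1: "Q = [:-t, 1:] * Q1" using True poly_eq_0_iff_dvd by (metis dvdE)
      have dQ: "poly (pderiv Q) t = poly Q1 t" unfolding Q1 pderiv_mult poly_add poly_mult by (simp add: pderiv_pCons)
      have Q1t: "poly Q1 t \<noteq> 0" using simple[OF True] dQ by simp
      have Qu: "\<forall>\<^sub>F z in at z0. poly Q (u z) = k z * (z - z0) ^ j * poly Q1 (u z)"
      proof -
        have QQ: "poly Q x = (x - t) * poly Q1 x" for x unfolding Q1 poly_mult by simp
        show ?thesis using u' by eventually_elim (simp add: QQ)
      qed
      define \<rho> where "\<rho> = poly P t / (k z0 * poly Q1 t)"
      have \<rho>0: "\<rho> \<noteq> 0" using cop[OF True] k Q1t by (simp add: \<rho>_def)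
      have "((\<lambda>z. poly P (u z) / (k z * poly Q1 (u z))) \<longlongrightarrow> \<rho>) (at z0)"
        unfolding \<rho>_def using k Q1t by (intro tendsto_intros kl ul) auto
      moreover have "\<forall>\<^sub>F z in at z0. (z - z0) ^ j * Schwarzian u z = poly P (u z) / (k z * poly Q1 (u z))"
        using solz Qu nz by eventually_elim simp
      ultimately have Sj: "((\<lambda>z. (z - z0) ^ j * Schwarzian u z) \<longlongrightarrow> \<rho>) (at z0)"
        by (rule tendsto_cong[THEN iffD2, rotated])
      have j1: "j \<noteq> 1"
      proof
        assume "j = 1"
        then obtain c where "(Schwarzian u \<longlongrightarrow> c) (at z0)" using S(2) j by auto
        from tendsto_power_times_finite[OF this j(1)] show False
          using Sj \<rho>0 tendsto_unique[OF trivial_limit_at] by blast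
      qed
      have j2: "\<not> j > 2"
      proof
        assume "j > 2"
        then have "((\<lambda>z. (z - z0) ^ (j - 2) * ((z - z0)^2 * Schwarzian u z)) \<longlongrightarrow> 0) (at z0)"
          by (intro tendsto_power_times_finite[OF S(1)]) simp
        moreover have "(z - z0) ^ (j - 2) * ((z - z0)^2 * Schwarzian u z) = (z - z0) ^ j * Schwarzian u z" for z
        proof -
          have "(z - z0) ^ (j - 2) * (z - z0)^2 = (z - z0) ^ j"
            using le_add_diff_inverse2[OF less_imp_le[OF \<open>j > 2\<close>]] by (simp only: power_add[symmetric])
          then show ?thesis by (simp only: mult.assoc[symmetric])
        qed
        ultimately have "((\<lambda>z. (z - z0) ^ j * Schwarzian u z) \<longlongrightarrow> 0) (at z0)" by simp
        then show False using Sj \<rho>0 tendsto_unique[OF trivial_limit_at] by blast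
      qed
      have jj: "j = 2" using j1 j2 j(1) by linarith
      then have nn: "n = 2" using j by simp
      have "\<rho> = - 3 / 2" using tendsto_unique[OF trivial_limit_at Sj] S(1) by (simp add: jj nn)
      then have k0: "k z0 = - 2 * poly P t / (3 * poly Q1 t)" using k Q1t by (simp add: \<rho>_def field_simps)
      have "((\<lambda>z. (k2 z)^2 / (k z * poly Q1 (u z))) \<longlongrightarrow> (k2 z0)^2 / (k z0 * poly Q1 t)) (at z0)"
        using k Q1t by (intro tendsto_intros kl ul) auto
      moreover have "\<forall>\<^sub>F z in at z0. (deriv u z)^2 / poly Q (u z) = (k2 z)^2 / (k z * poly Q1 (u z))"
        using du' Qu nz by eventually_elim (simp add: jj power2_eq_square)
      ultimately have lim: "((\<lambda>z. (deriv u z)^2 / poly Q (u z)) \<longlongrightarrow> (k2 z0)^2 / (k z0 * poly Q1 t)) (at z0)"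
        by (rule tendsto_cong[THEN iffD2, rotated])
      have "(k2 z0)^2 / (k z0 * poly Q1 t) = 4 * k z0 / poly Q1 t"
        using k Q1t by (simp add: k20 nn power2_eq_square)
      also have "\<dots> = - 8 * poly P t / (3 * (poly (pderiv Q) t)^2)" unfolding dQ k0 using Q1t by (simp add: power2_eq_square)
      finally have val: "(k2 z0)^2 / (k z0 * poly Q1 t) = - 8 * poly P t / (3 * (poly (pderiv Q) t)^2)" .
      have "(k2 z0)^2 / (k z0 * poly Q1 t) \<noteq> 0" using k20 k Q1t by simp
      then show ?thesis using that[OF _ lim] val ut by blast
    qed
  qed
qed

text \<open>The argument of Bloch's theorem. Maximizing (1 - |z - z0|) |h'(z)| yields a disc of some radius s
around a point a with |h'(z0)| at most 2 s |h'(a)|, on which |h'| is at most 2 |h'(a)|. On the disc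
around a of radius s/8, |h'| is at least |h'(a)|/2, and the image of that disc contains a disc of
radius proportional to s |h'(a)|. Either this radius is less than R, which bounds |h'(z0)|, or the
image meets N, and kappa bounds |h'(a)|/2.\<close>
lemma bounded_deriv_if_bounded_over_net:
  assumes h: "h holomorphic_on UNIV" and R: "\<And>w. \<exists>p\<in>N. dist w p < R"
    and \<kappa>: "\<And>z. h z \<in> N \<Longrightarrow> norm (deriv h z) \<le> \<kappa>"
  obtains B where "\<And>z. norm (deriv h z) \<le> B"
proof -
  let ?g = "deriv h"
  have gh: "?g holomorphic_on UNIV" using h by (intro holomorphic_deriv) auto
  define c where "c = 3 - 2 * sqrt (2::real)"
  have "sqrt 2 < 3/2" by (rule real_less_lsqrt) (auto simp: power2_eq_square)
  then have c: "c > 0" by (simp add: c_def)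
  have "norm (?g z0) \<le> max (2 * \<kappa>) (16 * R / c)" for z0
  proof (cases "?g z0 = 0")
    case True
    have "R > 0" using R[of 0] zero_le_dist le_less_trans by blast
    then have "0 \<le> 16 * R / c" using c by simp
    then show ?thesis using True by simp
  next
    case False
    \<comment> \<open>The weight vanishes on the boundary of the unit disc around z0, which forces the maximum inside.\<close>
    define \<phi> where "\<phi> = (\<lambda>z. (1 - norm (z - z0)) * norm (?g z))"
    have "continuous_on (cball z0 1) \<phi>" unfolding \<phi>_def
      by (intro continuous_intros holomorphic_on_imp_continuous_on[OF holomorphic_on_subset[OF gh]]) auto
    then obtain a where a: "a \<in> cball z0 1" "\<And>z. z \<in> cball z0 1 \<Longrightarrow> \<phi> z \<le> \<phi> a"
      using continuous_attains_sup[of "cball z0 1" \<phi>] by auto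
    have \<phi>a: "norm (?g z0) \<le> \<phi> a" using a(2)[of z0] by (simp add: \<phi>_def)
    then have \<phi>p: "\<phi> a > 0" using False by (meson less_le_trans zero_less_norm_iff)
    define s where "s = (1 - norm (a - z0)) / 2"
    have s2: "\<phi> a = 2 * s * norm (?g a)" by (simp add: \<phi>_def s_def)
    have s: "s > 0" "s \<le> 1/2"
    proof -
      have "1 - norm (a - z0) \<ge> 0" using a(1) by (simp add: dist_norm norm_minus_commute)
      moreover have "1 - norm (a - z0) \<noteq> 0" using \<phi>p by (auto simp: \<phi>_def)
      ultimately show "s > 0" by (simp add: s_def)
      show "s \<le> 1/2" by (simp add: s_def)
    qed
    have ga: "norm (?g a) > 0" using \<phi>p s2 s by (metis mult_eq_0_iff norm_eq_zero order_less_irrefl zero_less_norm_iff)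
    have near: "norm (?g z) \<le> 2 * norm (?g a)" if z: "norm (z - a) \<le> s" for z
    proof -
      have nz: "norm (z - z0) \<le> norm (z - a) + norm (a - z0)" using norm_triangle_ineq[of "z - a" "a - z0"] by simp
      then have sz: "s \<le> 1 - norm (z - z0)" using z by (simp add: s_def field_simps)
      then have "z \<in> cball z0 1" using s by (simp add: dist_norm norm_minus_commute)
      then have "\<phi> z \<le> 2 * s * norm (?g a)" using a(2) s2 by simp
      moreover have "s * norm (?g z) \<le> \<phi> z" unfolding \<phi>_def using sz by (intro mult_right_mono) auto
      ultimately have "s * norm (?g z) \<le> s * (2 * norm (?g a))" by simp
      then show ?thesis using s by simp
    qed
    have dg: "norm (deriv ?g z) \<le> 4 * norm (?g a) / s" if z: "z \<in> ball a (s/2)" for z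
    proof -
      have "norm ((deriv ^^ 1) ?g z) \<le> fact 1 * (2 * norm (?g a)) / (s/2) ^ 1"
      proof (rule Cauchy_inequality)
        show "?g holomorphic_on ball z (s/2)" by (rule holomorphic_on_subset[OF gh]) simp
        show "continuous_on (cball z (s/2)) ?g"
          by (rule holomorphic_on_imp_continuous_on[OF holomorphic_on_subset[OF gh]]) simp
        fix x assume x: "norm (z - x) = s/2"
        have "norm (x - a) \<le> norm (x - z) + norm (z - a)" using norm_triangle_ineq[of "x - z" "z - a"] by simp
        then show "norm (?g x) \<le> 2 * norm (?g a)" using x z by (intro near) (simp add: dist_norm norm_minus_commute)
      qed (use s in simp)
      then show ?thesis by simp
    qed
    have half: "norm (?g z) \<ge> norm (?g a) / 2" if z: "z \<in> ball a (s/8)" for z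
    proof -
      have "norm (?g z - ?g a) \<le> 4 * norm (?g a) / s * norm (z - a)"
      proof (rule field_differentiable_bound[of "ball a (s/2)"])
        show "(?g has_field_derivative deriv ?g x) (at x within ball a (s/2))" for x
          using holomorphic_derivI[OF gh open_UNIV UNIV_I] has_field_derivative_at_within by blast
      qed (use dg z s in auto)
      also have "\<dots> \<le> 4 * norm (?g a) / s * (s/8)"
        using z s by (intro mult_left_mono) (auto simp: dist_norm norm_minus_commute)
      also have "\<dots> = norm (?g a) / 2" using s by simp
      finally show ?thesis using norm_triangle_ineq2[of "?g a" "?g a - ?g z"] norm_minus_commute[of "?g z" "?g a"] by simp
    qed
    have bl: "ball (h a) (c * (s/8) * norm (?g a)) \<subseteq> h ` ball a (s/8)"
      unfolding c_def
    proof (rule Bloch_lemma)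
      show "h holomorphic_on cball a (s/8)" by (rule holomorphic_on_subset[OF h]) simp
      show "norm (?g z) \<le> 2 * norm (?g a)" if "z \<in> ball a (s/8)" for z
        using that s by (intro near) (simp add: dist_norm norm_minus_commute)
    qed (use s in simp)
    show ?thesis
    proof (cases "R \<le> c * (s/8) * norm (?g a)")
      case True
      obtain p where p: "p \<in> N" "dist (h a) p < R" using R by blast
      then have "p \<in> h ` ball a (s/8)" using bl True by auto
      then obtain z where z: "z \<in> ball a (s/8)" "p = h z" by blast
      have "norm (?g a) \<le> 2 * \<kappa>" using half[OF z(1)] \<kappa>[of z] p(1) z(2) by simp
      moreover have "2 * s * norm (?g a) \<le> 1 * norm (?g a)" using s by (intro mult_right_mono) auto
      ultimately show ?thesis using \<phi>a s2 by simp
    next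
      case False
      then have "2 * s * norm (?g a) \<le> 16 * R / c" using c by (simp add: field_simps)
      then show ?thesis using \<phi>a s2 by simp
    qed
  qed
  then show ?thesis using that by blast
qed

section \<open>The first integral\<close>
lemma poly_zero_if_vanishes_cosparse:
  fixes p :: "complex poly"
  assumes m: "u meromorphic_on UNIV" and nc: "\<not> (\<exists>k. \<forall>\<^sub>\<approx>z. u z = k)" and p: "\<forall>\<^sub>\<approx>z. poly p (u z) = 0"
  shows "p = 0"
proof (rule ccontr)
  assume "p \<noteq> 0"
  then have "finite {x. poly p x = 0}" by (rule poly_roots_finite)
  moreover have "\<forall>\<^sub>\<approx>z. u z \<noteq> x" for x
    using meromorphic_imp_constant_or_avoid[OF m open_UNIV connected_UNIV, of x] nc by blast
  ultimately have "\<forall>\<^sub>\<approx>z. \<forall>x\<in>{x. poly p x = 0}. u z \<noteq> x" by (intro eventually_ball_finite) auto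
  with p have "\<forall>\<^sub>\<approx>z::complex. False" by eventually_elim auto
  then show False by (rule cosparse_ex) simp
qed

text \<open>The arguments s1, s2, s3 of the following three functions are the elementary symmetric functions of
the differences a - t_j. They are the coefficients for which x = d - b/(u - a) satisfies
x'^2 = 4 x^3 - g2 x - g3 when u'^2 = K Q(u) and b = - K s3/4. The shift d removes the quadratic term
of the cubic.\<close>
definition wp_shift_param :: "complex \<Rightarrow> complex \<Rightarrow> complex \<Rightarrow> complex \<Rightarrow> complex" where
  "wp_shift_param b s1 s2 s3 = - b * s2 / (3 * s3)"

definition wp_g2_param :: "complex \<Rightarrow> complex \<Rightarrow> complex \<Rightarrow> complex \<Rightarrow> complex" where
  "wp_g2_param b s1 s2 s3 = 4 * b^2 / (3 * s3^2) * (s2^2 - 3 * s1 * s3)"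

definition wp_g3_param :: "complex \<Rightarrow> complex \<Rightarrow> complex \<Rightarrow> complex \<Rightarrow> complex" where
  "wp_g3_param b s1 s2 s3 = 4 * b^3 / (27 * s3^3) * (2 * s2^3 - 9 * s1 * s2 * s3 + 27 * s3^2)"

text \<open>The right-hand side is Q(u)/(u - a)^4 up to a constant, as a polynomial in w = 1/(u - a).\<close>
lemma cubic_of_inverted_quartic:
  fixes b w s1 s2 s3 :: complex
  assumes "s3 \<noteq> 0"
  defines "x \<equiv> wp_shift_param b s1 s2 s3 - b * w"
  shows "4 * x^3 - wp_g2_param b s1 s2 s3 * x - wp_g3_param b s1 s2 s3 = - 4 * b^3 / s3 * (1 + s1 * w + s2 * w^2 + s3 * w^3)"
proof -
  define s m where "s = s2 / (3 * s3)" and "m = 1 / s3"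
  have sm: "s3 * m = 1" using assms by (simp add: m_def)
  have s2: "s2 = 3 * s * s3" using assms by (simp add: s_def)
  have d: "wp_shift_param b s1 s2 s3 = - b * s" by (simp add: wp_shift_param_def s_def)
  have g2: "wp_g2_param b s1 s2 s3 = 4 * b^2 * (3 * s^2 - s1 * m)"
    unfolding wp_g2_param_def s2 m_def using assms by (simp add: field_simps power2_eq_square)
  have g3: "wp_g3_param b s1 s2 s3 = 4 * b^3 * (2 * s^3 - s1 * s * m + m)"
    unfolding wp_g3_param_def s2 m_def using assms by (simp add: field_simps power2_eq_square power3_eq_cube)
  have "- 4 * b^3 / s3 * (1 + s1 * w + s2 * w^2 + s3 * w^3) = - 4 * b^3 * (m + m * s1 * w + 3 * s * w^2 + w^3)"
    unfolding s2 m_def using assms by (simp add: field_simps power2_eq_square power3_eq_cube)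
  then show ?thesis unfolding x_def d g2 g3 by (simp add: algebra_simps power2_eq_square power3_eq_cube)
qed

text \<open>The classical formula for the discriminant of a cubic in terms of its coefficients, applied to the
monic cubic with roots A1, A2, A3.\<close>
lemma wp_param_discriminant:
  fixes b A1 A2 A3 :: complex
  defines "s1 \<equiv> A1 + A2 + A3" and "s2 \<equiv> A1 * A2 + A1 * A3 + A2 * A3" and "s3 \<equiv> A1 * A2 * A3"
  assumes s3: "s3 \<noteq> 0"
  shows "wp_g2_param b s1 s2 s3 ^ 3 - 27 * wp_g3_param b s1 s2 s3 ^ 2 =
    16 * b^6 / s3^6 * (s3^2 * ((A1 - A2) * (A1 - A3) * (A2 - A3))^2)"
proof -
  have D: "((A1 - A2) * (A1 - A3) * (A2 - A3))^2 = s1^2 * s2^2 - 4 * s2^3 - 4 * s1^3 * s3 + 18 * s1 * s2 * s3 - 27 * s3^2"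
    unfolding s1_def s2_def s3_def by (simp add: algebra_simps power2_eq_square power3_eq_cube)
  have E: "4 * (s2^2 - 3 * s1 * s3)^3 - (2 * s2^3 - 9 * s1 * s2 * s3 + 27 * s3^2)^2
     = 27 * s3^2 * (s1^2 * s2^2 - 4 * s2^3 - 4 * s1^3 * s3 + 18 * s1 * s2 * s3 - 27 * s3^2)"
    by (simp add: algebra_simps power2_eq_square power3_eq_cube)
  have "wp_g2_param b s1 s2 s3 ^ 3 - 27 * wp_g3_param b s1 s2 s3 ^ 2
    = 16 * b^6 / (27 * s3^6) * (4 * (s2^2 - 3 * s1 * s3)^3 - (2 * s2^3 - 9 * s1 * s2 * s3 + 27 * s3^2)^2)"
    unfolding wp_g2_param_def wp_g3_param_def power_mult_distrib power_divide
    by (simp add: right_diff_distrib mult.assoc flip: power_mult)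
  then show ?thesis unfolding E D by simp
qed

lemma wp_form_first_integral:
  fixes a t1 t2 t3 b :: complex
  defines "s1 \<equiv> (a - t1) + (a - t2) + (a - t3)"
    and "s2 \<equiv> (a - t1) * (a - t2) + (a - t1) * (a - t3) + (a - t2) * (a - t3)"
    and "s3 \<equiv> (a - t1) * (a - t2) * (a - t3)"
  assumes s3: "s3 \<noteq> 0" and b: "b \<noteq> 0" and u: "u \<noteq> a"
  defines "x \<equiv> wp_shift_param b s1 s2 s3 - b / (u - a)"
  shows "4 * x^3 - wp_g2_param b s1 s2 s3 * x - wp_g3_param b s1 s2 s3
    = (- 4 * b / s3) * ((u - a) * (u - t1) * (u - t2) * (u - t3)) * (b / (u - a)^2)^2"
proof -
  define w where "w = 1 / (u - a)"
  have x: "x = wp_shift_param b s1 s2 s3 - b * w" by (simp add: x_def w_def)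
  have f: "u - t = (u - a) * (1 + (a - t) * w)" for t using u by (simp add: w_def field_simps)
  have "(u - a) * (u - t1) * (u - t2) * (u - t3) = (u - a)^4 * ((1 + (a - t1) * w) * (1 + (a - t2) * w) * (1 + (a - t3) * w))"
    unfolding f[of t1] f[of t2] f[of t3] by (simp add: power_numeral_reduce)
  also have "(1 + (a - t1) * w) * (1 + (a - t2) * w) * (1 + (a - t3) * w) = 1 + s1 * w + s2 * w^2 + s3 * w^3"
    unfolding s1_def s2_def s3_def by (simp add: algebra_simps power2_eq_square power3_eq_cube)
  finally have q: "(u - a) * (u - t1) * (u - t2) * (u - t3) = (u - a)^4 * (1 + s1 * w + s2 * w^2 + s3 * w^3)" .
  have sq: "(u - a)^4 * (b / (u - a)^2)^2 = b^2" using u by (simp add: power_divide flip: power_mult)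
  have "(- 4 * b / s3) * ((u - a) * (u - t1) * (u - t2) * (u - t3)) * (b / (u - a)^2)^2
     = (- 4 * b / s3) * (1 + s1 * w + s2 * w^2 + s3 * w^3) * ((u - a)^4 * (b / (u - a)^2)^2)"
    unfolding q by (simp only: mult_ac)
  also have "\<dots> = - 4 * b^3 / s3 * (1 + s1 * w + s2 * w^2 + s3 * w^3)"
    unfolding sq by (simp add: power2_eq_square power3_eq_cube)
  finally show ?thesis unfolding x cubic_of_inverted_quartic[OF s3] by (rule sym)
qed

text \<open>The Moebius map that sends a to infinity normalizes the quartic to a Weierstrass cubic. The factor
v is h'^2 as long as u'^2/Q(u) is not known to be constant, and 1 afterwards.\<close>
lemma inverted_solution_ode:
  fixes a t1 t2 t3 b :: complex
  defines "s1 \<equiv> (a - t1) + (a - t2) + (a - t3)"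
    and "s2 \<equiv> (a - t1) * (a - t2) + (a - t1) * (a - t3) + (a - t2) * (a - t3)"
    and "s3 \<equiv> (a - t1) * (a - t2) * (a - t3)"
  assumes s3: "s3 \<noteq> 0" and b: "b \<noteq> 0"
    and m: "u meromorphic_on UNIV" and nc: "\<not> (\<exists>k. \<forall>\<^sub>\<approx>z. u z = k)"
    and ode: "\<forall>\<^sub>\<approx>z. (deriv u z)^2 = v z * (- 4 * b / s3) * ((u z - a) * (u z - t1) * (u z - t2) * (u z - t3))"
  defines "y \<equiv> (\<lambda>z. wp_shift_param b s1 s2 s3 - b / (u z - a))"
  shows "y meromorphic_on UNIV" "\<not> (\<exists>k. \<forall>\<^sub>\<approx>z. y z = k)"
    "\<forall>\<^sub>\<approx>z. (deriv y z)^2 = v z * (4 * y z^3 - wp_g2_param b s1 s2 s3 * y z - wp_g3_param b s1 s2 s3)"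
proof -
  let ?d = "wp_shift_param b s1 s2 s3"
  show "y meromorphic_on UNIV" unfolding y_def using m by (intro meromorphic_intros)
  have inv: "u z = a + b / (?d - y z)" for z unfolding y_def using b by (cases "u z = a") auto
  show "\<not> (\<exists>k. \<forall>\<^sub>\<approx>z. y z = k)"
  proof
    assume "\<exists>k. \<forall>\<^sub>\<approx>z. y z = k"
    then obtain k where "\<forall>\<^sub>\<approx>z. y z = k" by blast
    then have "\<forall>\<^sub>\<approx>z. u z = a + b / (?d - k)" by eventually_elim (use inv in simp)
    then show False using nc by blast
  qed
  have "\<forall>\<^sub>\<approx>z. u z \<noteq> a"
    using meromorphic_imp_constant_or_avoid[OF m open_UNIV connected_UNIV, of a] nc by blast
  with ode meromorphic_on_imp_analytic_cosparse[OF m]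
  show "\<forall>\<^sub>\<approx>z. (deriv y z)^2 = v z * (4 * y z^3 - wp_g2_param b s1 s2 s3 * y z - wp_g3_param b s1 s2 s3)"
  proof eventually_elim
    case (elim z)
    have ua: "u z - a \<noteq> 0" using elim by simp
    have d: "(u has_field_derivative deriv u z) (at z)" using elim analytic_derivI by blast
    have "(y has_field_derivative deriv u z * (b / (u z - a)^2)) (at z)"
      unfolding y_def using ua by (auto intro!: derivative_eq_intros d simp: power2_eq_square)
    then have "deriv y z = deriv u z * (b / (u z - a)^2)" by (rule DERIV_imp_deriv)
    then have "(deriv y z)^2 = (deriv u z)^2 * (b / (u z - a)^2)^2" by (simp only: power_mult_distrib)
    also have "\<dots> = v z * ((- 4 * b / s3) * ((u z - a) * (u z - t1) * (u z - t2) * (u z - t3)) * (b / (u z - a)^2)^2)"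
      unfolding elim(1) by (simp only: mult.assoc)
    also have "\<dots> = v z * (4 * y z^3 - wp_g2_param b s1 s2 s3 * y z - wp_g3_param b s1 s2 s3)"
      unfolding y_def s1_def s2_def s3_def
      using wp_form_first_integral[of a t1 t2 t3 b "u z"] s3 b ua unfolding s3_def by simp
    finally show ?case .
  qed
qed

lemma wp_param_discriminant_nonzero:
  fixes a t1 t2 t3 b :: complex
  defines "s1 \<equiv> (a - t1) + (a - t2) + (a - t3)"
    and "s2 \<equiv> (a - t1) * (a - t2) + (a - t1) * (a - t3) + (a - t2) * (a - t3)"
    and "s3 \<equiv> (a - t1) * (a - t2) * (a - t3)"
  assumes "distinct [a, t1, t2, t3]" and b: "b \<noteq> 0"
  shows "wp_g2_param b s1 s2 s3 ^ 3 - 27 * wp_g3_param b s1 s2 s3 ^ 2 \<noteq> 0"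
proof -
  have "s3 \<noteq> 0" using assms by (auto simp: s3_def)
  then show ?thesis
    unfolding s1_def s2_def s3_def using assms by (subst wp_param_discriminant) auto
qed

lemma filterlim_at_of_nonzero_deriv:
  fixes h :: "complex \<Rightarrow> complex"
  assumes d: "(h has_field_derivative D) (at z)" and D: "D \<noteq> 0"
  shows "filterlim h (at (h z)) (at z)"
proof -
  have "((\<lambda>w. (h w - h z) / (w - z)) \<longlongrightarrow> D) (at z)" using d by (simp add: has_field_derivative_iff)
  from tendsto_imp_eventually_ne[OF this D] have "\<forall>\<^sub>F w in at z. h w \<noteq> h z" by eventually_elim auto
  moreover have "(h \<longlongrightarrow> h z) (at z)" using DERIV_isCont[OF d] by (simp add: isCont_def)
  ultimately show ?thesis by (simp add: filterlim_at)
qed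

text \<open>The quotient u'^2/Q(u) extends to an entire function v0 = h'^2 without zeros, which has the same value
at all points where u = a. Sending a to infinity makes these the points where h + zeta meets a
lattice, so that h' is bounded there, hence everywhere. The form of P follows by comparing with the
Schwarzian derivative along u'^2 = K Q(u).\<close>
theorem Schwarzian_first_integral:
  fixes a t1 t2 t3 :: complex and P Q :: "complex poly"
  assumes dist: "distinct [a, t1, t2, t3]"
    and Q: "Q = [:- a, 1:] * [:- t1, 1:] * [:- t2, 1:] * [:- t3, 1:]"
    and degP: "degree P = 4" and cop: "\<And>t. poly Q t = 0 \<Longrightarrow> poly P t \<noteq> 0"
    and m: "u meromorphic_on UNIV" and nc: "\<not> (\<exists>k. \<forall>\<^sub>\<approx>z. u z = k)"
    and sol: "\<forall>\<^sub>\<approx>z. Schwarzian u z = poly P (u z) / poly Q (u z)"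
  obtains K where "K \<noteq> 0" "\<forall>\<^sub>\<approx>z. (deriv u z)^2 = K * poly Q (u z)" "P = smult (K / 8) (schwarz_quartic Q)"
proof -
  have Qx: "poly Q x = (x - a) * (x - t1) * (x - t2) * (x - t3)" for x by (simp add: Q algebra_simps)
  have degQ: "degree Q = 4" by (simp add: Q)
  have simple: "poly (pderiv Q) t \<noteq> 0" if "poly Q t = 0" for t
  proof -
    have "t = a \<or> t = t1 \<or> t = t2 \<or> t = t3" using that by (auto simp: Qx)
    moreover have "poly (pderiv Q) x = (x - t1) * (x - t2) * (x - t3) + (x - a) * (x - t2) * (x - t3)
        + (x - a) * (x - t1) * (x - t3) + (x - a) * (x - t1) * (x - t2)" for x
      unfolding Q pderiv_mult poly_add poly_mult by (simp add: pderiv_pCons algebra_simps)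
    ultimately show ?thesis using dist by auto
  qed
  define v where "v = (\<lambda>z. (deriv u z)^2 / poly Q (u z))"
  have vm: "v meromorphic_on UNIV" unfolding v_def poly_altdef using m by (intro meromorphic_intros)
  define v0 where "v0 = remove_sings v"
  define \<kappa> where "\<kappa> = - 8 * poly P a / (3 * (poly (pderiv Q) a)^2)"
  have loc: "v0 analytic_on {z} \<and> v0 z \<noteq> 0 \<and> ((u \<longlongrightarrow> a) (at z) \<longrightarrow> v0 z = \<kappa>)" for z
  proof (rule Schwarzian_solution_first_integral_local[OF m nc sol degQ degP simple cop, where ?z0.0 = z])
    fix l assume l: "l \<noteq> 0" "((\<lambda>z. (deriv u z)^2 / poly Q (u z)) \<longlongrightarrow> l) (at z)"
      "\<And>t. poly Q t = 0 \<Longrightarrow> (u \<longlongrightarrow> t) (at z) \<Longrightarrow> l = - 8 * poly P t / (3 * (poly (pderiv Q) t)^2)"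
    have vl: "(v \<longlongrightarrow> l) (at z)" using l(2) by (simp add: v_def)
    have iso: "isolated_singularity_at v z" by (rule meromorphic_on_isolated_singularity, rule meromorphic_on_subset[OF vm]) simp
    have "v0 z = l" unfolding v0_def by (rule remove_sings_eqI[OF vl])
    then show "v0 analytic_on {z} \<and> v0 z \<noteq> 0 \<and> ((u \<longlongrightarrow> a) (at z) \<longrightarrow> v0 z = \<kappa>)"
      using remove_sings_analytic_at[OF iso vl] l(1) l(3)[of a] by (auto simp: v0_def \<kappa>_def Qx)
  qed
  have "v0 analytic_on {z}" for z using loc[of z] by simp
  then have "v0 analytic_on UNIV" using analytic_on_analytic_at by blast
  then have v0h: "v0 holomorphic_on UNIV" by (rule analytic_imp_holomorphic)
  have "\<forall>\<^sub>\<approx>z. v0 z = v z" unfolding v0_def by (rule eventually_remove_sings_eq[OF vm])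
  then have uode: "\<forall>\<^sub>\<approx>z. poly Q (u z) \<noteq> 0 \<and> (deriv u z)^2 = v0 z * poly Q (u z)"
  proof eventually_elim
    case (elim z)
    then have "v z \<noteq> 0" using loc[of z] by simp
    then have "poly Q (u z) \<noteq> 0" by (auto simp: v_def)
    then show ?case using elim by (simp add: v_def)
  qed
  \<comment> \<open>An entire h with h'^2 = v0 exists, since v0 is entire without zeros.\<close>
  have "\<exists>g. g holomorphic_on UNIV \<and> (\<forall>z. exp (g z) = v0 z)"
  proof (rule holomorphic_logarithm_exists[OF convex_UNIV open_UNIV v0h _ UNIV_I[of 0]])
    show "v0 x \<noteq> 0" for x using loc[of x] by simp
    fix g assume "g holomorphic_on UNIV" "\<And>x. x \<in> UNIV \<Longrightarrow> exp (g x) = v0 x"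
    then show "\<exists>g. g holomorphic_on UNIV \<and> (\<forall>z. exp (g z) = v0 z)" by auto
  qed
  then obtain g where g: "g holomorphic_on UNIV" "\<And>z. exp (g z) = v0 z" by blast
  have eh: "(\<lambda>z. exp (g z / 2)) holomorphic_on UNIV" using g(1) by (intro holomorphic_intros) auto
  have "\<exists>h. \<forall>z. (h has_field_derivative exp (g z / 2)) (at z)"
  proof (rule holomorphic_convex_primitive'[OF convex_UNIV open_UNIV eh])
    fix h assume "\<And>z. z \<in> UNIV \<Longrightarrow> (h has_field_derivative exp (g z / 2)) (at z within UNIV)"
    then show "\<exists>h. \<forall>z. (h has_field_derivative exp (g z / 2)) (at z)" by auto
  qed
  then obtain h where h: "\<And>z. (h has_field_derivative exp (g z / 2)) (at z)" by blast
  have hh: "h holomorphic_on UNIV" using h by (meson field_differentiable_at_within field_differentiable_def holomorphic_onI)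
  have dh: "deriv h z = exp (g z / 2)" for z using h by (rule DERIV_imp_deriv)
  have dh2: "(deriv h z)^2 = v0 z" for z
    unfolding dh g(2)[symmetric] by (simp flip: exp_double)
  define s1 s2 s3 where "s1 = (a - t1) + (a - t2) + (a - t3)"
    and "s2 = (a - t1) * (a - t2) + (a - t1) * (a - t3) + (a - t2) * (a - t3)"
    and "s3 = (a - t1) * (a - t2) * (a - t3)"
  have s3: "s3 \<noteq> 0" using dist by (auto simp: s3_def)
  \<comment> \<open>This choice normalizes K to 1, so that the factor v0 alone remains in the equation for y.\<close>
  define b where "b = - s3 / 4"
  have b: "b \<noteq> 0" "- 4 * b / s3 = 1" using s3 by (auto simp: b_def)
  define d g2 g3 where "d = wp_shift_param b s1 s2 s3" and "g2 = wp_g2_param b s1 s2 s3" and "g3 = wp_g3_param b s1 s2 s3"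
  define y where "y = (\<lambda>z. d - b / (u z - a))"
  have uode': "\<forall>\<^sub>\<approx>z. (deriv u z)^2 = v0 z * (- 4 * b / s3) * ((u z - a) * (u z - t1) * (u z - t2) * (u z - t3))"
    unfolding b(2) using uode by eventually_elim (simp add: Qx)
  note inv = inverted_solution_ode[OF s3[unfolded s3_def] b(1) m nc uode'[unfolded s3_def],
      folded s1_def s2_def s3_def, folded d_def g2_def g3_def, folded y_def]
  have disc: "g2^3 - 27 * g3^2 \<noteq> 0"
    using wp_param_discriminant_nonzero[OF dist b(1)] by (simp add: g2_def g3_def s1_def s2_def s3_def)
  obtain L where L: "is_lattice L" "lattice_g2 L = g2" "lattice_g3 L = g3"
    using uniformization[OF disc] by blast
  have yode: "\<forall>\<^sub>\<approx>z. (deriv y z)^2 = (deriv h z)^2 * (4 * y z^3 - lattice_g2 L * y z - lattice_g3 L)"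
    using inv(3) unfolding dh2 L y_def .
  have ync: "\<not> (\<exists>k. \<forall>\<^sub>\<approx>z. y z = k)" using inv(2) unfolding y_def .
  obtain \<zeta> where \<zeta>: "\<forall>\<^sub>\<approx>z. y z = lattice_wp L (h z + \<zeta>)"
    by (rule lattice_wp_lift[OF L(1) inv(1) ync hh yode])
  \<comment> \<open>There y has a pole, so that u tends to a and v0 takes the value kappa.\<close>
  have at_lattice: "norm (deriv h z) \<le> sqrt (norm \<kappa>)" if z: "h z \<in> {p. p + \<zeta> \<in> L}" for z
  proof -
    have zL: "h z + \<zeta> \<in> L" using z by simp
    have pole: "filterlim (lattice_wp L) at_infinity (at (h z + \<zeta>))"
      using lattice_wp_is_pole_iff[OF L(1)] zL by (simp add: is_pole_def)
    have "((\<lambda>w. h w + \<zeta>) has_field_derivative exp (g z / 2)) (at z)" by (auto intro!: derivative_eq_intros h)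
    from filterlim_compose[OF pole filterlim_at_of_nonzero_deriv[OF this]]
    have "filterlim (\<lambda>w. lattice_wp L (h w + \<zeta>)) at_infinity (at z)" by simp
    then have yinf: "filterlim y at_infinity (at z)"
      using filterlim_cong[OF refl refl eventually_cosparse_imp_eventually_at[OF \<zeta> UNIV_I, of z]] by simp
    have "filterlim (\<lambda>w. - d + y w) at_infinity (at z)"
      by (rule tendsto_add_filterlim_at_infinity[OF tendsto_const yinf])
    then have "((\<lambda>w. inverse (- d + y w)) \<longlongrightarrow> 0) (at z)" using tendsto_inverse_0 filterlim_compose by blast
    then have "((\<lambda>w. a - b * inverse (- d + y w)) \<longlongrightarrow> a - b * 0) (at z)" by (intro tendsto_intros)
    moreover have "a - b * inverse (- d + y w) = u w" for w
      unfolding y_def using b(1) by (cases "u w = a") (auto simp: field_simps)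
    ultimately have "(u \<longlongrightarrow> a) (at z)" by simp
    then have "v0 z = \<kappa>" using loc by blast
    then have "norm (deriv h z) ^ 2 = norm \<kappa>" using dh2[of z] by (metis norm_power)
    then show ?thesis by (metis norm_ge_zero order_refl real_sqrt_unique)
  qed
  obtain R where R: "\<And>z. \<exists>p\<in>L. dist z p < R" using lattice_dense[OF L(1)] by blast
  have net: "\<exists>p\<in>{p. p + \<zeta> \<in> L}. dist w p < R" for w
  proof -
    obtain p where "p \<in> L" "dist (w + \<zeta>) p < R" using R by blast
    then show ?thesis by (intro bexI[of _ "p - \<zeta>"]) (auto simp: dist_norm algebra_simps)
  qed
  obtain B where B: "\<And>z. norm (deriv h z) \<le> B"
    using bounded_deriv_if_bounded_over_net[OF hh net at_lattice] by blast
  have "deriv h holomorphic_on UNIV" using hh by (intro holomorphic_deriv) auto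
  moreover have "bounded (range (deriv h))" using B by (auto simp: bounded_iff)
  ultimately have "deriv h constant_on UNIV" by (rule Liouville_theorem)
  then obtain k where k: "\<And>z. deriv h z = k" by (auto simp: constant_on_def)
  define K where "K = k^2"
  have vK: "v0 z = K" for z using dh2[of z] k by (simp add: K_def)
  have K0: "K \<noteq> 0" using vK[of 0] loc[of 0] by auto
  have uK: "\<forall>\<^sub>\<approx>z. (deriv u z)^2 = K * poly Q (u z)" using uode by eventually_elim (simp add: vK)
  have "\<forall>\<^sub>\<approx>z. poly (P - smult (K / 8) (schwarz_quartic Q)) (u z) = 0"
    using Schwarzian_of_square_ode[OF m nc uK] sol uode
  proof eventually_elim
    case (elim z)
    then have "poly P (u z) / poly Q (u z) = K * poly (schwarz_quartic Q) (u z) / (8 * poly Q (u z))" by simp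
    then show ?case using elim(3) by (simp add: field_simps)
  qed
  from poly_zero_if_vanishes_cosparse[OF m nc this]
  have "P = smult (K / 8) (schwarz_quartic Q)" by simp
  then show ?thesis using that[OF K0 uK] by blast
qed

section \<open>Solutions built from the Weierstrass function\<close>
lemma wp_meromorphic_ode:
  assumes disc: "g2^3 - 27 * g3^2 \<noteq> 0"
  shows "(\<lambda>z. wp g2 g3 (z - z0)) meromorphic_on UNIV" "is_pole (\<lambda>z. wp g2 g3 (z - z0)) z0"
    "\<not> (\<exists>k. \<forall>\<^sub>\<approx>z. wp g2 g3 (z - z0) = k)"
    "\<forall>\<^sub>\<approx>z. (deriv (\<lambda>z. wp g2 g3 (z - z0)) z)^2 = 4 * wp g2 g3 (z - z0)^3 - g2 * wp g2 g3 (z - z0) - g3"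
proof -
  obtain L where L: "is_lattice L" "lattice_g2 L = g2" "lattice_g3 L = g3" "wp g2 g3 = lattice_wp L"
    by (rule wp_eq_lattice_wp[OF disc])
  have ps: "pole_solution g2 g3 (wp g2 g3)" using lattice_wp_pole_solution[OF L(1)] by (simp add: L)
  show "(\<lambda>z. wp g2 g3 (z - z0)) meromorphic_on UNIV"
    using meromorphic_on_affine[OF pole_solutionD(1)[OF ps], of 1 "- z0"] by simp
  show pole: "is_pole (\<lambda>z. wp g2 g3 (z - z0)) z0"
    using is_pole_affine[of "wp g2 g3" 1 z0 "- z0"] pole_solutionD(2)[OF ps] by simp
  show "\<not> (\<exists>k. \<forall>\<^sub>\<approx>z. wp g2 g3 (z - z0) = k)"
  proof
    assume "\<exists>k. \<forall>\<^sub>\<approx>z. wp g2 g3 (z - z0) = k"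
    then obtain k where k: "\<forall>\<^sub>\<approx>z. wp g2 g3 (z - z0) = k" by blast
    have "is_pole (\<lambda>_::complex. k) z0"
      using is_pole_cong[OF eventually_cosparse_imp_eventually_at[OF k UNIV_I] refl] pole by blast
    then show False by simp
  qed
  show "\<forall>\<^sub>\<approx>z. (deriv (\<lambda>z. wp g2 g3 (z - z0)) z)^2 = 4 * wp g2 g3 (z - z0)^3 - g2 * wp g2 g3 (z - z0) - g3"
    using cubic_ode_affine[OF pole_solutionD(1,3)[OF ps], of 1 "- z0"] by simp
qed

lemma wp_form_inverse:
  assumes "b \<noteq> 0" and "u = wp_form a b d g2 g3 z0 z"
  shows "wp g2 g3 (z - z0) = d - b / (u - a)"
  using assms by (cases "wp g2 g3 (z - z0) = d") (auto simp: wp_form_def)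

lemma wp_form_meromorphic:
  assumes disc: "g2^3 - 27 * g3^2 \<noteq> 0"
  shows "wp_form a b d g2 g3 z0 meromorphic_on UNIV"
proof -
  have "(\<lambda>z. a - b / (wp g2 g3 (z - z0) - d)) meromorphic_on UNIV"
    using wp_meromorphic_ode(1)[OF disc] by (intro meromorphic_intros)
  then show ?thesis by (simp add: wp_form_def[abs_def])
qed

lemma wp_form_nonconstant:
  assumes disc: "g2^3 - 27 * g3^2 \<noteq> 0" and b: "b \<noteq> 0"
  shows "\<not> (\<exists>k. \<forall>\<^sub>\<approx>z. wp_form a b d g2 g3 z0 z = k)"
proof
  assume "\<exists>k. \<forall>\<^sub>\<approx>z. wp_form a b d g2 g3 z0 z = k"
  then obtain k where k: "\<forall>\<^sub>\<approx>z. wp_form a b d g2 g3 z0 z = k" by blast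
  have "\<forall>\<^sub>\<approx>z. wp g2 g3 (z - z0) = d - b / (k - a)"
    using k by eventually_elim (use wp_form_inverse[OF b] in blast)
  then show False using wp_meromorphic_ode(3)[OF disc] by blast
qed

lemma wp_form_deriv:
  assumes disc: "g2^3 - 27 * g3^2 \<noteq> 0" and b: "b \<noteq> 0"
  shows "\<forall>\<^sub>\<approx>z. wp_form a b d g2 g3 z0 z \<noteq> a \<and>
    4 * wp g2 g3 (z - z0)^3 - g2 * wp g2 g3 (z - z0) - g3
      = (deriv (wp_form a b d g2 g3 z0) z)^2 * (b / (wp_form a b d g2 g3 z0 z - a)^2)^2"
proof -
  let ?x = "\<lambda>z. wp g2 g3 (z - z0)"
  note wp = wp_meromorphic_ode[OF disc, of z0]
  have "\<forall>\<^sub>\<approx>z. ?x z \<noteq> d"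
    using meromorphic_imp_constant_or_avoid[OF wp(1) open_UNIV connected_UNIV, of d] wp(3) by blast
  with wp(4) meromorphic_on_imp_analytic_cosparse[OF wp(1)] show ?thesis
  proof eventually_elim
    case (elim z)
    have xd: "?x z - d \<noteq> 0" using elim by simp
    have xD: "(?x has_field_derivative deriv ?x z) (at z)" using elim analytic_derivI by blast
    have "((\<lambda>z. a - b / (?x z - d)) has_field_derivative b * deriv ?x z / (?x z - d)^2) (at z)"
      using xd by (auto intro!: derivative_eq_intros xD simp: power2_eq_square)
    then have df: "deriv (wp_form a b d g2 g3 z0) z = b * deriv ?x z / (?x z - d)^2"
      unfolding wp_form_def[abs_def] by (rule DERIV_imp_deriv)
    have fa: "wp_form a b d g2 g3 z0 z - a = - b / (?x z - d)" by (simp add: wp_form_def)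
    have "(deriv (wp_form a b d g2 g3 z0) z) * (b / (wp_form a b d g2 g3 z0 z - a)^2) = deriv ?x z"
    proof -
      have g: "b * D / e^2 * (b / (- b / e)^2) = D" if "e \<noteq> 0" for D e :: complex
        using that b by (simp add: power_divide)  (simp add: power2_eq_square)
      show ?thesis unfolding df fa by (rule g[OF xd])
    qed
    then have "(deriv (wp_form a b d g2 g3 z0) z)^2 * (b / (wp_form a b d g2 g3 z0 z - a)^2)^2 = (deriv ?x z)^2"
      by (simp only: flip: power_mult_distrib)
    moreover have "wp_form a b d g2 g3 z0 z - a \<noteq> 0" unfolding fa using xd b by simp
    ultimately show ?case using elim(1) by simp
  qed
qed

lemma wp_form_elliptic:
  assumes disc: "g2^3 - 27 * g3^2 \<noteq> 0" and m: "u meromorphic_on UNIV" and u: "\<forall>\<^sub>\<approx>z. u z = wp_form a b d g2 g3 z0 z"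
  shows "elliptic u"
proof -
  obtain L where L: "is_lattice L" "wp g2 g3 = lattice_wp L" by (rule wp_eq_lattice_wp[OF disc])
  obtain w1 w2 where I: "Im (w2 / w1) \<noteq> 0" and LL: "L = {of_int m * w1 + of_int n * w2 | m n. True}"
    using L(1) is_lattice_def by auto
  have "of_int 1 * w1 + of_int 0 * w2 \<in> L" "of_int 0 * w1 + of_int 1 * w2 \<in> L" unfolding LL by blast+
  then have w: "w1 \<in> L" "w2 \<in> L" by simp_all
  have "\<forall>\<^sub>\<approx>z. u (z + w) = u z" if "w \<in> L" for w
  proof -
    have "\<forall>\<^sub>\<approx>z. u (1 * z + w) = wp_form a b d g2 g3 z0 (1 * z + w)" by (rule eventually_cosparse_affine[OF u]) simp
    with u show ?thesis
    proof eventually_elim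
      case (elim z)
      have "lattice_wp L (z + w - z0) = lattice_wp L (z - z0)"
        using lattice_wp_periodic[OF L(1) that, of "z - z0"] by (simp add: algebra_simps)
      then show ?case using elim by (simp add: wp_form_def L(2))
    qed
  qed
  then show ?thesis unfolding elliptic_def using m I w by blast
qed

lemma schwarz_quartic_pCons:
  "schwarz_quartic [:e4, - e3, e2, - e1, 1:] =
    [:8 * e2 * e4 - 3 * e3^2, 4 * e2 * e3 - 24 * e1 * e4, 6 * e1 * e3 + 48 * e4 - 4 * e2^2,
      4 * e1 * e2 - 24 * e3, 8 * e2 - 3 * e1^2:]"
proof -
  let ?Q = "[:e4, - e3, e2, - e1, 1:]"
  have "poly (schwarz_quartic ?Q) x = poly [:8 * e2 * e4 - 3 * e3^2, 4 * e2 * e3 - 24 * e1 * e4,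
      6 * e1 * e3 + 48 * e4 - 4 * e2^2, 4 * e1 * e2 - 24 * e3, 8 * e2 - 3 * e1^2:] x" for x :: complex
    unfolding schwarz_quartic_def poly_diff poly_mult poly_power poly_numeral
    by (simp add: pderiv_pCons algebra_simps power2_eq_square)
  then show ?thesis by (simp only: poly_eq_poly_eq_iff[symmetric] fun_eq_iff simp_thms)
qed

context
  fixes a t1 t2 t3 s1 s2 s3 :: complex and Q :: "complex poly"
  assumes dist: "distinct [a, t1, t2, t3]"
    and Q: "Q = [:- a, 1:] * [:- t1, 1:] * [:- t2, 1:] * [:- t3, 1:]"
    and s1: "s1 = (a - t1) + (a - t2) + (a - t3)"
    and s2: "s2 = (a - t1) * (a - t2) + (a - t1) * (a - t3) + (a - t2) * (a - t3)"
    and s3: "s3 = (a - t1) * (a - t2) * (a - t3)"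
begin

lemma root_gap_product_nonzero: "s3 \<noteq> 0" using dist by (auto simp: s3)

lemma poly_monic_quartic: "poly Q x = (x - a) * (x - t1) * (x - t2) * (x - t3)" by (simp add: Q algebra_simps)

lemma wp_form_square_ode:
  assumes b: "b \<noteq> 0" and g: "g2 = wp_g2_param b s1 s2 s3" "g3 = wp_g3_param b s1 s2 s3" "d = wp_shift_param b s1 s2 s3"
    and disc: "g2^3 - 27 * g3^2 \<noteq> 0"
  shows "\<forall>\<^sub>\<approx>z. (deriv (wp_form a b d g2 g3 z0) z)^2 = (- 4 * b / s3) * poly Q (wp_form a b d g2 g3 z0 z)"
  using wp_form_deriv[OF disc b, of a d z0]
proof eventually_elim
  case (elim z)
  let ?f = "wp_form a b d g2 g3 z0 z"
  have fa: "?f \<noteq> a" using elim by simp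
  have x: "wp g2 g3 (z - z0) = d - b / (?f - a)" by (rule wp_form_inverse[OF b refl])
  have "(deriv (wp_form a b d g2 g3 z0) z)^2 * (b / (?f - a)^2)^2 = 4 * (d - b / (?f - a))^3 - g2 * (d - b / (?f - a)) - g3"
    using elim x by simp
  also have "\<dots> = (- 4 * b / s3) * poly Q ?f * (b / (?f - a)^2)^2"
    unfolding g poly_monic_quartic using wp_form_first_integral[of a t1 t2 t3 b ?f] root_gap_product_nonzero b fa
    unfolding s1 s2 s3 g by simp
  finally have e: "(deriv (wp_form a b d g2 g3 z0) z)^2 * (b / (?f - a)^2)^2 = (- 4 * b / s3) * poly Q ?f * (b / (?f - a)^2)^2" .
  have "(b / (?f - a)^2)^2 \<noteq> 0" using b fa by simp
  from mult_right_cancel[OF this] e show ?case by blast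
qed

lemma wp_form_representation:
  assumes K: "K \<noteq> 0" and b: "b = - K * s3 / 4"
    and g: "g2 = wp_g2_param b s1 s2 s3" "g3 = wp_g3_param b s1 s2 s3" "d = wp_shift_param b s1 s2 s3"
    and m: "u meromorphic_on UNIV" and nc: "\<not> (\<exists>k. \<forall>\<^sub>\<approx>z. u z = k)"
    and ode: "\<forall>\<^sub>\<approx>z. (deriv u z)^2 = K * poly Q (u z)"
  shows "g2^3 - 27 * g3^2 \<noteq> 0" "\<exists>z0. \<forall>\<^sub>\<approx>z. u z = wp_form a b d g2 g3 z0 z"
proof -
  have b0: "b \<noteq> 0" and Kb: "K = - 4 * b / s3" using K root_gap_product_nonzero by (auto simp: b)
  show disc: "g2^3 - 27 * g3^2 \<noteq> 0"
    using wp_param_discriminant_nonzero[OF dist b0] by (simp add: g s1 s2 s3)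
  obtain L where L: "is_lattice L" "lattice_g2 L = g2" "lattice_g3 L = g3" "wp g2 g3 = lattice_wp L"
    by (rule wp_eq_lattice_wp[OF disc])
  have ode': "\<forall>\<^sub>\<approx>z. (deriv u z)^2 = 1 * (- 4 * b / s3) * ((u z - a) * (u z - t1) * (u z - t2) * (u z - t3))"
    using ode by eventually_elim (simp add: poly_monic_quartic Kb)
  note inv = inverted_solution_ode[where v="\<lambda>_. 1", OF root_gap_product_nonzero[unfolded s3] b0 m nc ode'[unfolded s3],
      folded s1 s2 s3, folded g]
  have id: "(\<lambda>z::complex. z) holomorphic_on UNIV" by (intro holomorphic_intros)
  have "\<forall>\<^sub>\<approx>z. (deriv (\<lambda>z. d - b / (u z - a)) z)^2 = (deriv (\<lambda>z::complex. z) z)^2 *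
      (4 * (d - b / (u z - a))^3 - lattice_g2 L * (d - b / (u z - a)) - lattice_g3 L)"
    using inv(3) unfolding L(2,3) by simp
  then obtain \<zeta> where "\<forall>\<^sub>\<approx>z. d - b / (u z - a) = lattice_wp L (z + \<zeta>)"
    by (rule lattice_wp_lift[OF L(1) inv(1,2) id])
  then have "\<forall>\<^sub>\<approx>z. u z = wp_form a b d g2 g3 (- \<zeta>) z"
  proof eventually_elim
    case (elim z)
    have "wp g2 g3 (z - (- \<zeta>)) - d = - b / (u z - a)" by (simp add: L(4) elim[symmetric])
    then show ?case using b0 by (cases "u z = a") (simp_all add: wp_form_def)
  qed
  then show "\<exists>z0. \<forall>\<^sub>\<approx>z. u z = wp_form a b d g2 g3 z0 z" by blast
qed

text \<open>Substituting u = a - b/(x - d) in u'^2 = K Q(u) and using the equation for x = wp gives a polynomial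
identity in x of degree three, whose coefficients determine K, d, g2 and g3 in this order.\<close>
lemma wp_form_parameters:
  assumes disc: "g2^3 - 27 * g3^2 \<noteq> 0" and nc: "\<not> (\<exists>k. \<forall>\<^sub>\<approx>z. wp_form a b d g2 g3 z0 z = k)"
    and ode: "\<forall>\<^sub>\<approx>z. (deriv (wp_form a b d g2 g3 z0) z)^2 = K * poly Q (wp_form a b d g2 g3 z0 z)"
  shows "b \<noteq> 0" "K = - 4 * b / s3" "d = wp_shift_param b s1 s2 s3"
    "g2 = wp_g2_param b s1 s2 s3" "g3 = wp_g3_param b s1 s2 s3"
proof -
  show b: "b \<noteq> 0"
  proof
    assume "b = 0"
    then have "\<forall>\<^sub>\<approx>z. wp_form a b d g2 g3 z0 z = a" by (simp add: wp_form_def)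
    then show False using nc by blast
  qed
  note wp = wp_meromorphic_ode[OF disc, of z0]
  define c0 c1 c2 c3 where "c0 = - b * g3 + K * (- (d^3) * s3 - b * d^2 * s2 - b^2 * d * s1 - b^3)"
    and "c1 = - b * g2 + K * (3 * d^2 * s3 + 2 * b * d * s2 + b^2 * s1)"
    and "c2 = K * (- 3 * d * s3 - b * s2)" and "c3 = 4 * b + K * s3"
  have "\<forall>\<^sub>\<approx>z. poly [:c0, c1, c2, c3:] (wp g2 g3 (z - z0)) = 0"
    using wp_form_deriv[OF disc b, of a d z0] ode
  proof eventually_elim
    case (elim z)
    let ?f = "wp_form a b d g2 g3 z0 z"
    define x w where "x = wp g2 g3 (z - z0)" and "w = ?f - a"
    have w0: "w \<noteq> 0" using elim by (simp add: w_def)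
    have "x = d - b / (?f - a)" unfolding x_def by (rule wp_form_inverse[OF b refl])
    then have xd: "x - d = - b / w" by (simp add: w_def)
    have f: "?f - t = w + (a - t)" for t by (simp add: w_def)
    have "b * (4 * x^3 - g2 * x - g3) = b * (K * (w * (w + (a - t1)) * (w + (a - t2)) * (w + (a - t3))) * (b / w^2)^2)"
      using elim by (simp add: poly_monic_quartic f x_def flip: w_def)
    also have "\<dots> = K * (b + (a - t1) * (b / w)) * (b + (a - t2) * (b / w)) * (b + (a - t3) * (b / w))"
      using w0 by (simp add: field_simps power2_eq_square)
    also have "b / w = - (x - d)" using xd by simp
    finally have "b * (4 * x^3 - g2 * x - g3) - K * (b + (a - t1) * (- (x - d))) * (b + (a - t2) * (- (x - d))) * (b + (a - t3) * (- (x - d))) = 0"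
      by simp
    moreover have "poly [:c0, c1, c2, c3:] x
      = b * (4 * x^3 - g2 * x - g3) - K * (b + (a - t1) * (- (x - d))) * (b + (a - t2) * (- (x - d))) * (b + (a - t3) * (- (x - d)))"
      unfolding c0_def c1_def c2_def c3_def s1 s2 s3 by (simp add: algebra_simps power2_eq_square power3_eq_cube)
    ultimately show ?case by (simp add: x_def)
  qed
  from poly_zero_if_vanishes_cosparse[OF wp(1,3) this]
  have z: "c0 = 0" "c1 = 0" "c2 = 0" "c3 = 0" by simp_all
  have "K * s3 = - 4 * b" using z(4) by (simp add: c3_def add_eq_0_iff)
  then show K: "K = - 4 * b / s3" using root_gap_product_nonzero by (simp add: field_simps)
  have c2: "- 3 * d * s3 - b * s2 = 0" using z(3) b root_gap_product_nonzero by (simp add: c2_def K)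
  have "3 * s3 * d = - b * s2 - (- 3 * d * s3 - b * s2)" by (simp add: algebra_simps)
  then have "3 * s3 * d = - b * s2" unfolding c2 by simp
  then show d: "d = wp_shift_param b s1 s2 s3" using root_gap_product_nonzero by (simp add: wp_shift_param_def field_simps)
  have cancel: "y = - 4 / s3 * x" if "b * y = K * x" for x y
  proof -
    have "b * y = b * (- 4 / s3 * x)" using that by (simp add: K)
    then show ?thesis by (rule mult_left_cancel[OF b, THEN iffD1])
  qed
  have "b * g2 = K * (3 * d^2 * s3 + 2 * b * d * s2 + b^2 * s1)" using z(2) by (simp add: c1_def)
  then have "g2 = - 4 / s3 * (3 * d^2 * s3 + 2 * b * d * s2 + b^2 * s1)" by (rule cancel)
  also have "\<dots> = wp_g2_param b s1 s2 s3"
    unfolding d wp_shift_param_def wp_g2_param_def using root_gap_product_nonzero by (simp add: field_simps power2_eq_square)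
  finally show "g2 = wp_g2_param b s1 s2 s3" .
  have "b * g3 = K * (- (d^3) * s3 - b * d^2 * s2 - b^2 * d * s1 - b^3)" using z(1) by (simp add: c0_def)
  then have "g3 = - 4 / s3 * (- (d^3) * s3 - b * d^2 * s2 - b^2 * d * s1 - b^3)" by (rule cancel)
  also have "\<dots> = wp_g3_param b s1 s2 s3"
    unfolding d wp_shift_param_def wp_g3_param_def using root_gap_product_nonzero by (simp add: field_simps power2_eq_square power3_eq_cube)
  finally show "g3 = wp_g3_param b s1 s2 s3" .
qed

section \<open>Explicit relations\<close>

context
  fixes e1 e2 e3 e4 :: complex
  assumes e1: "e1 = a + t1 + t2 + t3"
    and e2: "e2 = a * t1 + a * t2 + a * t3 + t1 * t2 + t1 * t3 + t2 * t3"
    and e3: "e3 = a * t1 * t2 + a * t1 * t3 + a * t2 * t3 + t1 * t2 * t3"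
    and e4: "e4 = a * t1 * t2 * t3"
begin

text \<open>Expressing the symmetric functions of all four roots by a and those of the differences keeps the
expansions below small.\<close>
lemma symmetric_shift:
  "e1 = 4 * a - s1" "e2 = 6 * a^2 - 3 * a * s1 + s2" "e3 = 4 * a^3 - 3 * a^2 * s1 + 2 * a * s2 - s3"
  "e4 = a^4 - a^3 * s1 + a^2 * s2 - a * s3"
  unfolding e1 e2 e3 e4 s1 s2 s3 by (simp_all add: algebra_simps power_numeral_reduce)

lemma wp_shift_param_symmetric:
  "wp_shift_param b s1 s2 s3 = b / (6 * s3) *
    (((t1 - t2)^2 + (t1 - t3)^2 + (t2 - t3)^2) - (2 * (a - t1)^2 + 2 * (a - t2)^2 + 2 * (a - t3)^2))"
proof -
  have h: "((t1 - t2)^2 + (t1 - t3)^2 + (t2 - t3)^2) - (2 * (a - t1)^2 + 2 * (a - t2)^2 + 2 * (a - t3)^2) = - 2 * s2"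
    unfolding s2 by (simp add: algebra_simps power2_eq_square)
  show ?thesis unfolding h wp_shift_param_def using root_gap_product_nonzero by (simp add: field_simps)
qed

lemma wp_g2_param_symmetric:
  "wp_g2_param b s1 s2 s3 = 4 * b^2 / (3 * s3^2) * (e2^2 - 3 * e1 * e3 + 12 * e4)"
proof -
  have "s2^2 - 3 * s1 * s3 = e2^2 - 3 * e1 * e3 + 12 * e4"
    unfolding symmetric_shift by (simp add: algebra_simps power_numeral_reduce)
  then show ?thesis by (simp add: wp_g2_param_def)
qed

lemma wp_g3_param_symmetric:
  "wp_g3_param b s1 s2 s3 = 4 * b^3 / (27 * s3^3) *
    (2 * e2^3 - 9 * e1 * e2 * e3 - 72 * e2 * e4 + 27 * e3^2 + 27 * e1^2 * e4)"
proof -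
  have "2 * s2^3 - 9 * s1 * s2 * s3 + 27 * s3^2 = 2 * e2^3 - 9 * e1 * e2 * e3 - 72 * e2 * e4 + 27 * e3^2 + 27 * e1^2 * e4"
    unfolding symmetric_shift by (simp add: algebra_simps power_numeral_reduce)
  then show ?thesis by (simp add: wp_g3_param_def)
qed

lemma wp_discriminant_symmetric:
  "wp_g2_param b s1 s2 s3 ^ 3 - 27 * wp_g3_param b s1 s2 s3 ^ 2 = 16 * b^6 / s3^6 *
    ((a - t1)^2 * (a - t2)^2 * (a - t3)^2 * (t1 - t2)^2 * (t1 - t3)^2 * (t2 - t3)^2)"
proof -
  have "s3^2 * (((a - t1) - (a - t2)) * ((a - t1) - (a - t3)) * ((a - t2) - (a - t3)))^2
     = (a - t1)^2 * (a - t2)^2 * (a - t3)^2 * (t1 - t2)^2 * (t1 - t3)^2 * (t2 - t3)^2"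
    unfolding s3 by (simp add: power_mult_distrib power2_commute mult_ac)
  then show ?thesis
    using wp_param_discriminant[of "a - t1" "a - t2" "a - t3" b, folded s1 s2 s3, OF root_gap_product_nonzero] by simp
qed

context
  fixes P :: "complex poly" and R :: "complex \<Rightarrow> complex" and r0 r1 r2 r3 r4 :: complex
  assumes P: "P = [:r0, r1, r2, r3, r4:]"
    and degP: "degree P = 4"
    and cop: "\<And>t. poly Q t = 0 \<Longrightarrow> poly P t \<noteq> 0"
    and R: "\<And>x. R x = poly P x / poly Q x"
begin

lemma Schwarzian_solution_iff:
  "Schwarzian_solution R u \<longleftrightarrow> u meromorphic_on UNIV \<and> \<not> (\<exists>k. \<forall>\<^sub>\<approx>z. u z = k) \<and>
     (\<forall>\<^sub>\<approx>z. Schwarzian u z = poly P (u z) / poly Q (u z))"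
  by (simp add: Schwarzian_solution_def R)

lemma numerator_relations:
  "P = smult (- b / (2 * s3)) (schwarz_quartic Q) \<longleftrightarrow>
     r0 = b / (2 * s3) * (3 * e3 ^ 2 - 8 * e2 * e4) \<and>
     r1 = 2 * b / s3 * (6 * e1 * e4 - e2 * e3) \<and>
     r2 = b / s3 * (2 * e2 ^ 2 - 3 * e1 * e3 - 24 * e4) \<and>
     r3 = 2 * b / s3 * (6 * e3 - e1 * e2) \<and>
     r4 = b / (2 * s3) * (3 * e1 ^ 2 - 8 * e2)"
proof -
  have Qe: "Q = [:e4, - e3, e2, - e1, 1:]"
    unfolding Q e1 e2 e3 e4 by (simp add: algebra_simps)
  have "- b / (2 * s3) * (8 * e2 * e4 - 3 * e3^2) = b / (2 * s3) * (3 * e3 ^ 2 - 8 * e2 * e4)"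
    "- b / (2 * s3) * (4 * e2 * e3 - 24 * e1 * e4) = 2 * b / s3 * (6 * e1 * e4 - e2 * e3)"
    "- b / (2 * s3) * (6 * e1 * e3 + 48 * e4 - 4 * e2^2) = b / s3 * (2 * e2 ^ 2 - 3 * e1 * e3 - 24 * e4)"
    "- b / (2 * s3) * (4 * e1 * e2 - 24 * e3) = 2 * b / s3 * (6 * e3 - e1 * e2)"
    "- b / (2 * s3) * (8 * e2 - 3 * e1^2) = b / (2 * s3) * (3 * e1 ^ 2 - 8 * e2)"
    using root_gap_product_nonzero by (simp_all add: divide_simps) (simp_all add: algebra_simps)
  then show ?thesis unfolding Qe P schwarz_quartic_pCons by (simp only: smult_pCons pCons_eq_iff smult_0_right simp_thms)
qed

lemma wp_form_is_solution:
  assumes b: "b \<noteq> 0" and disc: "g2^3 - 27 * g3^2 \<noteq> 0"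
    and P': "P = smult (- b / (2 * s3)) (schwarz_quartic Q)"
    and g: "g2 = wp_g2_param b s1 s2 s3" "g3 = wp_g3_param b s1 s2 s3" "d = wp_shift_param b s1 s2 s3"
  shows "Schwarzian_solution R (wp_form a b d g2 g3 z0)"
proof -
  let ?f = "wp_form a b d g2 g3 z0"
  note m = wp_form_meromorphic[OF disc, of a b d z0] and nc = wp_form_nonconstant[OF disc b, of a d z0]
  have ode: "\<forall>\<^sub>\<approx>z. (deriv ?f z)^2 = (- 4 * b / s3) * poly Q (?f z)"
    by (rule wp_form_square_ode[OF b g disc])
  have "\<forall>\<^sub>\<approx>z. Schwarzian ?f z = poly P (?f z) / poly Q (?f z)"
    using Schwarzian_of_square_ode[OF m nc ode]
  proof eventually_elim
    case (elim z)
    show ?case unfolding elim P' poly_smult by simp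
  qed
  then show ?thesis using Schwarzian_solution_iff m nc by blast
qed

lemma Schwarzian_solution_square_ode:
  assumes u: "Schwarzian_solution R u"
  obtains b where "b \<noteq> 0" "\<forall>\<^sub>\<approx>z. (deriv u z)^2 = (- 4 * b / s3) * poly Q (u z)"
    "P = smult (- b / (2 * s3)) (schwarz_quartic Q)"
proof -
  have u': "u meromorphic_on UNIV" "\<not> (\<exists>k. \<forall>\<^sub>\<approx>z. u z = k)" "\<forall>\<^sub>\<approx>z. Schwarzian u z = poly P (u z) / poly Q (u z)"
    using u Schwarzian_solution_iff by blast+
  show ?thesis
  proof (rule Schwarzian_first_integral[OF dist Q degP cop u'])
    fix K assume K: "K \<noteq> 0" "\<forall>\<^sub>\<approx>z. (deriv u z)^2 = K * poly Q (u z)" "P = smult (K / 8) (schwarz_quartic Q)"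
    define b where "b = - K * s3 / 4"
    have "K = - 4 * b / s3" "K / 8 = - b / (2 * s3)" using root_gap_product_nonzero by (simp_all add: b_def)
    then show ?thesis using K root_gap_product_nonzero by (intro that[of b]) (auto simp: b_def)
  qed
qed

lemma wp_form_solution_iff:
  "(g2^3 - 27 * g3^2 \<noteq> 0 \<and> (\<exists>z0. Schwarzian_solution R (wp_form a b d g2 g3 z0))) \<longleftrightarrow>
   (P = smult (- b / (2 * s3)) (schwarz_quartic Q) \<and> d = wp_shift_param b s1 s2 s3 \<and>
     g2 = wp_g2_param b s1 s2 s3 \<and> g3 = wp_g3_param b s1 s2 s3 \<and> g2^3 - 27 * g3^2 \<noteq> 0)"
proof safe
  fix z0 assume disc: "g2^3 - 27 * g3^2 \<noteq> 0" and sol: "Schwarzian_solution R (wp_form a b d g2 g3 z0)"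
  have nc: "\<not> (\<exists>k. \<forall>\<^sub>\<approx>z. wp_form a b d g2 g3 z0 z = k)" using sol Schwarzian_solution_iff by blast
  obtain b' where b': "\<forall>\<^sub>\<approx>z. (deriv (wp_form a b d g2 g3 z0) z)^2 = (- 4 * b' / s3) * poly Q (wp_form a b d g2 g3 z0 z)"
    "P = smult (- b' / (2 * s3)) (schwarz_quartic Q)"
    by (rule Schwarzian_solution_square_ode[OF sol])
  note p = wp_form_parameters[OF disc nc b'(1)]
  have "b' = b" using p(2) root_gap_product_nonzero by simp
  then show "P = smult (- b / (2 * s3)) (schwarz_quartic Q)" using b'(2) by simp
  show "d = wp_shift_param b s1 s2 s3" "g2 = wp_g2_param b s1 s2 s3" "g3 = wp_g3_param b s1 s2 s3"
    using p(3-5) by blast+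
next
  assume P': "P = smult (- b / (2 * s3)) (schwarz_quartic Q)"
    and disc: "wp_g2_param b s1 s2 s3 ^ 3 - 27 * wp_g3_param b s1 s2 s3 ^ 2 \<noteq> 0"
  have "b \<noteq> 0"
  proof
    assume "b = 0"
    then show False using disc by (simp add: wp_g2_param_def wp_g3_param_def)
  qed
  then show "\<exists>z0. Schwarzian_solution R (wp_form a b (wp_shift_param b s1 s2 s3) (wp_g2_param b s1 s2 s3) (wp_g3_param b s1 s2 s3) z0)"
    using wp_form_is_solution[OF _ disc P' refl refl refl] by blast
qed

text \<open>The constants are the same for all solutions because P determines the factor K, and with it b.\<close>
lemma Schwarzian_solutions_are_wp_forms:
  "\<exists>b d g2 g3. \<forall>u. Schwarzian_solution R u \<longrightarrow> elliptic u \<and> g2 ^ 3 - 27 * g3 ^ 2 \<noteq> 0 \<and>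
     (\<exists>z0. \<forall>\<^sub>\<approx>z. u z = wp_form a b d g2 g3 z0 z) \<and> (\<forall>z0. Schwarzian_solution R (wp_form a b d g2 g3 z0))"
proof -
  define b where "b = (SOME b. P = smult (- b / (2 * s3)) (schwarz_quartic Q))"
  define d g2 g3 where "d = wp_shift_param b s1 s2 s3" and "g2 = wp_g2_param b s1 s2 s3" and "g3 = wp_g3_param b s1 s2 s3"
  show ?thesis
  proof (rule exI[of _ b], rule exI[of _ d], rule exI[of _ g2], rule exI[of _ g3], rule allI, rule impI)
    fix u assume u: "Schwarzian_solution R u"
    have um: "u meromorphic_on UNIV" and nc: "\<not> (\<exists>k. \<forall>\<^sub>\<approx>z. u z = k)" using u Schwarzian_solution_iff by blast+
    obtain b' where b': "b' \<noteq> 0" "\<forall>\<^sub>\<approx>z. (deriv u z)^2 = (- 4 * b' / s3) * poly Q (u z)"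
      "P = smult (- b' / (2 * s3)) (schwarz_quartic Q)"
      by (rule Schwarzian_solution_square_ode[OF u])
    have Pb: "P = smult (- b / (2 * s3)) (schwarz_quartic Q)" unfolding b_def
      by (rule someI[of "\<lambda>b. P = smult (- b / (2 * s3)) (schwarz_quartic Q)", OF b'(3)])
    have "P \<noteq> 0" using degP by auto
    then have "schwarz_quartic Q \<noteq> 0" using Pb by auto
    moreover have "smult (- b / (2 * s3) - - b' / (2 * s3)) (schwarz_quartic Q) = 0"
      using Pb b'(3) by (metis diff_self smult_diff_left)
    ultimately have "- b / (2 * s3) = - b' / (2 * s3)" by (metis right_minus_eq smult_eq_0_iff)
    then have bb: "b' = b" using root_gap_product_nonzero by simp
    have b0: "b \<noteq> 0" using b'(1) bb by simp
    define K where "K = - 4 * b / s3"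
    have K: "K \<noteq> 0" "b = - K * s3 / 4" using b0 root_gap_product_nonzero by (simp_all add: K_def)
    have ode: "\<forall>\<^sub>\<approx>z. (deriv u z)^2 = K * poly Q (u z)" using b'(2) unfolding bb K_def .
    note rep = wp_form_representation[OF K g2_def g3_def d_def um nc ode]
    obtain z0 where z0: "\<forall>\<^sub>\<approx>z. u z = wp_form a b d g2 g3 z0 z" using rep(2) by blast
    show "elliptic u \<and> g2 ^ 3 - 27 * g3 ^ 2 \<noteq> 0 \<and>
       (\<exists>z0. \<forall>\<^sub>\<approx>z. u z = wp_form a b d g2 g3 z0 z) \<and> (\<forall>z0. Schwarzian_solution R (wp_form a b d g2 g3 z0))"
      using wp_form_elliptic[OF rep(1) um z0] rep wp_form_is_solution[OF b0 rep(1) Pb g2_def g3_def d_def] by blast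
  qed
qed

lemma wp_form_solution_iff_symmetric:
  "(g2^3 - 27 * g3^2 \<noteq> 0 \<and> (\<exists>z0. Schwarzian_solution R (wp_form a b d g2 g3 z0))) \<longleftrightarrow>
   (r0 = b / (2 * s3) * (3 * e3 ^ 2 - 8 * e2 * e4) \<and>
    r1 = 2 * b / s3 * (6 * e1 * e4 - e2 * e3) \<and>
    r2 = b / s3 * (2 * e2 ^ 2 - 3 * e1 * e3 - 24 * e4) \<and>
    r3 = 2 * b / s3 * (6 * e3 - e1 * e2) \<and>
    r4 = b / (2 * s3) * (3 * e1 ^ 2 - 8 * e2) \<and>
    d = b / (6 * s3) * (((t1 - t2)^2 + (t1 - t3)^2 + (t2 - t3)^2) - (2 * (a - t1)^2 + 2 * (a - t2)^2 + 2 * (a - t3)^2)) \<and>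
    g2 = 4 * b ^ 2 / (3 * s3 ^ 2) * (e2 ^ 2 - 3 * e1 * e3 + 12 * e4) \<and>
    g3 = 4 * b ^ 3 / (27 * s3 ^ 3) *
           (2 * e2 ^ 3 - 9 * e1 * e2 * e3 - 72 * e2 * e4 + 27 * e3 ^ 2 + 27 * e1 ^ 2 * e4) \<and>
    g2 ^ 3 - 27 * g3 ^ 2 = 16 * b ^ 6 / s3 ^ 6 *
      ((a - t1)^2 * (a - t2)^2 * (a - t3)^2 * (t1 - t2)^2 * (t1 - t3)^2 * (t2 - t3)^2) \<and>
    g2 ^ 3 - 27 * g3 ^ 2 \<noteq> 0)"
  unfolding wp_form_solution_iff numerator_relations
    wp_shift_param_symmetric[symmetric] wp_g2_param_symmetric[symmetric] wp_g3_param_symmetric[symmetric]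
    wp_discriminant_symmetric[symmetric]
  by blast

end

end

end

theorem theorem3:
  fixes c :: complex and \<tau> \<sigma> r q :: "nat \<Rightarrow> complex" and e1 e2 e3 e4 :: complex
    and R :: "complex \<Rightarrow> complex"
  assumes c: "c \<noteq> 0"
    and \<tau>: "inj_on \<tau> {1..4}"
    and \<sigma>: "\<forall>j\<in>{1..4}. \<forall>k\<in>{1..4}. \<sigma> j \<noteq> \<tau> k"
    and r: "\<forall>x. c * (\<Prod>j=1..4. x - \<sigma> j) = r 4 * x ^ 4 + r 3 * x ^ 3 + r 2 * x ^ 2 + r 1 * x + r 0"
    and R: "\<forall>x. R x = c * ((\<Prod>j=1..4. x - \<sigma> j) / (\<Prod>j=1..4. x - \<tau> j))"
    and e1: "e1 = (\<Sum>j\<in>{1..4}. \<tau> j)"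
    and e2: "e2 = (\<Sum>j\<in>{1..4}. \<Sum>k\<in>{j<..4}. \<tau> j * \<tau> k)"
    and e3: "e3 = (\<Sum>j\<in>{1..4}. \<Sum>k\<in>{j<..4}. \<Sum>l\<in>{k<..4}. \<tau> j * \<tau> k * \<tau> l)"
    and e4: "e4 = (\<Prod>j\<in>{1..4}. \<tau> j)"
    and q: "\<forall>i\<in>{1..4}. q i = (\<Prod>j\<in>{1..4} - {i}. \<tau> i - \<tau> j)"
  shows
    "(\<exists>b d g2 g3 :: nat \<Rightarrow> complex. \<forall>u. Schwarzian_solution R u \<and> transcendental u \<longrightarrow>
        elliptic u \<and>
        (\<exists>i\<in>{1..4}. g2 i ^ 3 - 27 * g3 i ^ 2 \<noteq> 0 \<and>
           (\<exists>z0. \<forall>\<^sub>\<approx>z. u z = wp_form (\<tau> i) (b i) (d i) (g2 i) (g3 i) z0 z) \<and>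
           (\<forall>z0. Schwarzian_solution R (wp_form (\<tau> i) (b i) (d i) (g2 i) (g3 i) z0))))
     \<and>
     (\<forall>i\<in>{1..4}. \<forall>b d g2 g3 :: complex.
        (g2 ^ 3 - 27 * g3 ^ 2 \<noteq> 0 \<and> (\<exists>z0. Schwarzian_solution R (wp_form (\<tau> i) b d g2 g3 z0)))
        \<longleftrightarrow>
        (r 0 = b / (2 * q i) * (3 * e3 ^ 2 - 8 * e2 * e4) \<and>
         r 1 = 2 * b / q i * (6 * e1 * e4 - e2 * e3) \<and>
         r 2 = b / q i * (2 * e2 ^ 2 - 3 * e1 * e3 - 24 * e4) \<and>
         r 3 = 2 * b / q i * (6 * e3 - e1 * e2) \<and>
         r 4 = b / (2 * q i) * (3 * e1 ^ 2 - 8 * e2) \<and>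
         d = b / (6 * q i) *
               ((\<Sum>j\<in>{1..4} - {i}. \<Sum>k\<in>{j<..4} - {i}. (\<tau> j - \<tau> k) ^ 2)
                - (\<Sum>j\<in>{1..4} - {i}. 2 * (\<tau> i - \<tau> j) ^ 2)) \<and>
         g2 = 4 * b ^ 2 / (3 * q i ^ 2) * (e2 ^ 2 - 3 * e1 * e3 + 12 * e4) \<and>
         g3 = 4 * b ^ 3 / (27 * q i ^ 3) *
                (2 * e2 ^ 3 - 9 * e1 * e2 * e3 - 72 * e2 * e4 + 27 * e3 ^ 2 + 27 * e1 ^ 2 * e4) \<and>
         g2 ^ 3 - 27 * g3 ^ 2 =
           16 * b ^ 6 / q i ^ 6 * (\<Prod>j\<in>{1..4}. \<Prod>k\<in>{j<..4}. (\<tau> j - \<tau> k) ^ 2) \<and>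
         g2 ^ 3 - 27 * g3 ^ 2 \<noteq> 0))"
proof -
  have dist: "distinct [\<tau> 1, \<tau> 2, \<tau> 3, \<tau> 4]"
  proof -
    have "\<tau> i \<noteq> \<tau> j" if "i \<in> {1..4}" "j \<in> {1..4}" "i \<noteq> j" for i j using inj_onD[OF \<tau>, of i j] that by blast
    from this[of 1 2] this[of 1 3] this[of 1 4] this[of 2 3] this[of 2 4] this[of 3 4] show ?thesis by simp
  qed
  have I: "{1..4::nat} = {1, 2, 3, 4}" "{Suc 0..4} = {1, 2, 3, 4}" by auto
  have J: "{1<..4::nat} = {2, 3, 4}" "{Suc 0<..4::nat} = {2, 3, 4}" "{2<..4::nat} = {3, 4}" "{3<..4::nat} = {4}" "{4<..4::nat} = {}" by auto
  have e1': "e1 = \<tau> 1 + \<tau> 2 + \<tau> 3 + \<tau> 4" by (simp add: e1 I)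
  have e2': "e2 = \<tau> 1 * \<tau> 2 + \<tau> 1 * \<tau> 3 + \<tau> 1 * \<tau> 4 + \<tau> 2 * \<tau> 3 + \<tau> 2 * \<tau> 4 + \<tau> 3 * \<tau> 4"
    by (simp add: e2 I J)
  have e3': "e3 = \<tau> 1 * \<tau> 2 * \<tau> 3 + \<tau> 1 * \<tau> 2 * \<tau> 4 + \<tau> 1 * \<tau> 3 * \<tau> 4 + \<tau> 2 * \<tau> 3 * \<tau> 4"
    by (simp add: e3 I J)
  have e4': "e4 = \<tau> 1 * \<tau> 2 * \<tau> 3 * \<tau> 4" by (simp add: e4 I)
  have D: "(\<Prod>j\<in>{1..4}. \<Prod>k\<in>{j<..4}. (\<tau> j - \<tau> k) ^ 2) =
      (\<tau> 1 - \<tau> 2)^2 * (\<tau> 1 - \<tau> 3)^2 * (\<tau> 1 - \<tau> 4)^2 * (\<tau> 2 - \<tau> 3)^2 * (\<tau> 2 - \<tau> 4)^2 * (\<tau> 3 - \<tau> 4)^2"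
    by (simp add: I J)
  define P where "P = [:r 0, r 1, r 2, r 3, r 4:]"
  define Q where "Q = [:- \<tau> 1, 1:] * [:- \<tau> 2, 1:] * [:- \<tau> 3, 1:] * [:- \<tau> 4, 1:]"
  have Px: "poly P x = c * (\<Prod>j=1..4. x - \<sigma> j)" for x
    using r[rule_format, of x] by (simp add: P_def algebra_simps power_numeral_reduce)
  have Qx: "poly Q x = (\<Prod>j=1..4. x - \<tau> j)" for x by (simp add: Q_def I algebra_simps)
  have "P = smult c ([:- \<sigma> 1, 1:] * [:- \<sigma> 2, 1:] * [:- \<sigma> 3, 1:] * [:- \<sigma> 4, 1:])"
  proof -
    have "poly P x = poly (smult c ([:- \<sigma> 1, 1:] * [:- \<sigma> 2, 1:] * [:- \<sigma> 3, 1:] * [:- \<sigma> 4, 1:])) x" for x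
      unfolding Px poly_smult poly_mult by (simp add: I mult_ac)
    then show ?thesis by (simp only: poly_eq_poly_eq_iff[symmetric] fun_eq_iff simp_thms)
  qed
  then have degP: "degree P = 4" using c by simp
  have cop: "poly P t \<noteq> 0" if tq: "poly Q t = 0" for t
  proof -
    obtain k where k: "k \<in> {1..4}" "t = \<tau> k" using tq unfolding Qx by auto
    have "(\<Prod>j=1..4. \<tau> k - \<sigma> j) \<noteq> 0"
    proof
      assume "(\<Prod>j=1..4. \<tau> k - \<sigma> j) = 0"
      then have "\<exists>j\<in>{1..4}. \<tau> k - \<sigma> j = 0"
        using prod_zero_iff[of "{1..4::nat}" "\<lambda>j. \<tau> k - \<sigma> j"] finite_atLeastAtMost by blast
      then obtain j where j: "j \<in> {1..4}" "\<sigma> j = \<tau> k" by auto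
      then show False using \<sigma> k(1) by blast
    qed
    then show ?thesis unfolding Px k(2) using c by simp
  qed
  have RPQ: "R x = poly P x / poly Q x" for x unfolding Px Qx using R by simp
  \<comment> \<open>Every root tau_i may be the one sent to infinity; the first one is used.\<close>
  have part1: "\<exists>b d g2 g3. \<forall>u. Schwarzian_solution R u \<longrightarrow> elliptic u \<and> g2 ^ 3 - 27 * g3 ^ 2 \<noteq> 0 \<and>
     (\<exists>z0. \<forall>\<^sub>\<approx>z. u z = wp_form (\<tau> 1) b d g2 g3 z0 z) \<and> (\<forall>z0. Schwarzian_solution R (wp_form (\<tau> 1) b d g2 g3 z0))"
    by (rule Schwarzian_solutions_are_wp_forms[OF dist Q_def refl refl refl e1' e2' e3' e4' P_def degP cop RPQ])
  show ?thesis
  proof (intro conjI ballI allI)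
    obtain b d g2 g3 where H: "\<forall>u. Schwarzian_solution R u \<longrightarrow> elliptic u \<and> g2 ^ 3 - 27 * g3 ^ 2 \<noteq> 0 \<and>
     (\<exists>z0. \<forall>\<^sub>\<approx>z. u z = wp_form (\<tau> 1) b d g2 g3 z0 z) \<and> (\<forall>z0. Schwarzian_solution R (wp_form (\<tau> 1) b d g2 g3 z0))"
      using part1 by blast
    show "\<exists>b d g2 g3 :: nat \<Rightarrow> complex. \<forall>u. Schwarzian_solution R u \<and> transcendental u \<longrightarrow>
        elliptic u \<and>
        (\<exists>i\<in>{1..4}. g2 i ^ 3 - 27 * g3 i ^ 2 \<noteq> 0 \<and>
           (\<exists>z0. \<forall>\<^sub>\<approx>z. u z = wp_form (\<tau> i) (b i) (d i) (g2 i) (g3 i) z0 z) \<and>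
           (\<forall>z0. Schwarzian_solution R (wp_form (\<tau> i) (b i) (d i) (g2 i) (g3 i) z0)))"
    proof (rule exI[of _ "\<lambda>_. b"], rule exI[of _ "\<lambda>_. d"], rule exI[of _ "\<lambda>_. g2"], rule exI[of _ "\<lambda>_. g3"],
        intro allI impI)
      fix u assume "Schwarzian_solution R u \<and> transcendental u"
      then have sol: "Schwarzian_solution R u" by blast
      from H[rule_format, OF sol]
      have el: "elliptic u" and w: "g2 ^ 3 - 27 * g3 ^ 2 \<noteq> 0 \<and> (\<exists>z0. \<forall>\<^sub>\<approx>z. u z = wp_form (\<tau> 1) b d g2 g3 z0 z) \<and>
          (\<forall>z0. Schwarzian_solution R (wp_form (\<tau> 1) b d g2 g3 z0))"
        by (rule conjunct1, rule conjunct2)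
      show "elliptic u \<and> (\<exists>i\<in>{1..4}. g2 ^ 3 - 27 * g3 ^ 2 \<noteq> 0 \<and>
           (\<exists>z0. \<forall>\<^sub>\<approx>z. u z = wp_form (\<tau> i) b d g2 g3 z0 z) \<and>
           (\<forall>z0. Schwarzian_solution R (wp_form (\<tau> i) b d g2 g3 z0)))"
        by (rule conjI[OF el], rule bexI[of _ 1], rule w, simp)
    qed
  next
    fix i and b d g2 g3 :: complex
    assume i: "i \<in> {1..4::nat}"
    have "\<exists>j k l. {1..4} - {i} = {j, k, l} \<and> ((i = 1 \<and> j = 2 \<and> k = 3 \<and> l = 4) \<or> (i = 2 \<and> j = 1 \<and> k = 3 \<and> l = 4) \<or>
        (i = 3 \<and> j = 1 \<and> k = 2 \<and> l = 4) \<or> (i = 4 \<and> j = 1 \<and> k = 2 \<and> l = 3))"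
    proof -
      have "i = 1 \<or> i = 2 \<or> i = 3 \<or> i = 4" using i by fastforce
      moreover have "{1..4} - {1} = {2, 3, 4::nat}" "{1..4} - {2} = {1, 3, 4::nat}"
        "{1..4} - {3} = {1, 2, 4::nat}" "{1..4} - {4} = {1, 2, 3::nat}" by auto
      ultimately show ?thesis by metis
    qed
    then obtain j k l where jkl: "{1..4} - {i} = {j, k, l}" and four: "(i = 1 \<and> j = 2 \<and> k = 3 \<and> l = 4) \<or> (i = 2 \<and> j = 1 \<and> k = 3 \<and> l = 4) \<or>
        (i = 3 \<and> j = 1 \<and> k = 2 \<and> l = 4) \<or> (i = 4 \<and> j = 1 \<and> k = 2 \<and> l = 3)"
      by (elim exE conjE)
    have lt: "j < k" "k < l" using four by auto
    have dist': "distinct [\<tau> i, \<tau> j, \<tau> k, \<tau> l]" using four dist by auto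
    have ee: "e1 = \<tau> i + \<tau> j + \<tau> k + \<tau> l"
      "e2 = \<tau> i * \<tau> j + \<tau> i * \<tau> k + \<tau> i * \<tau> l + \<tau> j * \<tau> k + \<tau> j * \<tau> l + \<tau> k * \<tau> l"
      "e3 = \<tau> i * \<tau> j * \<tau> k + \<tau> i * \<tau> j * \<tau> l + \<tau> i * \<tau> k * \<tau> l + \<tau> j * \<tau> k * \<tau> l"
      "e4 = \<tau> i * \<tau> j * \<tau> k * \<tau> l"
      using four by (auto simp: e1' e2' e3' e4' algebra_simps)
    have Qi: "Q = [:- \<tau> i, 1:] * [:- \<tau> j, 1:] * [:- \<tau> k, 1:] * [:- \<tau> l, 1:]"
      using four by (elim disjE conjE) (simp_all only: Q_def mult_ac)
    have qi: "q i = (\<tau> i - \<tau> j) * (\<tau> i - \<tau> k) * (\<tau> i - \<tau> l)"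
      using q[rule_format, OF i] lt unfolding jkl by (simp add: mult.assoc)
    have Di: "(\<Prod>j\<in>{1..4}. \<Prod>k\<in>{j<..4}. (\<tau> j - \<tau> k) ^ 2) =
       (\<tau> i - \<tau> j)^2 * (\<tau> i - \<tau> k)^2 * (\<tau> i - \<tau> l)^2 * (\<tau> j - \<tau> k)^2 * (\<tau> j - \<tau> l)^2 * (\<tau> k - \<tau> l)^2"
      unfolding D using four by (elim disjE conjE) (simp_all add: power2_commute mult_ac)
    have K: "{j<..4} - {i} = {k, l}" "{k<..4} - {i} = {l}" "{l<..4} - {i} = {}" using four by auto
    have di: "(\<Sum>j\<in>{1..4} - {i}. \<Sum>k\<in>{j<..4} - {i}. (\<tau> j - \<tau> k) ^ 2) = (\<tau> j - \<tau> k)^2 + (\<tau> j - \<tau> l)^2 + (\<tau> k - \<tau> l)^2"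
      "(\<Sum>j\<in>{1..4} - {i}. 2 * (\<tau> i - \<tau> j) ^ 2) = 2 * (\<tau> i - \<tau> j)^2 + 2 * (\<tau> i - \<tau> k)^2 + 2 * (\<tau> i - \<tau> l)^2"
      unfolding jkl using lt by (simp_all add: K)
    note main = wp_form_solution_iff_symmetric[OF dist' Qi refl refl qi ee P_def degP cop RPQ]
    show "(g2 ^ 3 - 27 * g3 ^ 2 \<noteq> 0 \<and> (\<exists>z0. Schwarzian_solution R (wp_form (\<tau> i) b d g2 g3 z0)))
        \<longleftrightarrow>
        (r 0 = b / (2 * q i) * (3 * e3 ^ 2 - 8 * e2 * e4) \<and>
         r 1 = 2 * b / q i * (6 * e1 * e4 - e2 * e3) \<and>
         r 2 = b / q i * (2 * e2 ^ 2 - 3 * e1 * e3 - 24 * e4) \<and>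
         r 3 = 2 * b / q i * (6 * e3 - e1 * e2) \<and>
         r 4 = b / (2 * q i) * (3 * e1 ^ 2 - 8 * e2) \<and>
         d = b / (6 * q i) *
               ((\<Sum>j\<in>{1..4} - {i}. \<Sum>k\<in>{j<..4} - {i}. (\<tau> j - \<tau> k) ^ 2)
                - (\<Sum>j\<in>{1..4} - {i}. 2 * (\<tau> i - \<tau> j) ^ 2)) \<and>
         g2 = 4 * b ^ 2 / (3 * q i ^ 2) * (e2 ^ 2 - 3 * e1 * e3 + 12 * e4) \<and>
         g3 = 4 * b ^ 3 / (27 * q i ^ 3) *
                (2 * e2 ^ 3 - 9 * e1 * e2 * e3 - 72 * e2 * e4 + 27 * e3 ^ 2 + 27 * e1 ^ 2 * e4) \<and>
         g2 ^ 3 - 27 * g3 ^ 2 =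
           16 * b ^ 6 / q i ^ 6 * (\<Prod>j\<in>{1..4}. \<Prod>k\<in>{j<..4}. (\<tau> j - \<tau> k) ^ 2) \<and>
         g2 ^ 3 - 27 * g3 ^ 2 \<noteq> 0)"
      unfolding di Di by (rule main)
  qed
qed

end
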